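(* Let $\mathsf Q$ be a Gray presentation such that $\mathsf Q_2$ and $\mathsf Q_3$ are finite and $|\partial^-_2(A)|>0$ for every $A\in\mathsf Q_3$. Then there is a finite number of local branchings $(S_1,S_2)$, with rewriting steps $S_1,S_2\in\mathsf Q_3^*$, such that $(S_1,S_2)$ is a critical branching.
   Context: **Precategories.** An $n$-precategory is an $n$-globular set $C$ (sets $C_0,\dots,C_n$ with source/target maps $\partial^-_i,\partial^+_i:C_{i+1}\to C_i$ satisfying the globular identities; $\partial^\epsilon_i$ also denotes iterated source/target) with identities $\mathrm{id}:C_{k-1}\to C_k$ and compositions $u\ast_i v\in C_{\max(k,l)}$ for $u\in C_k$, $v\in C_l$, $k,l>0$, $i=\min(k,l)-1$, $\partial^+_i(u)=\partial^-_i(v)$ ("$i$-composable"), such that: $\partial^\pm(\mathrm{id}_u)=u$; $\partial^\epsilon(u\ast_i v)$ is $u\ast_i\partial^\epsilon v$ if $k<l$, $\partial^\epsilon u\ast_i v$ if $k>l$, and $\partial^-u$ (resp. $\partial^+v$) for $\epsilon=-$ (resp. $+$) if $k=l$; composing with an identity on a cell of dimension $i$ via $\ast_i$ is trivial, and $\mathrm{id}_u\ast_i v=\mathrm{id}_{u\ast_i v}$, $v\ast_i\mathrm{id}_u=\mathrm{id}_{v\ast_i u}$ when $\dim u>i$ and $\dim v=i+1$; each $\ast_i$ is associative whenever both sides are defined; for $i<j$ and $u$ of dimension $i+1$, $u\ast_i(v\ast_j v')=(u\ast_i v)\ast_j(u\ast_i v')$ and $(v\ast_j v')\ast_i u=(v\ast_i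 u)\ast_j(v'\ast_i u)$ whenever the left sides are defined. **Prepolygraphs.** A $0$-prepolygraph is a set $\mathsf P_0$, with $\mathsf P^*_0=\mathsf P_0$. An $(n+1)$-prepolygraph is an $n$-prepolygraph $(\mathsf P_0,\dots,\mathsf P_n)$, generating a free $n$-precategory with $i$-cells $\mathsf P^*_i$, together with a set $\mathsf P_{n+1}$ of $(n+1)$-generators with source and target in $\mathsf P^*_n$ (parallel if $n\ge1$); its free $(n+1)$-precategory $\mathsf P^*$ is obtained by freely adjoining the elements of $\mathsf P_{n+1}$ as $(n+1)$-cells. $\mathsf P_{\le k}$ is the underlying $k$-prepolygraph. Every $2$-cell of $\mathsf P^*$ is uniquely a $\ast_1$-composite of whiskers $l\ast_0\alpha\ast_0 r$ with $\alpha\in\mathsf P_2$, $l,r\in\mathsf P^*_1$; their number is its length $|\cdot|$. **Gray presentation.** A $4$-prepolygraph $\mathsf Q$ containing, for all $\alpha:f\Rightarrow f'$, $\beta:h\Rightarrow h'$ in $\mathsf Q_2$ and $g\in\mathsf Q^*_1$ with $\alpha,g,\beta$ $0$-composable, a distinguished $3$-generator (interchange generator) $X_{\alpha,g,\beta}:(\alpha\ast_0 g\ast_0 h)\ast_1(f'\ast_0 g\ast_0\beta)\Rrightarrow(f\ast_0 g\ast_0\beta)\ast_1(\alpha\ast_0 g\ast_0 h')$, together with certain distinguished $4$-generators (independence and interchange naturality generators) which play no role in the present statement, since the notions below only involve $\mathsf P=\mathsf Q_{\le3}$. **Elementary swaps.** For $0$-composable $\phi,\psi\in\mathsf Q_2^*$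 with last whisker $\phi_k=f_k\ast_0\alpha_k\ast_0g_k$ of $\phi=\phi_1\ast_1\cdots\ast_1\phi_k$ and first whisker $\psi_1=f'_1\ast_0\beta_1\ast_0g'_1$ of $\psi=\psi_1\ast_1\cdots\ast_1\psi_{k'}$ ($k,k'\ge1$), the elementary swap of the last whisker of $\phi$ with the first whisker of $\psi$, with source $(\phi\ast_0\partial^-_1\psi)\ast_1(\partial^+_1\phi\ast_0\psi)$, is the $3$-cell $\lambda\ast_1(f_k\ast_0X_{\alpha_k,g_k\ast_0f'_1,\beta_1}\ast_0g'_1)\ast_1\rho$ with $\lambda=(\phi_1\ast_1\cdots\ast_1\phi_{k-1})\ast_0\partial^-_1\psi$ and $\rho=\partial^+_1\phi\ast_0(\psi_2\ast_1\cdots\ast_1\psi_{k'})$. **Critical branchings.** A rewriting step is a $3$-cell $\lambda\ast_1(l\ast_0 A\ast_0 r)\ast_1\rho$ with $A\in\mathsf P_3$, $l,r\in\mathsf P_1^*$, $\lambda,\rho\in\mathsf P_2^*$. A local branching is a pair $(S_1,S_2)$ of rewriting steps with the same source; its symmetric branching is $(S_2,S_1)$. It is: trivial if $S_1=S_2$; minimal if whenever $S_i=\lambda\ast_1(l\ast_0S'_i\ast_0r)\ast_1\rho$ ($i=1,2$) for a local branching $(S'_1,S'_2)$, $1$-cells $l,r$ and $2$-cells $\lambda,\rho$, then $l,r,\lambda,\rho$ are identities; independent if $S_1=(l_1\ast_0A_1\ast_0r_1)\ast_1\chi\ast_1(l_2\ast_0\phi_2\ast_0r_2)$ and $S_2=(l_1\ast_0\phi_1\ast_0r_1)\ast_1\chi\ast_1(l_2\ast_0A_2\ast_0r_2)$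 with $A_i:\phi_i\Rrightarrow\phi'_i$ in $\mathsf P_3$; natural if either $S_1=(A\ast_0g\ast_0h)\ast_1(f'\ast_0g\ast_0\psi)$ with $A:\phi\Rrightarrow\phi':f\Rightarrow f'$ in $\mathsf P_3$, $g\in\mathsf P_1^*$, $\psi:h\Rightarrow h'$ in $\mathsf P_2^*$, and $S_2$ is the elementary swap of the last whisker of $\phi$ with the first whisker of $g\ast_0\psi$, or, symmetrically, $S_1=(\phi\ast_0g\ast_0h)\ast_1(f'\ast_0g\ast_0B)$ with $\phi:f\Rightarrow f'$ in $\mathsf P_2^*$, $B:\psi\Rrightarrow\psi':h\Rightarrow h'$ in $\mathsf P_3$ and $S_2$ is the elementary swap of the last whisker of $\phi\ast_0g$ with the first whisker of $\psi$. It is critical if it is minimal and neither it nor its symmetric branching is trivial, independent or natural. *)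

theory Defs
  imports Main
begin

section \<open>Precategories\<close>

datatype sign = Minus | Plus

text \<open>
  The sets of cells of different dimensions are kept disjoint inside one carrier type, so that the
  dimension of a cell need not be passed to the operations. The field \<^term>\<open>bdry\<close> is the iterated
  source or target map onto the given dimension, the identity on cells of that dimension;
  \<^term>\<open>cmp\<close> takes the index \<open>i\<close> of the composition.
\<close>

record 'c precat =
  cells :: "nat \<Rightarrow> 'c set"
  bdry :: "sign \<Rightarrow> nat \<Rightarrow> 'c \<Rightarrow> 'c"
  idt :: "'c \<Rightarrow> 'c"
  cmp :: "nat \<Rightarrow> 'c \<Rightarrow> 'c \<Rightarrow> 'c"

definition composable :: "'c precat \<Rightarrow> nat \<Rightarrow> 'c \<Rightarrow> 'c \<Rightarrow> bool" where
  "composable C i u v \<longleftrightarrow>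
     (\<exists>k l. u \<in> cells C k \<and> v \<in> cells C l \<and> min k l = Suc i) \<and> bdry C Plus i u = bdry C Minus i v"

locale precategory =
  fixes n :: nat and C :: "'c precat"
  assumes cells_above: "k > n \<Longrightarrow> cells C k = {}"
    and cells_disjoint: "u \<in> cells C k \<Longrightarrow> u \<in> cells C l \<Longrightarrow> k = l"
    and bdry_cells: "u \<in> cells C l \<Longrightarrow> k \<le> l \<Longrightarrow> bdry C e k u \<in> cells C k"
    and bdry_same: "u \<in> cells C k \<Longrightarrow> bdry C e k u = u"
    and globular: "u \<in> cells C l \<Longrightarrow> j < k \<Longrightarrow> k \<le> l \<Longrightarrow> bdry C e j (bdry C d k u) = bdry C e j u"
    and idt_cells: "u \<in> cells C k \<Longrightarrow> k < n \<Longrightarrow> idt C u \<in> cells C (Suc k)"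
    and bdry_idt: "u \<in> cells C k \<Longrightarrow> k < n \<Longrightarrow> bdry C e k (idt C u) = u"
    and cmp_cells: "u \<in> cells C k \<Longrightarrow> v \<in> cells C l \<Longrightarrow> composable C i u v \<Longrightarrow>
      cmp C i u v \<in> cells C (max k l)"
    and bdry_cmp_less: "u \<in> cells C k \<Longrightarrow> v \<in> cells C (Suc l) \<Longrightarrow> k < Suc l \<Longrightarrow>
      composable C i u v \<Longrightarrow> bdry C e l (cmp C i u v) = cmp C i u (bdry C e l v)"
    and bdry_cmp_greater: "u \<in> cells C (Suc k) \<Longrightarrow> v \<in> cells C l \<Longrightarrow> l < Suc k \<Longrightarrow>
      composable C i u v \<Longrightarrow> bdry C e k (cmp C i u v) = cmp C i (bdry C e k u) v"
    and bdry_cmp_minus: "u \<in> cells C (Suc k) \<Longrightarrow> v \<in> cells C (Suc k) \<Longrightarrow>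
      composable C k u v \<Longrightarrow> bdry C Minus k (cmp C k u v) = bdry C Minus k u"
    and bdry_cmp_plus: "u \<in> cells C (Suc k) \<Longrightarrow> v \<in> cells C (Suc k) \<Longrightarrow>
      composable C k u v \<Longrightarrow> bdry C Plus k (cmp C k u v) = bdry C Plus k v"
    and idt_left: "u \<in> cells C i \<Longrightarrow> composable C i (idt C u) v \<Longrightarrow> cmp C i (idt C u) v = v"
    and idt_right: "u \<in> cells C i \<Longrightarrow> composable C i v (idt C u) \<Longrightarrow> cmp C i v (idt C u) = v"
    and cmp_idt_left: "u \<in> cells C k \<Longrightarrow> k < n \<Longrightarrow> i < k \<Longrightarrow> v \<in> cells C (Suc i) \<Longrightarrow>
      composable C i (idt C u) v \<Longrightarrow> cmp C i (idt C u) v = idt C (cmp C i u v)"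
    and cmp_idt_right: "u \<in> cells C k \<Longrightarrow> k < n \<Longrightarrow> i < k \<Longrightarrow> v \<in> cells C (Suc i) \<Longrightarrow>
      composable C i v (idt C u) \<Longrightarrow> cmp C i v (idt C u) = idt C (cmp C i v u)"
    and cmp_assoc: "composable C i u v \<Longrightarrow> composable C i (cmp C i u v) w \<Longrightarrow>
      composable C i v w \<Longrightarrow> composable C i u (cmp C i v w) \<Longrightarrow>
      cmp C i (cmp C i u v) w = cmp C i u (cmp C i v w)"
    and distrib_left: "i < j \<Longrightarrow> u \<in> cells C (Suc i) \<Longrightarrow> composable C j v v' \<Longrightarrow>
      composable C i u (cmp C j v v') \<Longrightarrow>
      cmp C i u (cmp C j v v') = cmp C j (cmp C i u v) (cmp C i u v')"
    and distrib_right: "i < j \<Longrightarrow> u \<in> cells C (Suc i) \<Longrightarrow> composable C j v v' \<Longrightarrow>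
      composable C i (cmp C j v v') u \<Longrightarrow>
      cmp C i (cmp C j v v') u = cmp C j (cmp C i v u) (cmp C i v' u)"


section \<open>Freely adjoining generators\<close>

text \<open>
  Let \<open>C\<close> be an \<open>n\<close>-precategory and \<open>G\<close> a set of \<open>(n+1)\<close>-generators with boundaries in the
  \<open>n\<close>-cells of \<open>C\<close>. The new \<open>(n+1)\<close>-cells are the well-formed terms below, modulo the
  least congruence that makes the axioms of precategories hold. Since a composition \<open>*\<^sub>i\<close>
  of an \<open>(n+1)\<close>-cell with a lower cell requires the latter to have dimension \<open>i+1\<close>, the
  terms \<open>LAct\<close> and \<open>RAct\<close> act by cells of \<open>C\<close>.
\<close>

datatype ('c, 'g) tm =
    Gen 'g
  | Idt 'c
  | LAct nat 'c "('c, 'g) tm"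
  | RAct nat "('c, 'g) tm" 'c
  | Comp "('c, 'g) tm" "('c, 'g) tm"

definition attachable :: "nat \<Rightarrow> 'c precat \<Rightarrow> 'g set \<Rightarrow> (sign \<Rightarrow> 'g \<Rightarrow> 'c) \<Rightarrow> bool" where
  "attachable n C G b \<longleftrightarrow>
     (\<forall>g\<in>G. (\<forall>e. b e g \<in> cells C n) \<and>
       (n \<ge> 1 \<longrightarrow> (\<forall>e. bdry C e (n - 1) (b Minus g) = bdry C e (n - 1) (b Plus g))))"

primrec tm_bdry :: "'c precat \<Rightarrow> (sign \<Rightarrow> 'g \<Rightarrow> 'c) \<Rightarrow> sign \<Rightarrow> ('c, 'g) tm \<Rightarrow> 'c" where
  "tm_bdry C b e (Gen g) = b e g"
| "tm_bdry C b e (Idt c) = c"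
| "tm_bdry C b e (LAct i c t) = cmp C i c (tm_bdry C b e t)"
| "tm_bdry C b e (RAct i t c) = cmp C i (tm_bdry C b e t) c"
| "tm_bdry C b e (Comp t t') = (case e of Minus \<Rightarrow> tm_bdry C b e t | Plus \<Rightarrow> tm_bdry C b e t')"

inductive wf_tm :: "nat \<Rightarrow> 'c precat \<Rightarrow> 'g set \<Rightarrow> (sign \<Rightarrow> 'g \<Rightarrow> 'c) \<Rightarrow> ('c, 'g) tm \<Rightarrow> bool"
  for n C G b where
  wf_Gen: "g \<in> G \<Longrightarrow> wf_tm n C G b (Gen g)"
| wf_Idt: "c \<in> cells C n \<Longrightarrow> wf_tm n C G b (Idt c)"
| wf_LAct: "c \<in> cells C (Suc i) \<Longrightarrow> wf_tm n C G b t \<Longrightarrow>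
    composable C i c (tm_bdry C b Minus t) \<Longrightarrow> wf_tm n C G b (LAct i c t)"
| wf_RAct: "c \<in> cells C (Suc i) \<Longrightarrow> wf_tm n C G b t \<Longrightarrow>
    composable C i (tm_bdry C b Plus t) c \<Longrightarrow> wf_tm n C G b (RAct i t c)"
| wf_Comp: "wf_tm n C G b t \<Longrightarrow> wf_tm n C G b t' \<Longrightarrow>
    tm_bdry C b Plus t = tm_bdry C b Minus t' \<Longrightarrow> wf_tm n C G b (Comp t t')"

inductive tm_eq :: "nat \<Rightarrow> 'c precat \<Rightarrow> 'g set \<Rightarrow> (sign \<Rightarrow> 'g \<Rightarrow> 'c) \<Rightarrow>
    ('c, 'g) tm \<Rightarrow> ('c, 'g) tm \<Rightarrow> bool"
  for n C G b where
  tm_eq_refl: "wf_tm n C G b t \<Longrightarrow> tm_eq n C G b t t"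
| tm_eq_sym: "tm_eq n C G b t t' \<Longrightarrow> tm_eq n C G b t' t"
| tm_eq_trans: "tm_eq n C G b t t' \<Longrightarrow> tm_eq n C G b t' t'' \<Longrightarrow> tm_eq n C G b t t''"
| tm_eq_LAct: "wf_tm n C G b (LAct i c t) \<Longrightarrow> tm_eq n C G b t t' \<Longrightarrow>
    tm_eq n C G b (LAct i c t) (LAct i c t')"
| tm_eq_RAct: "wf_tm n C G b (RAct i t c) \<Longrightarrow> tm_eq n C G b t t' \<Longrightarrow>
    tm_eq n C G b (RAct i t c) (RAct i t' c)"
| tm_eq_Comp: "wf_tm n C G b (Comp s t) \<Longrightarrow> tm_eq n C G b s s' \<Longrightarrow> tm_eq n C G b t t' \<Longrightarrow>
    tm_eq n C G b (Comp s t) (Comp s' t')"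
| Comp_Idt_left: "wf_tm n C G b (Comp (Idt c) t) \<Longrightarrow> tm_eq n C G b (Comp (Idt c) t) t"
| Comp_Idt_right: "wf_tm n C G b (Comp t (Idt c)) \<Longrightarrow> tm_eq n C G b (Comp t (Idt c)) t"
| LAct_idt: "x \<in> cells C i \<Longrightarrow> wf_tm n C G b (LAct i (idt C x) t) \<Longrightarrow>
    tm_eq n C G b (LAct i (idt C x) t) t"
| RAct_idt: "x \<in> cells C i \<Longrightarrow> wf_tm n C G b (RAct i t (idt C x)) \<Longrightarrow>
    tm_eq n C G b (RAct i t (idt C x)) t"
| LAct_Idt: "wf_tm n C G b (LAct i c (Idt d)) \<Longrightarrow>
    tm_eq n C G b (LAct i c (Idt d)) (Idt (cmp C i c d))"
| RAct_Idt: "wf_tm n C G b (RAct i (Idt d) c) \<Longrightarrow>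
    tm_eq n C G b (RAct i (Idt d) c) (Idt (cmp C i d c))"
| Comp_assoc: "wf_tm n C G b (Comp (Comp s t) u) \<Longrightarrow> wf_tm n C G b (Comp s (Comp t u)) \<Longrightarrow>
    tm_eq n C G b (Comp (Comp s t) u) (Comp s (Comp t u))"
| LAct_LAct: "composable C i c d \<Longrightarrow> wf_tm n C G b (LAct i (cmp C i c d) t) \<Longrightarrow>
    wf_tm n C G b (LAct i c (LAct i d t)) \<Longrightarrow>
    tm_eq n C G b (LAct i (cmp C i c d) t) (LAct i c (LAct i d t))"
| RAct_RAct: "composable C i c d \<Longrightarrow> wf_tm n C G b (RAct i (RAct i t c) d) \<Longrightarrow>
    wf_tm n C G b (RAct i t (cmp C i c d)) \<Longrightarrow>
    tm_eq n C G b (RAct i (RAct i t c) d) (RAct i t (cmp C i c d))"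
| LAct_RAct: "wf_tm n C G b (RAct i (LAct i c t) d) \<Longrightarrow> wf_tm n C G b (LAct i c (RAct i t d)) \<Longrightarrow>
    tm_eq n C G b (RAct i (LAct i c t) d) (LAct i c (RAct i t d))"
| LAct_Comp: "wf_tm n C G b (LAct i c (Comp s t)) \<Longrightarrow>
    tm_eq n C G b (LAct i c (Comp s t)) (Comp (LAct i c s) (LAct i c t))"
| RAct_Comp: "wf_tm n C G b (RAct i (Comp s t) c) \<Longrightarrow>
    tm_eq n C G b (RAct i (Comp s t) c) (Comp (RAct i s c) (RAct i t c))"
| LAct_dist_LAct: "i < j \<Longrightarrow> wf_tm n C G b (LAct i c (LAct j d t)) \<Longrightarrow>
    tm_eq n C G b (LAct i c (LAct j d t)) (LAct j (cmp C i c d) (LAct i c t))"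
| LAct_dist_RAct: "i < j \<Longrightarrow> wf_tm n C G b (LAct i c (RAct j t d)) \<Longrightarrow>
    tm_eq n C G b (LAct i c (RAct j t d)) (RAct j (LAct i c t) (cmp C i c d))"
| RAct_dist_LAct: "i < j \<Longrightarrow> wf_tm n C G b (RAct i (LAct j d t) c) \<Longrightarrow>
    tm_eq n C G b (RAct i (LAct j d t) c) (LAct j (cmp C i d c) (RAct i t c))"
| RAct_dist_RAct: "i < j \<Longrightarrow> wf_tm n C G b (RAct i (RAct j t d) c) \<Longrightarrow>
    tm_eq n C G b (RAct i (RAct j t d) c) (RAct j (RAct i t c) (cmp C i d c))"

datatype ('c, 'g) ext = Low 'c | Top "('c, 'g) tm set"

definition tm_class :: "nat \<Rightarrow> 'c precat \<Rightarrow> 'g set \<Rightarrow> (sign \<Rightarrow> 'g \<Rightarrow> 'c) \<Rightarrow>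
    ('c, 'g) tm \<Rightarrow> ('c, 'g) ext" where
  "tm_class n C G b t = Top {t'. tm_eq n C G b t t'}"

definition rep :: "('c, 'g) tm set \<Rightarrow> ('c, 'g) tm" where
  "rep T = (SOME t. t \<in> T)"

definition adjoin :: "nat \<Rightarrow> 'c precat \<Rightarrow> 'g set \<Rightarrow> (sign \<Rightarrow> 'g \<Rightarrow> 'c) \<Rightarrow> ('c, 'g) ext precat" where
  "adjoin n C G b = \<lparr>
     cells = (\<lambda>k. if k = Suc n then {tm_class n C G b t | t. wf_tm n C G b t} else Low ` cells C k),
     bdry = (\<lambda>e k x. case x of
         Low u \<Rightarrow> Low (bdry C e k u)
       | Top T \<Rightarrow> if k \<le> n then Low (bdry C e k (tm_bdry C b e (rep T))) else Top T),
     idt = (\<lambda>x. case x of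
         Low u \<Rightarrow> if u \<in> cells C n then tm_class n C G b (Idt u) else Low (idt C u)
       | Top T \<Rightarrow> undefined),
     cmp = (\<lambda>i x y. case x of
         Low u \<Rightarrow> (case y of
             Low v \<Rightarrow> Low (cmp C i u v)
           | Top T \<Rightarrow> tm_class n C G b (LAct i u (rep T)))
       | Top S \<Rightarrow> (case y of
             Low v \<Rightarrow> tm_class n C G b (RAct i (rep S) v)
           | Top T \<Rightarrow> tm_class n C G b (Comp (rep S) (rep T))))\<rparr>"


section \<open>The free extension is a precategory\<close>

lemma composable_Suc: "composable C i u v \<Longrightarrow> u \<in> cells C k \<Longrightarrow> v \<in> cells C l \<Longrightarrow> precategory n C \<Longrightarrow> min k l = Suc i"
  unfolding composable_def by (metis precategory.cells_disjoint)

locale adjunction = precategory n C for n and C :: "'c precat" +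
  fixes G :: "'g set" and b :: "sign \<Rightarrow> 'g \<Rightarrow> 'c"
  assumes att: "attachable n C G b"
begin

abbreviation "wt \<equiv> wf_tm n C G b"
abbreviation "eq \<equiv> tm_eq n C G b"
abbreviation "bd \<equiv> tm_bdry C b"
abbreviation "cls \<equiv> tm_class n C G b"
abbreviation "A \<equiv> adjoin n C G b"

lemma pc: "precategory n C" by (rule precategory_axioms)

lemma cells_le: "u \<in> cells C k \<Longrightarrow> k \<le> n" using cells_above[of k] by fastforce

lemma compD: "composable C i u v \<Longrightarrow> u \<in> cells C k \<Longrightarrow> v \<in> cells C l \<Longrightarrow> min k l = Suc i \<and> bdry C Plus i u = bdry C Minus i v"
  using composable_Suc[OF _ _ _ pc] unfolding composable_def by blast

lemma compI: "u \<in> cells C k \<Longrightarrow> v \<in> cells C l \<Longrightarrow> min k l = Suc i \<Longrightarrow> bdry C Plus i u = bdry C Minus i v \<Longrightarrow> composable C i u v"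
  unfolding composable_def by blast

definition "par d d' \<longleftrightarrow> d \<in> cells C n \<and> d' \<in> cells C n \<and> (\<forall>e. \<forall>j<n. bdry C e j d = bdry C e j d')"

lemma parI: assumes "d \<in> cells C n" "d' \<in> cells C n" "\<And>e m. n = Suc m \<Longrightarrow> bdry C e m d = bdry C e m d'"
  shows "par d d'"
  unfolding par_def
proof (intro conjI allI impI assms(1,2))
  fix e j assume "j < n"
  then obtain m where m: "n = Suc m" "j \<le> m" by (metis Suc_le_eq less_Suc_eq_le lessE)
  have "bdry C e j d = bdry C e j (bdry C e m d)" if "j < m"
    using globular[OF assms(1) that] m by simp
  moreover have "bdry C e j d' = bdry C e j (bdry C e m d')" if "j < m"
    using globular[OF assms(2) that] m by simp
  ultimately show "bdry C e j d = bdry C e j d'" using assms(3)[OF m(1)] m(2) by (metis le_neq_implies_less)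
qed

lemma par_L: assumes p: "par d d'" and c: "c \<in> cells C (Suc i)" and k: "composable C i c d"
  shows "composable C i c d'" "par (cmp C i c d) (cmp C i c d')"
proof -
  have d: "d \<in> cells C n" "d' \<in> cells C n" and e: "\<And>e j. j<n \<Longrightarrow> bdry C e j d = bdry C e j d'" using p unfolding par_def by auto
  have i: "min (Suc i) n = Suc i" "bdry C Plus i c = bdry C Minus i d" using compD[OF k c d(1)] by auto
  show k': "composable C i c d'" using compI[OF c d(2)] i e[of i Minus] by simp
  have x: "cmp C i c d \<in> cells C n" "cmp C i c d' \<in> cells C n" 
    using cmp_cells[OF c d(1) k] cmp_cells[OF c d(2) k'] i by (simp_all add: max_def min_def split: if_splits)
  show "par (cmp C i c d) (cmp C i c d')"
  proof (rule parI[OF x])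
    fix s m assume m: "n = Suc m"
    show "bdry C s m (cmp C i c d) = bdry C s m (cmp C i c d')"
    proof (cases "Suc i < n")
      case True thus ?thesis using bdry_cmp_less[OF c _ _ k, of m s] bdry_cmp_less[OF c _ _ k', of m s] d m e[of m s] by simp
    next
      case False hence "i = m" using i m by simp
      thus ?thesis using bdry_cmp_minus[of c m d] bdry_cmp_minus[of c m d'] bdry_cmp_plus[of c m d] bdry_cmp_plus[of c m d']
         c d m k k' e[of m s] by (cases s) simp_all
    qed
  qed
qed

lemma par_R: assumes p: "par d d'" and c: "c \<in> cells C (Suc i)" and k: "composable C i d c"
  shows "composable C i d' c" "par (cmp C i d c) (cmp C i d' c)"
proof -
  have d: "d \<in> cells C n" "d' \<in> cells C n" and e: "\<And>e j. j<n \<Longrightarrow> bdry C e j d = bdry C e j d'" using p unfolding par_def by auto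
  have i: "min n (Suc i) = Suc i" "bdry C Plus i d = bdry C Minus i c" using compD[OF k d(1) c] by auto
  show k': "composable C i d' c" using compI[OF d(2) c] i e[of i Plus] by simp
  have x: "cmp C i d c \<in> cells C n" "cmp C i d' c \<in> cells C n" 
    using cmp_cells[OF d(1) c k] cmp_cells[OF d(2) c k'] i by (simp_all add: max_def min_def split: if_splits)
  show "par (cmp C i d c) (cmp C i d' c)"
  proof (rule parI[OF x])
    fix s m assume m: "n = Suc m"
    show "bdry C s m (cmp C i d c) = bdry C s m (cmp C i d' c)"
    proof (cases "Suc i < n")
      case True thus ?thesis using bdry_cmp_greater[OF _ c _ k, of m s] bdry_cmp_greater[OF _ c _ k', of m s] d m e[of m s] by simp
    next
      case False hence "i = m" using i m by simp
      thus ?thesis using bdry_cmp_minus[of d m c] bdry_cmp_minus[of d' m c] bdry_cmp_plus[of d m c] bdry_cmp_plus[of d' m c]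
         c d m k k' e[of m s] by (cases s) simp_all
    qed
  qed
qed

lemma par_sym: "par d d' \<Longrightarrow> par d' d" unfolding par_def by simp
lemma par_trans: "par d d' \<Longrightarrow> par d' d'' \<Longrightarrow> par d d''" unfolding par_def by simp

lemma wf_par: "wt t \<Longrightarrow> par (bd Minus t) (bd Plus t)"
proof (induction rule: wf_tm.induct)
  case (wf_Gen g)
  then show ?case using att unfolding attachable_def by (auto intro!: parI)
next
  case (wf_Idt c) then show ?case by (simp add: par_def)
next
  case (wf_LAct c i t) then show ?case using par_L(2) by simp
next
  case (wf_RAct c i t) then show ?case using par_R par_sym by simp
next
  case (wf_Comp t t') then show ?case using par_trans by simp
qed

lemma wf_bd: "wt t \<Longrightarrow> bd e t \<in> cells C n"
  using wf_par[of t] unfolding par_def by (cases e) auto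

lemma bd_eq: "wt t \<Longrightarrow> j < n \<Longrightarrow> bdry C e j (bd s t) = bdry C e j (bd Minus t)"
  using wf_par[of t] unfolding par_def by (cases s) auto

lemma wfL: "wt (LAct i c t) \<longleftrightarrow> wt t \<and> c \<in> cells C (Suc i) \<and> i < n \<and> bdry C Plus i c = bdry C Minus i (bd Minus t)"
  by (auto simp: wf_tm.simps[of _ _ _ _ "LAct i c t"] dest!: compD[OF _ _ wf_bd] intro!: compI[OF _ wf_bd])
lemma wfR: "wt (RAct i t c) \<longleftrightarrow> wt t \<and> c \<in> cells C (Suc i) \<and> i < n \<and> bdry C Plus i (bd Plus t) = bdry C Minus i c"
  by (auto simp: wf_tm.simps[of _ _ _ _ "RAct i t c"] dest!: compD[OF _ wf_bd] intro!: compI[OF wf_bd])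
lemma wfC: "wt (Comp s t) \<longleftrightarrow> wt s \<and> wt t \<and> bd Plus s = bd Minus t"
  by (auto simp: wf_tm.simps[of _ _ _ _ "Comp s t"])
lemma wfI: "wt (Idt c) \<longleftrightarrow> c \<in> cells C n"
  by (auto simp: wf_tm.simps[of _ _ _ _ "Idt c"])

lemma wfL_comp: "wt (LAct i c t) \<Longrightarrow> composable C i c (bd e t)"
  by (rule compI[OF _ wf_bd]) (auto simp: wfL bd_eq[of _ _ _ e])
lemma wfR_comp: "wt (RAct i t c) \<Longrightarrow> composable C i (bd e t) c"
  by (rule compI[OF wf_bd]) (auto simp: wfR bd_eq[of _ _ _ e] bd_eq[of _ _ _ Plus])


lemma bdry_cmp_up_L:
  assumes u: "u \<in> cells C (Suc i)" and v: "v \<in> cells C l" and k: "composable C i u v" and p: "i < p" "p \<le> l"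
  shows "bdry C e p (cmp C i u v) = cmp C i u (bdry C e p v)" "composable C i u (bdry C e p v)"
proof -
  have l: "Suc i \<le> l" "bdry C Plus i u = bdry C Minus i v" using compD[OF k u v] by auto
  have c: "composable C i u (bdry C e q v)" if "i < q" "q \<le> l" for q
    using compI[OF u bdry_cells[OF v that(2)]] that l globular[OF v that] by simp
  show "composable C i u (bdry C e p v)" using c p by blast
  have x: "cmp C i u v \<in> cells C l" using cmp_cells[OF u v k] l by (simp add: max_def split: if_splits)
  show "bdry C e p (cmp C i u v) = cmp C i u (bdry C e p v)"
    using p(2) p(1)
  proof (induction rule: inc_induct)
    case base then show ?case using bdry_same[OF v] bdry_same[OF x] by simp
  next
    case (step q)
    have "bdry C e q (cmp C i u v) = bdry C e q (bdry C e (Suc q) (cmp C i u v))"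
      using globular[OF x, of q "Suc q" e e] step by simp
    also have "\<dots> = bdry C e q (cmp C i u (bdry C e (Suc q) v))" using step by simp
    also have "\<dots> = cmp C i u (bdry C e q (bdry C e (Suc q) v))"
      using bdry_cmp_less[OF u bdry_cells[OF v]] step c by simp
    also have "\<dots> = cmp C i u (bdry C e q v)" using globular[OF v] step by simp
    finally show ?case .
  qed
qed

lemma bdry_cmp_up_R:
  assumes u: "u \<in> cells C (Suc i)" and v: "v \<in> cells C l" and k: "composable C i v u" and p: "i < p" "p \<le> l"
  shows "bdry C e p (cmp C i v u) = cmp C i (bdry C e p v) u" "composable C i (bdry C e p v) u"
proof -
  have l: "Suc i \<le> l" "bdry C Plus i v = bdry C Minus i u" using compD[OF k v u] by auto
  have c: "composable C i (bdry C e q v) u" if "i < q" "q \<le> l" for q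
    using compI[OF bdry_cells[OF v that(2)] u] that l globular[OF v that] by simp
  show "composable C i (bdry C e p v) u" using c p by blast
  have x: "cmp C i v u \<in> cells C l" using cmp_cells[OF v u k] l by (simp add: max_def split: if_splits)
  show "bdry C e p (cmp C i v u) = cmp C i (bdry C e p v) u"
    using p(2) p(1)
  proof (induction rule: inc_induct)
    case base then show ?case using bdry_same[OF v] bdry_same[OF x] by simp
  next
    case (step q)
    have "bdry C e q (cmp C i v u) = bdry C e q (bdry C e (Suc q) (cmp C i v u))"
      using globular[OF x, of q "Suc q" e e] step by simp
    also have "\<dots> = bdry C e q (cmp C i (bdry C e (Suc q) v) u)" using step by simp
    also have "\<dots> = cmp C i (bdry C e q (bdry C e (Suc q) v)) u"
      using bdry_cmp_greater[OF bdry_cells[OF v] u] step c by simp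
    also have "\<dots> = cmp C i (bdry C e q v) u" using globular[OF v] step by simp
    finally show ?case .
  qed
qed

lemma bdry_cmp_i: assumes u: "u \<in> cells C k" and v: "v \<in> cells C l" and c: "composable C i u v"
  shows "bdry C e i (cmp C i u v) = (case e of Minus \<Rightarrow> bdry C e i u | Plus \<Rightarrow> bdry C e i v)"
proof -
  have m: "min k l = Suc i" using compD[OF c u v] by simp
  have x: "cmp C i u v \<in> cells C (max k l)" using cmp_cells u v c by blast
  have g: "bdry C e i (cmp C i u v) = bdry C e i (bdry C e (Suc i) (cmp C i u v))"
    using globular[OF x, of i "Suc i" e e] m by (simp add: min_def max_def split: if_splits)
  show ?thesis
  proof (cases "k \<le> l")
    case True
    hence k: "k = Suc i" "Suc i \<le> l" using m by auto
    have "bdry C e (Suc i) (cmp C i u v) = cmp C i u (bdry C e (Suc i) v)"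
      "composable C i u (bdry C e (Suc i) v)" using bdry_cmp_up_L[of u i v l "Suc i" e] u v c k by auto
    thus ?thesis unfolding g using bdry_cmp_minus[of u i] bdry_cmp_plus[of u i] u k bdry_cells[OF v, of "Suc i"] 
      globular[OF v, of i "Suc i"] by (cases e) auto
  next
    case False
    hence k: "l = Suc i" "Suc i \<le> k" using m by auto
    have "bdry C e (Suc i) (cmp C i u v) = cmp C i (bdry C e (Suc i) u) v"
      "composable C i (bdry C e (Suc i) u) v" using bdry_cmp_up_R[of v i u k "Suc i" e] u v c k by auto
    thus ?thesis unfolding g using bdry_cmp_minus[of _ i v] bdry_cmp_plus[of _ i v] v k bdry_cells[OF u, of "Suc i"] 
      globular[OF u, of i "Suc i"] by (cases e) auto
  qed
qed

lemma bdry_cmp_low: assumes u: "u \<in> cells C k" and v: "v \<in> cells C l" and c: "composable C i u v" and j: "j < i"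
  shows "bdry C e j (cmp C i u v) = bdry C e j u" "bdry C e j u = bdry C e j v"
proof -
  have m: "min k l = Suc i" "bdry C Plus i u = bdry C Minus i v" using compD[OF c u v] by auto
  have x: "cmp C i u v \<in> cells C (max k l)" using cmp_cells u v c by blast
  have "bdry C e j (cmp C i u v) = bdry C e j (bdry C Minus i (cmp C i u v))"
    using globular[OF x j] m by (simp add: min_def max_def split: if_splits)
  also have "\<dots> = bdry C e j (bdry C Minus i u)" using bdry_cmp_i[OF u v c] by simp
  also have "\<dots> = bdry C e j u" using globular[OF u j] m by (simp add: min_def max_def split: if_splits)
  finally show "bdry C e j (cmp C i u v) = bdry C e j u" .
  have "bdry C e j u = bdry C e j (bdry C Plus i u)" using globular[OF u j, of e Plus] m(1) by (simp add: min_def split: if_splits)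
  also have "\<dots> = bdry C e j (bdry C Minus i v)" using m(2) by simp
  also have "\<dots> = bdry C e j v" using m(1) globular[OF v j, of e Minus] by (simp add: min_def split: if_splits)
  finally show "bdry C e j u = bdry C e j v" .
qed

lemma cmpL_cells: "wt (LAct i c t) \<Longrightarrow> cmp C i c (bd e t) \<in> cells C n"
  using wf_bd[of "LAct i c t" e] by simp
lemma cmpR_cells: "wt (RAct i t c) \<Longrightarrow> cmp C i (bd e t) c \<in> cells C n"
  using wf_bd[of "RAct i t c" e] by simp

lemma idt_pos: "x \<in> cells C i \<Longrightarrow> idt C x \<in> cells C (Suc i) \<Longrightarrow> bdry C e i (idt C x) = x"
  using bdry_idt cells_le[of "idt C x" "Suc i"] by auto

lemma eq_wf: "eq t t' \<Longrightarrow> wt t \<and> wt t' \<and> (\<forall>e. bd e t = bd e t')"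
proof (induction rule: tm_eq.induct)
  case (Comp_Idt_left c t) thus ?case by (auto simp: wfC split: sign.split)
next
  case (Comp_Idt_right c t) thus ?case by (auto simp: wfC split: sign.split)
next
  case (LAct_idt x i t)
  have "cmp C i (idt C x) (bd e t) = bd e t" for e
    using idt_left[OF LAct_idt(1) wfL_comp[OF LAct_idt(2)]] .
  thus ?case using LAct_idt by (simp add: wfL)
next
  case (RAct_idt x i t)
  have "cmp C i (bd e t) (idt C x) = bd e t" for e
    using idt_right[OF RAct_idt(1) wfR_comp[OF RAct_idt(2)]] .
  thus ?case using RAct_idt by (simp add: wfR)
next
  case (LAct_Idt i c d) thus ?case using wf_bd[OF LAct_Idt] by (simp add: wfI)
next
  case (RAct_Idt i c d) thus ?case using wf_bd[OF RAct_Idt] by (simp add: wfI)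
next
  case (Comp_assoc s t u) thus ?case by (auto split: sign.split)
next
  case (LAct_LAct i c d t)
  hence w: "wt (LAct i d t)" by (simp add: wfL[of i c])
  have "cmp C i (cmp C i c d) (bd e t) = cmp C i c (cmp C i d (bd e t))" for e
    using cmp_assoc[OF LAct_LAct(1) wfL_comp[OF LAct_LAct(2)] wfL_comp[OF w]] wfL_comp[OF LAct_LAct(3), of e] by simp
  thus ?case using LAct_LAct by simp
next
  case (RAct_RAct i c d t)
  hence w: "wt (RAct i t c)" by (simp add: wfR[of i _ d])
  have "cmp C i (cmp C i (bd e t) c) d = cmp C i (bd e t) (cmp C i c d)" for e
    using cmp_assoc[OF wfR_comp[OF w] _ RAct_RAct(1) wfR_comp[OF RAct_RAct(3)]] wfR_comp[OF RAct_RAct(2), of e] by simp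
  thus ?case using RAct_RAct by simp
next
  case (LAct_RAct i c t d)
  hence w: "wt (LAct i c t)" "wt (RAct i t d)" by (simp_all add: wfR[of i _ d] wfL[of i c])
  have "cmp C i (cmp C i c (bd e t)) d = cmp C i c (cmp C i (bd e t) d)" for e
    using cmp_assoc[OF wfL_comp[OF w(1)] _ wfR_comp[OF w(2)]] wfL_comp[OF LAct_RAct(2), of e] wfR_comp[OF LAct_RAct(1), of e] by simp
  thus ?case using LAct_RAct by simp
next
  case (LAct_Comp i c s t)
  then show ?case using bd_eq[of s i Minus Plus] by (auto simp: wfL wfC split: sign.split)
next
  case (RAct_Comp i s t c)
  then show ?case using bd_eq[of t i Plus Plus] by (auto simp: wfR wfC split: sign.split)
next
  case (LAct_dist_LAct i j c d t)
  have w: "wt (LAct j d t)" "c \<in> cells C (Suc i)" using LAct_dist_LAct by (simp_all add: wfL[of i c])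
  have d: "d \<in> cells C (Suc j)" "wt t" "j < n" "bdry C Plus j d = bdry C Minus j (bd Minus t)" using w by (simp_all add: wfL)
  have cd: "composable C j d (bd e t)" for e using wfL_comp[OF w(1)] .
  have cc: "composable C i c (cmp C j d (bd e t))" for e using wfL_comp[OF LAct_dist_LAct(2), of e] by simp
  have f: "bdry C Plus i c = bdry C Minus i (cmp C j d (bd e t))" for e
    using compD[OF cc w(2) cmpL_cells[OF w(1)]] by blast
  have f1: "bdry C Plus i c = bdry C Minus i d" and f2: "bdry C Plus i c = bdry C Minus i (bd Minus t)"
    using f[of Minus] bdry_cmp_low[OF d(1) wf_bd[OF d(2)] cd \<open>i<j\<close>] by simp_all
  have k1: "composable C i c d" using compI[OF w(2) d(1)] f1 \<open>i<j\<close> by simp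
  have W2: "wt (LAct i c t)" using d w f2 \<open>i<j\<close> by (simp add: wfL)
  have x: "cmp C i c d \<in> cells C (Suc j)" using cmp_cells[OF w(2) d(1) k1] \<open>i<j\<close> by (simp add: max_def)
  have "bdry C Plus j (cmp C i c d) = cmp C i c (bdry C Plus j d)"
    using bdry_cmp_up_L[OF w(2) d(1) k1] \<open>i<j\<close> by simp
  moreover have "bdry C Minus j (cmp C i c (bd Minus t)) = cmp C i c (bdry C Minus j (bd Minus t))"
    using bdry_cmp_up_L[OF w(2) wf_bd[OF d(2)] wfL_comp[OF W2]] \<open>i<j\<close> d by simp
  ultimately have "wt (LAct j (cmp C i c d) (LAct i c t))" using d x W2 by (simp add: wfL[of j "cmp C i c d"])
  thus ?case using LAct_dist_LAct distrib_left[OF \<open>i<j\<close> w(2) cd cc] by simp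
next
  case (LAct_dist_RAct i j c t d)
  have w: "wt (RAct j t d)" "c \<in> cells C (Suc i)" using LAct_dist_RAct by (simp_all add: wfL[of i c])
  have d: "d \<in> cells C (Suc j)" "wt t" "j < n" "bdry C Plus j (bd Plus t) = bdry C Minus j d" using w by (simp_all add: wfR)
  have cd: "composable C j (bd e t) d" for e using wfR_comp[OF w(1)] .
  have cc: "composable C i c (cmp C j (bd e t) d)" for e using wfL_comp[OF LAct_dist_RAct(2), of e] by simp
  have f: "bdry C Plus i c = bdry C Minus i (cmp C j (bd e t) d)" for e
    using compD[OF cc w(2) cmpR_cells[OF w(1)]] by blast
  have f1: "bdry C Plus i c = bdry C Minus i d" and f2: "bdry C Plus i c = bdry C Minus i (bd Minus t)"
    using f[of Minus] bdry_cmp_low[OF wf_bd[OF d(2)] d(1) cd \<open>i<j\<close>, of Minus Minus] by simp_all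
  have k1: "composable C i c d" using compI[OF w(2) d(1)] f1 \<open>i<j\<close> by simp
  have W2: "wt (LAct i c t)" using d w f2 \<open>i<j\<close> by (simp add: wfL)
  have x: "cmp C i c d \<in> cells C (Suc j)" using cmp_cells[OF w(2) d(1) k1] \<open>i<j\<close> by (simp add: max_def)
  have "bdry C Minus j (cmp C i c d) = cmp C i c (bdry C Minus j d)"
    using bdry_cmp_up_L[OF w(2) d(1) k1] \<open>i<j\<close> by simp
  moreover have "bdry C Plus j (cmp C i c (bd Plus t)) = cmp C i c (bdry C Plus j (bd Plus t))"
    using bdry_cmp_up_L[OF w(2) wf_bd[OF d(2)] wfL_comp[OF W2]] \<open>i<j\<close> d by simp
  ultimately have "wt (RAct j (LAct i c t) (cmp C i c d))" using d x W2 by (simp add: wfR[of j])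
  thus ?case using LAct_dist_RAct distrib_left[OF \<open>i<j\<close> w(2) cd cc] by simp
next
  case (RAct_dist_LAct i j d t c)
  have w: "wt (LAct j d t)" "c \<in> cells C (Suc i)" using RAct_dist_LAct by (simp_all add: wfR[of i _ c])
  have d: "d \<in> cells C (Suc j)" "wt t" "j < n" "bdry C Plus j d = bdry C Minus j (bd Minus t)" using w by (simp_all add: wfL)
  have cd: "composable C j d (bd e t)" for e using wfL_comp[OF w(1)] .
  have cc: "composable C i (cmp C j d (bd e t)) c" for e using wfR_comp[OF RAct_dist_LAct(2), of e] by simp
  have f: "bdry C Plus i (cmp C j d (bd e t)) = bdry C Minus i c" for e
    using compD[OF cc cmpL_cells[OF w(1)] w(2)] by blast
  have f1: "bdry C Plus i d = bdry C Minus i c" and f2: "bdry C Plus i (bd Plus t) = bdry C Minus i c"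
    using f[of Plus] bdry_cmp_low[OF d(1) wf_bd[OF d(2)] cd \<open>i<j\<close>, of Plus Plus] by simp_all
  have k1: "composable C i d c" using compI[OF d(1) w(2)] f1 \<open>i<j\<close> by simp
  have W2: "wt (RAct i t c)" using d w f2 \<open>i<j\<close> by (simp add: wfR)
  have x: "cmp C i d c \<in> cells C (Suc j)" using cmp_cells[OF d(1) w(2) k1] \<open>i<j\<close> by (simp add: max_def)
  have "bdry C Plus j (cmp C i d c) = cmp C i (bdry C Plus j d) c"
    using bdry_cmp_up_R[OF w(2) d(1) k1] \<open>i<j\<close> by simp
  moreover have "bdry C Minus j (cmp C i (bd Minus t) c) = cmp C i (bdry C Minus j (bd Minus t)) c"
    using bdry_cmp_up_R[OF w(2) wf_bd[OF d(2)] wfR_comp[OF W2]] \<open>i<j\<close> d by simp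
  ultimately have "wt (LAct j (cmp C i d c) (RAct i t c))" using d x W2 by (simp add: wfL[of j])
  thus ?case using RAct_dist_LAct distrib_right[OF \<open>i<j\<close> w(2) cd cc] by simp
next
  case (RAct_dist_RAct i j t d c)
  have w: "wt (RAct j t d)" "c \<in> cells C (Suc i)" using RAct_dist_RAct by (simp_all add: wfR[of i _ c])
  have d: "d \<in> cells C (Suc j)" "wt t" "j < n" "bdry C Plus j (bd Plus t) = bdry C Minus j d" using w by (simp_all add: wfR)
  have cd: "composable C j (bd e t) d" for e using wfR_comp[OF w(1)] .
  have cc: "composable C i (cmp C j (bd e t) d) c" for e using wfR_comp[OF RAct_dist_RAct(2), of e] by simp
  have f: "bdry C Plus i (cmp C j (bd e t) d) = bdry C Minus i c" for e
    using compD[OF cc cmpR_cells[OF w(1)] w(2)] by blast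
  have f1: "bdry C Plus i d = bdry C Minus i c" and f2: "bdry C Plus i (bd Plus t) = bdry C Minus i c"
    using f[of Plus] bdry_cmp_low[OF wf_bd[OF d(2)] d(1) cd \<open>i<j\<close>, of Plus Plus] by simp_all
  have k1: "composable C i d c" using compI[OF d(1) w(2)] f1 \<open>i<j\<close> by simp
  have W2: "wt (RAct i t c)" using d w f2 \<open>i<j\<close> by (simp add: wfR)
  have x: "cmp C i d c \<in> cells C (Suc j)" using cmp_cells[OF d(1) w(2) k1] \<open>i<j\<close> by (simp add: max_def)
  have "bdry C Minus j (cmp C i d c) = cmp C i (bdry C Minus j d) c"
    using bdry_cmp_up_R[OF w(2) d(1) k1] \<open>i<j\<close> by simp
  moreover have "bdry C Plus j (cmp C i (bd Plus t) c) = cmp C i (bdry C Plus j (bd Plus t)) c"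
    using bdry_cmp_up_R[OF w(2) wf_bd[OF d(2)] wfR_comp[OF W2]] \<open>i<j\<close> d by simp
  ultimately have "wt (RAct j (RAct i t c) (cmp C i d c))" using d x W2 by (simp add: wfR[of j])
  thus ?case using RAct_dist_RAct distrib_right[OF \<open>i<j\<close> w(2) cd cc] by simp
next
  case (tm_eq_LAct i c t t') thus ?case by (simp add: wfL)
next
  case (tm_eq_RAct i c t t') thus ?case by (simp add: wfR)
next
  case (tm_eq_Comp s t s' t') thus ?case by (simp add: wfC split: sign.split)
qed auto

lemma cls_eqI: "eq t t' \<Longrightarrow> cls t = cls t'"
  unfolding tm_class_def by (auto intro: tm_eq_trans tm_eq_sym)

lemma rep_cls: "wt t \<Longrightarrow> eq t (rep {t'. eq t t'})"
  unfolding rep_def using someI[of "\<lambda>x. x \<in> {t'. eq t t'}" t] tm_eq_refl by fastforce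

lemma cellsA: "cells A k = (if k = Suc n then {cls t | t. wt t} else Low ` cells C k)"
  by (simp add: adjoin_def)

lemma LowA: "Low u \<in> cells A k \<longleftrightarrow> u \<in> cells C k"
  using cells_above by (auto simp: cellsA tm_class_def)

lemma clsA: "wt t \<Longrightarrow> cls t \<in> cells A k \<longleftrightarrow> k = Suc n"
  by (auto simp: cellsA tm_class_def)

lemma cellsE: assumes "x \<in> cells A k"
  obtains (L) u where "x = Low u" "u \<in> cells C k" "k \<le> n" | (T) t where "x = cls t" "wt t" "k = Suc n"
  using assms cells_le by (fastforce simp: cellsA split: if_splits)

lemma bdL: "bdry A e k (Low u) = Low (bdry C e k u)" by (simp add: adjoin_def)
lemma bdT: assumes "wt t" shows "bdry A e k (cls t) = (if k \<le> n then Low (bdry C e k (bd e t)) else cls t)"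
  using eq_wf[OF rep_cls[OF assms]] by (simp add: adjoin_def tm_class_def)

lemma cLL: "cmp A i (Low u) (Low v) = Low (cmp C i u v)" by (simp add: adjoin_def)
lemma cLT: assumes "wt (LAct i u t)" shows "cmp A i (Low u) (cls t) = cls (LAct i u t)"
proof -
  have "wt t" using assms by (simp add: wfL)
  from cls_eqI[OF tm_eq_LAct[OF assms rep_cls[OF this]]] show ?thesis by (simp add: adjoin_def tm_class_def)
qed
lemma cTL: assumes "wt (RAct i t u)" shows "cmp A i (cls t) (Low u) = cls (RAct i t u)"
proof -
  have "wt t" using assms by (simp add: wfR)
  from cls_eqI[OF tm_eq_RAct[OF assms rep_cls[OF this]]] show ?thesis by (simp add: adjoin_def tm_class_def)
qed
lemma cTT: assumes "wt (Comp s t)" shows "cmp A i (cls s) (cls t) = cls (Comp s t)"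
proof -
  have "wt s" "wt t" using assms by (simp_all add: wfC)
  from cls_eqI[OF tm_eq_Comp[OF assms rep_cls[OF this(1)] rep_cls[OF this(2)]]] show ?thesis by (simp add: adjoin_def tm_class_def)
qed

lemma kLL: "composable A i (Low u) (Low v) \<longleftrightarrow> composable C i u v"
  by (simp add: composable_def LowA bdL)
lemma kLT: "wt t \<Longrightarrow> composable A i (Low u) (cls t) \<longleftrightarrow> wt (LAct i u t)"
proof -
  assume w: "wt t"
  have "(\<exists>k l. u \<in> cells C k \<and> l = Suc n \<and> min k l = Suc i) \<longleftrightarrow> u \<in> cells C (Suc i) \<and> i < n"
    using cells_le by (fastforce simp: min_def)
  thus ?thesis using w by (auto simp: composable_def LowA clsA bdL bdT wfL)
qed
lemma kTL: "wt t \<Longrightarrow> composable A i (cls t) (Low u) \<longleftrightarrow> wt (RAct i t u)"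
proof -
  assume w: "wt t"
  have "(\<exists>l k. l = Suc n \<and> u \<in> cells C k \<and> min l k = Suc i) \<longleftrightarrow> u \<in> cells C (Suc i) \<and> i < n"
    using cells_le by (fastforce simp: min_def)
  thus ?thesis using w by (auto simp: composable_def LowA clsA bdL bdT wfR)
qed
lemma kTT: assumes "wt s" "wt t" shows "composable A i (cls s) (cls t) \<longleftrightarrow> i = n \<and> wt (Comp s t)"
  using assms bdry_same[OF wf_bd[OF assms(1)]] bdry_same[OF wf_bd[OF assms(2)]]
  by (simp add: composable_def clsA bdT wfC) auto

lemma idL: "u \<in> cells C k \<Longrightarrow> idt A (Low u) = (if k = n then cls (Idt u) else Low (idt C u))"
  using cells_disjoint by (auto simp: adjoin_def)

lemma cls_Low: "cls t = Low u \<Longrightarrow> False" by (simp add: tm_class_def)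
lemma cells_leA: "x \<in> cells A k \<Longrightarrow> k \<le> Suc n" by (erule cellsE) auto

lemma composableE: assumes "composable A i x y"
  obtains (LL) u v where "x = Low u" "y = Low v" "composable C i u v"
  | (LT) u t where "x = Low u" "y = cls t" "wt t" "wt (LAct i u t)"
  | (TL) t u where "x = cls t" "y = Low u" "wt t" "wt (RAct i t u)"
  | (TT) s t where "x = cls s" "y = cls t" "i = n" "wt s" "wt t" "wt (Comp s t)"
proof -
  obtain k l where k: "x \<in> cells A k" "y \<in> cells A l" using assms unfolding composable_def by blast
  show ?thesis
    using k assms by (elim cellsE) (auto simp: kLL kLT kTL kTT intro: that)
qed

lemmas cc = cLL cLT cTL cTT
lemmas kk = kLL kLT kTL kTT

lemma adj: "precategory (Suc n) A"
proof
  fix k assume "Suc n < k" thus "cells A k = {}" using cells_above by (auto simp: cellsA)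
next
  fix x k l assume "x \<in> cells A k" "x \<in> cells A l" thus "k = l"
    by (elim cellsE) (auto simp: tm_class_def dest: cells_disjoint)
next
  fix x k l e assume "x \<in> cells A l" "k \<le> l" thus "bdry A e k x \<in> cells A k"
    by (elim cellsE) (auto simp: LowA clsA bdL bdT intro!: bdry_cells[OF wf_bd] dest: bdry_cells)
next
  fix x k e assume "x \<in> cells A k" thus "bdry A e k x = x"
    by (elim cellsE) (auto simp: bdL bdT dest: bdry_same)
next
  fix x l j k e d assume x: "x \<in> cells A l" "j < k" "k \<le> l" thus "bdry A e j (bdry A d k x) = bdry A e j x"
    using x(1)
  proof (cases rule: cellsE)
    case (L u) thus ?thesis using globular x by (simp add: bdL)
  next
    case (T t)
    show ?thesis
    proof (cases "k \<le> n")
      case True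
      have "bdry C e j (bdry C d k (bd d t)) = bdry C e j (bd d t)"
        by (rule globular[OF wf_bd[OF T(2)] x(2) True])
      also have "\<dots> = bdry C e j (bd e t)"
        using bd_eq[OF T(2), of j e d] bd_eq[OF T(2), of j e e] x True by simp
      finally show ?thesis using True T x(2) by (simp add: bdL bdT)
    next
      case False
      thus ?thesis using T by (simp add: bdT)
    qed
  qed
next
  fix x k assume "x \<in> cells A k" "k < Suc n" thus "idt A x \<in> cells A (Suc k)"
    by (elim cellsE) (auto simp: idL LowA clsA wfI idt_cells)
next
  fix x k e assume "x \<in> cells A k" "k < Suc n" thus "bdry A e k (idt A x) = x"
    by (elim cellsE) (auto simp: idL bdL bdT wfI bdry_idt bdry_same)
next
  fix x k y l i assume x: "x \<in> cells A k" "y \<in> cells A l" and c: "composable A i x y"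
  from c show "cmp A i x y \<in> cells A (max k l)"
    using x cmp_cells by (cases rule: composableE) (auto simp: cc LowA clsA max_def dest!: cells_le)
next
  fix x k y l i e assume x: "x \<in> cells A k" "y \<in> cells A (Suc l)" "k < Suc l" and c: "composable A i x y"
  from c show "bdry A e l (cmp A i x y) = cmp A i x (bdry A e l y)"
  proof (cases rule: composableE)
    case (LL u v) thus ?thesis using x bdry_cmp_less[of u k v l i e] by (simp add: LowA bdL cLL)
  next
    case (LT u t)
    hence "l = n" using x by (simp add: clsA)
    thus ?thesis using LT bdry_same[OF wf_bd[OF LT(3)], of e] bdry_same[OF cmpL_cells[OF LT(4)], of e e]
      by (simp add: cLT cLL bdT bdL)
  next
    case (TL t u)
    hence False using x cells_le[of u "Suc l"] by (simp add: LowA clsA)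
    thus ?thesis ..
  next
    case (TT s t)
    hence False using x by (simp add: clsA)
    thus ?thesis ..
  qed
next
  fix x k y l i e assume x: "x \<in> cells A (Suc k)" "y \<in> cells A l" "l < Suc k" and c: "composable A i x y"
  from c show "bdry A e k (cmp A i x y) = cmp A i (bdry A e k x) y"
  proof (cases rule: composableE)
    case (LL u v) thus ?thesis using x bdry_cmp_greater[of u k v l i e] by (simp add: LowA bdL cLL)
  next
    case (LT u t)
    hence False using x cells_le[of u "Suc k"] by (simp add: LowA clsA)
    thus ?thesis ..
  next
    case (TL t u)
    hence "k = n" using x by (simp add: clsA)
    thus ?thesis using TL bdry_same[OF wf_bd[OF TL(3)], of e] bdry_same[OF cmpR_cells[OF TL(4)], of e e]
      by (simp add: cTL cLL bdT bdL)
  next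
    case (TT s t)
    hence False using x by (simp add: clsA)
    thus ?thesis ..
  qed
next
  fix x k y assume x: "x \<in> cells A (Suc k)" "y \<in> cells A (Suc k)" and c: "composable A k x y"
  from c have "bdry A Minus k (cmp A k x y) = bdry A Minus k x \<and>
      bdry A Plus k (cmp A k x y) = bdry A Plus k y"
  proof (cases rule: composableE)
    case (LL u v)
    thus ?thesis using x bdry_cmp_minus[of u k v] bdry_cmp_plus[of u k v] by (simp add: LowA bdL cLL)
  next
    case (LT u t)
    hence False using x cells_le[of u "Suc k"] by (simp add: LowA clsA)
    thus ?thesis ..
  next
    case (TL t u)
    hence False using x cells_le[of u "Suc k"] by (simp add: LowA clsA)
    thus ?thesis ..
  next
    case (TT s t)
    thus ?thesis by (simp add: cTT bdT)
  qed
  thus "bdry A Minus k (cmp A k x y) = bdry A Minus k x"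
    and "bdry A Plus k (cmp A k x y) = bdry A Plus k y" by simp_all
next

  fix x i y assume x: "x \<in> cells A i" and c: "composable A i (idt A x) y"
  have i: "i \<le> n" using c cells_leA unfolding composable_def by fastforce
  obtain u where u: "x = Low u" "u \<in> cells C i" using x i by (auto elim: cellsE)
  show "cmp A i (idt A x) y = y"
  proof (cases "i = n")
    case True
    hence I: "idt A x = cls (Idt u)" using u by (simp add: idL)
    from c[unfolded I] show ?thesis
    proof (cases rule: composableE)
      case (LL u v) thus ?thesis using cls_Low by blast
    next
      case (LT u t) thus ?thesis using cls_Low by blast
    next
      case (TL t v)
      thus ?thesis using True by (simp add: wfR)
    next
      case (TT s t)
      have "composable A n (cls (Idt u)) (cls t)" using c[unfolded I] TT(2) True by simp
      hence "wt (Comp (Idt u) t)" using kTT[of "Idt u" t] TT(5) u True by (simp add: wfI)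
      hence "cmp A n (cls (Idt u)) (cls t) = cls t" using cls_eqI[OF Comp_Idt_left] by (simp add: cTT)
      thus ?thesis using TT(2) by (simp add: I True)
    qed
  next
    case False
    hence I: "idt A x = Low (idt C u)" using u by (simp add: idL)
    from c[unfolded I] show ?thesis
    proof (cases rule: composableE)
      case (LL w v) thus ?thesis using idt_left[OF u(2)] by (simp add: I cLL)
    next
      case (LT w t) thus ?thesis using cls_eqI[OF LAct_idt[OF u(2)]] by (simp add: I cLT)
    next
      case (TL t v) thus ?thesis using cls_Low by metis
    next
      case (TT s t) thus ?thesis using cls_Low by metis
    qed
  qed
next
  fix x i y assume x: "x \<in> cells A i" and c: "composable A i y (idt A x)"
  have i: "i \<le> n" using c cells_leA unfolding composable_def by fastforce
  obtain u where u: "x = Low u" "u \<in> cells C i" using x i by (auto elim: cellsE)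
  show "cmp A i y (idt A x) = y"
  proof (cases "i = n")
    case True
    hence I: "idt A x = cls (Idt u)" using u by (simp add: idL)
    from c[unfolded I] show ?thesis
    proof (cases rule: composableE)
      case (LL u v) thus ?thesis using cls_Low by metis
    next
      case (LT v t)
      thus ?thesis using True by (simp add: wfL)
    next
      case (TL t v) thus ?thesis using cls_Low by metis
    next
      case (TT s t)
      have "composable A n (cls s) (cls (Idt u))" using c[unfolded I] TT(1) True by simp
      hence "wt (Comp s (Idt u))" using kTT[of s "Idt u"] TT(4) u True by (simp add: wfI)
      hence "cmp A n (cls s) (cls (Idt u)) = cls s" using cls_eqI[OF Comp_Idt_right] by (simp add: cTT)
      thus ?thesis using TT(1) by (simp add: I True)
    qed
  next
    case False
    hence I: "idt A x = Low (idt C u)" using u by (simp add: idL)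
    from c[unfolded I] show ?thesis
    proof (cases rule: composableE)
      case (LL w v) thus ?thesis using idt_right[OF u(2)] by (simp add: I cLL)
    next
      case (TL t w) thus ?thesis using cls_eqI[OF RAct_idt[OF u(2)]] by (simp add: I cTL)
    next
      case (LT v t) thus ?thesis using cls_Low by metis
    next
      case (TT s t) thus ?thesis using cls_Low by metis
    qed
  qed
next
  fix x k i y assume x: "x \<in> cells A k" "k < Suc n" "i < k" and y: "y \<in> cells A (Suc i)" and c: "composable A i (idt A x) y"
  obtain u where u: "x = Low u" "u \<in> cells C k" using x by (auto elim: cellsE)
  obtain v where v: "y = Low v" "v \<in> cells C (Suc i)" using x y by (auto elim: cellsE)
  show "cmp A i (idt A x) y = idt A (cmp A i x y)"
  proof (cases "k = n")
    case True
    hence w: "wt (RAct i (Idt u) v)" using c u v by (simp add: idL kk wfI)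
    thus ?thesis using u v True cmpR_cells[OF w] by (simp add: idL cc) (intro cls_eqI RAct_Idt)
  next
    case False
    hence w: "composable C i (idt C u) v" using c u v by (simp add: idL kk wfI)
    have k: "idt C u \<in> cells C (Suc k)" "bdry C Plus k (idt C u) = u" using idt_cells bdry_idt u x False by auto
    have "composable C i u v" using compD[OF w k(1) v(2)] globular[OF k(1), of i k Plus Plus] k x
      by (intro compI[OF u(2) v(2)]) auto
    hence "cmp C i u v \<in> cells C k" using cmp_cells[OF u(2) v(2), of i] x(3) by (simp add: max.absorb1 Suc_le_eq)
    thus ?thesis using u v False cmp_idt_left[OF u(2) _ x(3) v(2) w] x by (simp add: idL cc)
  qed
next
  fix x k i y assume x: "x \<in> cells A k" "k < Suc n" "i < k" and y: "y \<in> cells A (Suc i)" and c: "composable A i y (idt A x)"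
  obtain u where u: "x = Low u" "u \<in> cells C k" using x by (auto elim: cellsE)
  obtain v where v: "y = Low v" "v \<in> cells C (Suc i)" using x y by (auto elim: cellsE)
  show "cmp A i y (idt A x) = idt A (cmp A i y x)"
  proof (cases "k = n")
    case True
    hence w: "wt (LAct i v (Idt u))" using c u v by (simp add: idL kk wfI)
    thus ?thesis using u v True cmpL_cells[OF w] by (simp add: idL cc) (intro cls_eqI LAct_Idt)
  next
    case False
    hence w: "composable C i v (idt C u)" using c u v by (simp add: idL kk wfI)
    have k: "idt C u \<in> cells C (Suc k)" "bdry C Minus k (idt C u) = u" using idt_cells bdry_idt u x False by auto
    have "composable C i v u" using compD[OF w v(2) k(1)] globular[OF k(1), of i k Minus Minus] k x
      by (intro compI[OF v(2) u(2)]) auto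
    hence "cmp C i v u \<in> cells C k" using cmp_cells[OF v(2) u(2), of i] x(3) by (simp add: max.absorb2 Suc_le_eq)
    thus ?thesis using u v False cmp_idt_right[OF u(2) _ x(3) v(2) w] x by (simp add: idL cc)
  qed
next
  fix i x y z assume a: "composable A i x y" "composable A i (cmp A i x y) z" "composable A i y z" "composable A i x (cmp A i y z)"
  consider (L) u where "x = Low u" | (T) s where "x = cls s" "wt s" using a(1) by (auto elim: composableE)
  note X = this
  consider (L) u where "y = Low u" | (T) s where "y = cls s" "wt s" using a(1) by (auto elim: composableE)
  note Y = this
  consider (L) u where "z = Low u" | (T) s where "z = cls s" "wt s" using a(3) by (auto elim: composableE)
  note Z = this
  show "cmp A i (cmp A i x y) z = cmp A i x (cmp A i y z)"
  proof (cases rule: X)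
    case x: (L u)
    show ?thesis
    proof (cases rule: Y)
      case y: (L v)
      show ?thesis
      proof (cases rule: Z)
        case (L w) thus ?thesis using a x y cmp_assoc by (simp add: cc kk)
      next
        case (T t) 
        have 1: "composable C i u v" "wt (LAct i v t)" "wt (LAct i (cmp C i u v) t)" using a x y T by (simp_all add: cc kk)
        hence "wt (LAct i u (LAct i v t))" using a x y T by (simp add: cc kk)
        thus ?thesis using x y T 1 by (simp add: cc) (intro cls_eqI LAct_LAct)
      qed
    next
      case y: (T t)
      have 1: "wt (LAct i u t)" using a x y by (simp add: kk)
      show ?thesis
      proof (cases rule: Z)
        case (L w)
        have 2: "wt (RAct i t w)" using a y L by (simp add: kk)
        have "wt (RAct i (LAct i u t) w)" "wt (LAct i u (RAct i t w))" using a x y L 1 2 by (simp_all add: cc kk)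
        thus ?thesis using x y L 1 2 by (simp add: cc) (intro cls_eqI LAct_RAct)
      next
        case (T s) thus ?thesis using a x y 1 by (simp add: kk wfL)
      qed
    qed
  next
    case x: (T r)
    show ?thesis
    proof (cases rule: Y)
      case y: (L v)
      have 1: "wt (RAct i r v)" using a x y by (simp add: kk)
      show ?thesis
      proof (cases rule: Z)
        case (L w)
        have 2: "composable C i v w" using a y L by (simp add: kk)
        have "wt (RAct i (RAct i r v) w)" "wt (RAct i r (cmp C i v w))" using a x y L 1 2 by (simp_all add: cc kk)
        thus ?thesis using x y L 1 2 by (simp add: cc) (intro cls_eqI RAct_RAct)
      next
        case (T t)
        have 2: "wt (LAct i v t)" using a y T by (simp add: kk)
        thus ?thesis using a(2) x y T 1 2 by (simp add: kk cc) (simp add: wfL)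
      qed
    next
      case y: (T s)
      have 1: "i = n" "wt (Comp r s)" using a x y by (simp_all add: kk)
      show ?thesis
      proof (cases rule: Z)
        case (L w)
        thus ?thesis using a(3) x y 1 by (simp add: kk wfR)
      next
        case (T t)
        have 2: "wt (Comp s t)" using a y T by (simp add: kk)
        have "wt (Comp (Comp r s) t)" "wt (Comp r (Comp s t))" using a x y T 1 2 by (simp_all add: cc kk)
        thus ?thesis using x y T 1 2 by (simp add: cc) (intro cls_eqI Comp_assoc)
      qed
    qed
  qed
next
  fix i j x y z assume j: "i < j" and x: "x \<in> cells A (Suc i)" and a: "composable A j y z" "composable A i x (cmp A j y z)"
  have "j \<le> n" using a(1) cells_leA unfolding composable_def by fastforce
  then obtain u where u: "x = Low u" "u \<in> cells C (Suc i)" using x j by (auto elim: cellsE)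
  from a(1) show "cmp A i x (cmp A j y z) = cmp A j (cmp A i x y) (cmp A i x z)"
  proof (cases rule: composableE)
    case (LL v w) thus ?thesis using u a j distrib_left[of i j u v w] by (simp add: cc kk)
  next
    case (LT v t)
    have w: "wt (LAct i u (LAct j v t))" using a(2) LT u by (simp add: cc kk)
    note E = LAct_dist_LAct[OF j w]
    have w2: "wt (LAct j (cmp C i u v) (LAct i u t))" using eq_wf[OF E] by blast
    hence "wt (LAct i u t)" by (simp add: wfL[of j])
    thus ?thesis using u LT w w2 cls_eqI[OF E] by (simp add: cc)
  next
    case (TL t v)
    have w: "wt (LAct i u (RAct j t v))" using a(2) TL u by (simp add: cc kk)
    note E = LAct_dist_RAct[OF j w]
    have w2: "wt (RAct j (LAct i u t) (cmp C i u v))" using eq_wf[OF E] by blast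
    hence "wt (LAct i u t)" by (simp add: wfR[of j])
    thus ?thesis using u TL w w2 cls_eqI[OF E] by (simp add: cc)
  next
    case (TT s t)
    have w: "wt (LAct i u (Comp s t))" using a(2) TT u by (simp add: cc kk)
    note E = LAct_Comp[OF w]
    have w2: "wt (Comp (LAct i u s) (LAct i u t))" using eq_wf[OF E] by blast
    hence "wt (LAct i u t)" "wt (LAct i u s)" by (simp_all add: wfC)
    thus ?thesis using u TT w w2 cls_eqI[OF E] by (simp add: cc)
  qed
next
  fix i j x y z assume j: "i < j" and x: "x \<in> cells A (Suc i)" and a: "composable A j y z" "composable A i (cmp A j y z) x"
  have "j \<le> n" using a(1) cells_leA unfolding composable_def by fastforce
  then obtain u where u: "x = Low u" "u \<in> cells C (Suc i)" using x j by (auto elim: cellsE)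
  from a(1) show "cmp A i (cmp A j y z) x = cmp A j (cmp A i y x) (cmp A i z x)"
  proof (cases rule: composableE)
    case (LL v w) thus ?thesis using u a j distrib_right[of i j u v w] by (simp add: cc kk)
  next
    case (LT v t)
    have w: "wt (RAct i (LAct j v t) u)" using a(2) LT u by (simp add: cc kk)
    note E = RAct_dist_LAct[OF j w]
    have w2: "wt (LAct j (cmp C i v u) (RAct i t u))" using eq_wf[OF E] by blast
    hence "wt (RAct i t u)" by (simp add: wfL[of j])
    thus ?thesis using u LT w w2 cls_eqI[OF E] by (simp add: cc)
  next
    case (TL t v)
    have w: "wt (RAct i (RAct j t v) u)" using a(2) TL u by (simp add: cc kk)
    note E = RAct_dist_RAct[OF j w]
    have w2: "wt (RAct j (RAct i t u) (cmp C i v u))" using eq_wf[OF E] by blast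
    hence "wt (RAct i t u)" by (simp add: wfR[of j])
    thus ?thesis using u TL w w2 cls_eqI[OF E] by (simp add: cc)
  next
    case (TT s t)
    have w: "wt (RAct i (Comp s t) u)" using a(2) TT u by (simp add: cc kk)
    note E = RAct_Comp[OF w]
    have w2: "wt (Comp (RAct i s u) (RAct i t u))" using eq_wf[OF E] by blast
    hence "wt (RAct i t u)" "wt (RAct i s u)" by (simp_all add: wfC)
    thus ?thesis using u TT w w2 cls_eqI[OF E] by (simp add: cc)
  qed
qed

end

lemma precategory_adjoin:
  assumes "precategory n C" and "attachable n C G b"
  shows "precategory (Suc n) (adjoin n C G b)"
proof -
  interpret precategory n C by fact
  interpret adjunction n C G b using assms(2) by unfold_locales
  show ?thesis by (rule adj)
qed


section \<open>Prepolygraphs\<close>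

definition discrete :: "'g set \<Rightarrow> 'g precat" where
  "discrete G = \<lparr>
     cells = (\<lambda>k. if k = 0 then G else {}),
     bdry = (\<lambda>e k u. u),
     idt = (\<lambda>u. undefined),
     cmp = (\<lambda>i u v. undefined)\<rparr>"

type_synonym ('g0, 'g1) cell1 = "('g0, 'g1) ext"
type_synonym ('g0, 'g1, 'g2) cell2 = "(('g0, 'g1) cell1, 'g2) ext"
type_synonym ('g0, 'g1, 'g2, 'g3) cell3 = "(('g0, 'g1, 'g2) cell2, 'g3) ext"

record ('g0, 'g1, 'g2, 'g3, 'g4) prepoly =
  gens0 :: "'g0 set"
  gens1 :: "'g1 set"
  gens2 :: "'g2 set"
  gens3 :: "'g3 set"
  gens4 :: "'g4 set"
  bd1 :: "sign \<Rightarrow> 'g1 \<Rightarrow> 'g0"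
  bd2 :: "sign \<Rightarrow> 'g2 \<Rightarrow> ('g0, 'g1) cell1"
  bd3 :: "sign \<Rightarrow> 'g3 \<Rightarrow> ('g0, 'g1, 'g2) cell2"
  bd4 :: "sign \<Rightarrow> 'g4 \<Rightarrow> ('g0, 'g1, 'g2, 'g3) cell3"

definition free1 :: "('g0, 'g1, 'g2, 'g3, 'g4, 'z) prepoly_scheme \<Rightarrow> ('g0, 'g1) cell1 precat" where
  "free1 Q = adjoin 0 (discrete (gens0 Q)) (gens1 Q) (bd1 Q)"

definition free2 :: "('g0, 'g1, 'g2, 'g3, 'g4, 'z) prepoly_scheme \<Rightarrow>
    ('g0, 'g1, 'g2) cell2 precat" where
  "free2 Q = adjoin 1 (free1 Q) (gens2 Q) (bd2 Q)"

definition free3 :: "('g0, 'g1, 'g2, 'g3, 'g4, 'z) prepoly_scheme \<Rightarrow>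
    ('g0, 'g1, 'g2, 'g3) cell3 precat" where
  "free3 Q = adjoin 2 (free2 Q) (gens3 Q) (bd3 Q)"

definition prepolygraph4 :: "('g0, 'g1, 'g2, 'g3, 'g4, 'z) prepoly_scheme \<Rightarrow> bool" where
  "prepolygraph4 Q \<longleftrightarrow>
     attachable 0 (discrete (gens0 Q)) (gens1 Q) (bd1 Q) \<and>
     attachable 1 (free1 Q) (gens2 Q) (bd2 Q) \<and>
     attachable 2 (free2 Q) (gens3 Q) (bd3 Q) \<and>
     attachable 3 (free3 Q) (gens4 Q) (bd4 Q)"

lemma precategory_discrete: "precategory 0 (discrete G)"
  by unfold_locales (auto simp: discrete_def composable_def split: if_splits)

lemma precategory_free3: assumes "prepolygraph4 Q" shows "precategory 3 (free3 Q)"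
proof -
  have "precategory 1 (free1 Q)"
    using precategory_adjoin[OF precategory_discrete] assms unfolding prepolygraph4_def free1_def by auto
  from precategory_adjoin[OF this, of "gens2 Q" "bd2 Q"] have "precategory 2 (free2 Q)"
    using assms unfolding prepolygraph4_def free2_def numeral_2_eq_2 by simp
  from precategory_adjoin[OF this, of "gens3 Q" "bd3 Q"] show ?thesis
    using assms unfolding prepolygraph4_def free3_def by simp
qed

text \<open>The generators as cells of the free 3-precategory.\<close>

definition gen2 :: "('g0, 'g1, 'g2, 'g3, 'g4, 'z) prepoly_scheme \<Rightarrow> 'g2 \<Rightarrow>
    ('g0, 'g1, 'g2, 'g3) cell3" where
  "gen2 Q \<alpha> = Low (tm_class 1 (free1 Q) (gens2 Q) (bd2 Q) (Gen \<alpha>))"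

definition gen3 :: "('g0, 'g1, 'g2, 'g3, 'g4, 'z) prepoly_scheme \<Rightarrow> 'g3 \<Rightarrow>
    ('g0, 'g1, 'g2, 'g3) cell3" where
  "gen3 Q A = tm_class 2 (free2 Q) (gens3 Q) (bd3 Q) (Gen A)"


section \<open>Gray presentations and critical branchings\<close>

text \<open>
  The field \<open>xch\<close> gives the interchange generators, as \<^term>\<open>xch Q \<alpha> g \<beta>\<close> with \<open>g\<close> a 1-cell
  of the free 3-precategory. The distinguished 4-generators of a Gray presentation (independence and
  interchange naturality) are not imposed: the notions below do not involve dimension 4.
\<close>

record ('g0, 'g1, 'g2, 'g3, 'g4) gray = "('g0, 'g1, 'g2, 'g3, 'g4) prepoly" +
  xch :: "'g2 \<Rightarrow> ('g0, 'g1, 'g2, 'g3) cell3 \<Rightarrow> 'g2 \<Rightarrow> 'g3"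

context
  fixes Q :: "('g0, 'g1, 'g2, 'g3, 'g4) gray"
begin

abbreviation Cell :: "nat \<Rightarrow> ('g0, 'g1, 'g2, 'g3) cell3 set" where
  "Cell k \<equiv> cells (free3 Q) k"

abbreviation src :: "nat \<Rightarrow> ('g0, 'g1, 'g2, 'g3) cell3 \<Rightarrow> ('g0, 'g1, 'g2, 'g3) cell3" where
  "src k u \<equiv> bdry (free3 Q) Minus k u"

abbreviation tgt :: "nat \<Rightarrow> ('g0, 'g1, 'g2, 'g3) cell3 \<Rightarrow> ('g0, 'g1, 'g2, 'g3) cell3" where
  "tgt k u \<equiv> bdry (free3 Q) Plus k u"

abbreviation star0 (infixl "\<star>\<^sub>0" 75) where
  "u \<star>\<^sub>0 v \<equiv> cmp (free3 Q) 0 u v"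

abbreviation star1 (infixl "\<star>\<^sub>1" 70) where
  "u \<star>\<^sub>1 v \<equiv> cmp (free3 Q) 1 u v"

abbreviation G2 :: "'g2 \<Rightarrow> ('g0, 'g1, 'g2, 'g3) cell3" where
  "G2 \<equiv> gen2 Q"

abbreviation G3 :: "'g3 \<Rightarrow> ('g0, 'g1, 'g2, 'g3) cell3" where
  "G3 \<equiv> gen3 Q"

definition gray_presentation :: bool where
  "gray_presentation \<longleftrightarrow> prepolygraph4 Q \<and>
     (\<forall>\<alpha>\<in>gens2 Q. \<forall>\<beta>\<in>gens2 Q. \<forall>g\<in>Cell 1.
        tgt 0 (G2 \<alpha>) = src 0 g \<and> tgt 0 g = src 0 (G2 \<beta>) \<longrightarrow>
        (let f = src 1 (G2 \<alpha>); f' = tgt 1 (G2 \<alpha>); h = src 1 (G2 \<beta>); h' = tgt 1 (G2 \<beta>);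
             X = xch Q \<alpha> g \<beta>
         in X \<in> gens3 Q \<and>
            src 2 (G3 X) = (G2 \<alpha> \<star>\<^sub>0 g \<star>\<^sub>0 h) \<star>\<^sub>1 (f' \<star>\<^sub>0 g \<star>\<^sub>0 G2 \<beta>) \<and>
            tgt 2 (G3 X) = (f \<star>\<^sub>0 g \<star>\<^sub>0 G2 \<beta>) \<star>\<^sub>1 (G2 \<alpha> \<star>\<^sub>0 g \<star>\<^sub>0 h')))"

text \<open>Well-definedness of \<open>l \<star>\<^sub>0 u \<star>\<^sub>0 r\<close> and of \<open>\<kappa> \<star>\<^sub>1 (l \<star>\<^sub>0 S \<star>\<^sub>0 r) \<star>\<^sub>1 \<rho>\<close>.\<close>

definition whisk_ok :: "_ \<Rightarrow> _ \<Rightarrow> _ \<Rightarrow> bool" where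
  "whisk_ok l u r \<longleftrightarrow> l \<in> Cell 1 \<and> r \<in> Cell 1 \<and>
     composable (free3 Q) 0 l u \<and> composable (free3 Q) 0 (l \<star>\<^sub>0 u) r"

definition ctx_ok :: "_ \<Rightarrow> _ \<Rightarrow> _ \<Rightarrow> _ \<Rightarrow> _ \<Rightarrow> bool" where
  "ctx_ok \<kappa> l S r \<rho> \<longleftrightarrow> \<kappa> \<in> Cell 2 \<and> \<rho> \<in> Cell 2 \<and> whisk_ok l S r \<and>
     composable (free3 Q) 1 \<kappa> (l \<star>\<^sub>0 S \<star>\<^sub>0 r) \<and>
     composable (free3 Q) 1 (\<kappa> \<star>\<^sub>1 (l \<star>\<^sub>0 S \<star>\<^sub>0 r)) \<rho>"

text \<open>\<open>vlen \<phi> m\<close>: \<open>\<phi>\<close> is a \<open>\<star>\<^sub>1\<close>-composite of \<open>m\<close> whiskers; such an \<open>m\<close> is unique.\<close>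

inductive vlen :: "('g0, 'g1, 'g2, 'g3) cell3 \<Rightarrow> nat \<Rightarrow> bool" where
  "f \<in> Cell 1 \<Longrightarrow> vlen (idt (free3 Q) f) 0"
| "\<alpha> \<in> gens2 Q \<Longrightarrow> whisk_ok l (G2 \<alpha>) r \<Longrightarrow> vlen \<phi> m \<Longrightarrow>
   composable (free3 Q) 1 (l \<star>\<^sub>0 G2 \<alpha> \<star>\<^sub>0 r) \<phi> \<Longrightarrow>
   vlen ((l \<star>\<^sub>0 G2 \<alpha> \<star>\<^sub>0 r) \<star>\<^sub>1 \<phi>) (Suc m)"

definition length2 :: "('g0, 'g1, 'g2, 'g3) cell3 \<Rightarrow> nat" where
  "length2 \<phi> = (THE m. vlen \<phi> m)"

text \<open>
  Here \<open>\<phi>\<^sub>0\<close> is the composite of all whiskers of \<open>\<phi>\<close> but the last, and \<open>\<psi>\<^sub>0\<close> that of all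
  whiskers of \<open>\<psi>\<close> but the first.
\<close>

definition elementary_swap :: "_ \<Rightarrow> _ \<Rightarrow> _ \<Rightarrow> bool" where
  "elementary_swap \<phi> \<psi> S \<longleftrightarrow>
     \<phi> \<in> Cell 2 \<and> \<psi> \<in> Cell 2 \<and> tgt 0 \<phi> = src 0 \<psi> \<and>
     (\<exists>\<phi>\<^sub>0 f \<alpha> g f' \<beta> g' \<psi>\<^sub>0. \<phi>\<^sub>0 \<in> Cell 2 \<and> \<psi>\<^sub>0 \<in> Cell 2 \<and> \<alpha> \<in> gens2 Q \<and> \<beta> \<in> gens2 Q \<and>
        whisk_ok f (G2 \<alpha>) g \<and> whisk_ok f' (G2 \<beta>) g' \<and>
        composable (free3 Q) 1 \<phi>\<^sub>0 (f \<star>\<^sub>0 G2 \<alpha> \<star>\<^sub>0 g) \<and> \<phi> = \<phi>\<^sub>0 \<star>\<^sub>1 (f \<star>\<^sub>0 G2 \<alpha> \<star>\<^sub>0 g) \<and>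
        composable (free3 Q) 1 (f' \<star>\<^sub>0 G2 \<beta> \<star>\<^sub>0 g') \<psi>\<^sub>0 \<and> \<psi> = (f' \<star>\<^sub>0 G2 \<beta> \<star>\<^sub>0 g') \<star>\<^sub>1 \<psi>\<^sub>0 \<and>
        S = (\<phi>\<^sub>0 \<star>\<^sub>0 src 1 \<psi>) \<star>\<^sub>1 (f \<star>\<^sub>0 G3 (xch Q \<alpha> (g \<star>\<^sub>0 f') \<beta>) \<star>\<^sub>0 g') \<star>\<^sub>1 (tgt 1 \<phi> \<star>\<^sub>0 \<psi>\<^sub>0))"

definition rewriting_step :: "_ \<Rightarrow> bool" where
  "rewriting_step S \<longleftrightarrow>
     (\<exists>A\<in>gens3 Q. \<exists>\<kappa> l r \<rho>. ctx_ok \<kappa> l (G3 A) r \<rho> \<and> S = \<kappa> \<star>\<^sub>1 (l \<star>\<^sub>0 G3 A \<star>\<^sub>0 r) \<star>\<^sub>1 \<rho>)"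

definition local_branching :: "_ \<Rightarrow> _ \<Rightarrow> bool" where
  "local_branching S1 S2 \<longleftrightarrow> rewriting_step S1 \<and> rewriting_step S2 \<and> src 2 S1 = src 2 S2"

definition is_idt :: "nat \<Rightarrow> _ \<Rightarrow> bool" where
  "is_idt k u \<longleftrightarrow> (\<exists>v\<in>Cell k. u = idt (free3 Q) v)"

definition minimal :: "_ \<Rightarrow> _ \<Rightarrow> bool" where
  "minimal S1 S2 \<longleftrightarrow>
     (\<forall>S1' S2' \<kappa> l r \<rho>. local_branching S1' S2' \<and> ctx_ok \<kappa> l S1' r \<rho> \<and> ctx_ok \<kappa> l S2' r \<rho> \<and>
        S1 = \<kappa> \<star>\<^sub>1 (l \<star>\<^sub>0 S1' \<star>\<^sub>0 r) \<star>\<^sub>1 \<rho> \<and> S2 = \<kappa> \<star>\<^sub>1 (l \<star>\<^sub>0 S2' \<star>\<^sub>0 r) \<star>\<^sub>1 \<rho> \<longrightarrow>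
        is_idt 0 l \<and> is_idt 0 r \<and> is_idt 1 \<kappa> \<and> is_idt 1 \<rho>)"

definition independent :: "_ \<Rightarrow> _ \<Rightarrow> bool" where
  "independent S1 S2 \<longleftrightarrow>
     (\<exists>A1\<in>gens3 Q. \<exists>A2\<in>gens3 Q. \<exists>l1 r1 l2 r2. \<exists>\<chi>\<in>Cell 2.
        whisk_ok l1 (G3 A1) r1 \<and> whisk_ok l2 (G3 A2) r2 \<and>
        composable (free3 Q) 1 (l1 \<star>\<^sub>0 G3 A1 \<star>\<^sub>0 r1) \<chi> \<and>
        composable (free3 Q) 1 \<chi> (l2 \<star>\<^sub>0 G3 A2 \<star>\<^sub>0 r2) \<and>
        S1 = (l1 \<star>\<^sub>0 G3 A1 \<star>\<^sub>0 r1) \<star>\<^sub>1 \<chi> \<star>\<^sub>1 (l2 \<star>\<^sub>0 src 2 (G3 A2) \<star>\<^sub>0 r2) \<and>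
        S2 = (l1 \<star>\<^sub>0 src 2 (G3 A1) \<star>\<^sub>0 r1) \<star>\<^sub>1 \<chi> \<star>\<^sub>1 (l2 \<star>\<^sub>0 G3 A2 \<star>\<^sub>0 r2))"

definition natural :: "_ \<Rightarrow> _ \<Rightarrow> bool" where
  "natural S1 S2 \<longleftrightarrow>
     (\<exists>A\<in>gens3 Q. \<exists>g\<in>Cell 1. \<exists>\<psi>\<in>Cell 2.
        tgt 0 (G3 A) = src 0 g \<and> tgt 0 g = src 0 \<psi> \<and>
        S1 = (G3 A \<star>\<^sub>0 g \<star>\<^sub>0 src 1 \<psi>) \<star>\<^sub>1 (tgt 1 (G3 A) \<star>\<^sub>0 g \<star>\<^sub>0 \<psi>) \<and>
        elementary_swap (src 2 (G3 A)) (g \<star>\<^sub>0 \<psi>) S2) \<or>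
     (\<exists>B\<in>gens3 Q. \<exists>g\<in>Cell 1. \<exists>\<phi>\<in>Cell 2.
        tgt 0 \<phi> = src 0 g \<and> tgt 0 g = src 0 (G3 B) \<and>
        S1 = (\<phi> \<star>\<^sub>0 g \<star>\<^sub>0 src 1 (G3 B)) \<star>\<^sub>1 (tgt 1 \<phi> \<star>\<^sub>0 g \<star>\<^sub>0 G3 B) \<and>
        elementary_swap (\<phi> \<star>\<^sub>0 g) (src 2 (G3 B)) S2)"

definition critical :: "_ \<Rightarrow> _ \<Rightarrow> bool" where
  "critical S1 S2 \<longleftrightarrow> local_branching S1 S2 \<and> minimal S1 S2 \<and>
     S1 \<noteq> S2 \<and>
     \<not> independent S1 S2 \<and> \<not> independent S2 S1 \<and>
     \<not> natural S1 S2 \<and> \<not> natural S2 S1"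

end

end

(*
  A 2-cell is a word of whiskers and a 1-cell a word of generators, so the source of a local branching
  is a word of whiskers in which each of the two steps rewrites an interval. If the intervals are disjoint,
  minimality makes the branching independent. Otherwise some whisker belongs to both intervals, and
  l1 f1 = l2 f2 and g1 r1 = g2 r2 for the contexts of the two steps around it. A common prefix of l1 and l2
  is then a prefix of every whisker of the source, since the intervals cover it, and can be factored out;
  so by minimality l1 or l2 is trivial, and the other one is a prefix of f1 or f2. The same holds on the
  right. Hence all contexts range over finite sets.
*)

theory Submission
  imports Defs
begin

section \<open>Words of cells\<close>

text \<open>Dimensions are kept as the numerals \<open>1\<close>, \<open>2\<close>, \<open>3\<close> in the statements about \<open>free3 Q\<close>.\<close>

declare One_nat_def [simp del]

text \<open>The free cells are classes of terms under a large congruence, which is never inverted.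
  Instead a list is read off each term, shown invariant under every generating relation, and shown
  to determine the cell once its source is fixed; the source has to be given because all identities
  share the empty word. The obstacle is that intervals, prefixes and suffixes live on lists, whereas
  minimality speaks of factorisations of cells, so each factorisation of a list must be lifted back
  to cells: this is the purpose of \<open>unwrap\<close> and \<open>factor_step\<close>. Rewriting
  steps themselves are handled only through their 2-sources and contexts. The sets of 0- and
  1-generators may be infinite, so a bound on the length of a word does not leave finitely many
  choices; each word has to be cut out of the source of some 3-generator. Positive length of these
  sources makes every rewritten interval nonempty. Otherwise an empty interval could lie inside the
  other one without a common whisker, and nothing would relate the two contexts.\<close>

primrec gens_word :: "('c, 'g) tm \<Rightarrow> 'g list" where
  "gens_word (Gen g) = [g]"
| "gens_word (Idt c) = []"
| "gens_word (LAct i c t) = gens_word t"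
| "gens_word (RAct i t c) = gens_word t"
| "gens_word (Comp s t) = gens_word s @ gens_word t"

text \<open>A triple \<open>(l, g, r)\<close> stands for the whisker of the generator
  \<open>g\<close> by 1-cells with words \<open>l\<close> and \<open>r\<close>; this is the effect
  on lists of whiskering a 2-cell by 1-cells with words \<open>u\<close> and
  \<open>v\<close>.\<close>

definition wrap :: "'w list \<Rightarrow> 'w list \<Rightarrow> ('w list \<times> 'g \<times> 'w list) list \<Rightarrow>
    ('w list \<times> 'g \<times> 'w list) list" where
  "wrap u v = map (\<lambda>(l, g, r). (u @ l, g, r @ v))"

lemma wrap_simps [simp]:
  "wrap u v [] = []"
  "wrap u v ((l, g, r) # X) = (u @ l, g, r @ v) # wrap u v X"
  "wrap u v (X @ Y) = wrap u v X @ wrap u v Y"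
  "wrap u v (wrap u' v' X) = wrap (u @ u') (v' @ v) X"
  "length (wrap u v X) = length X"
  "wrap [] [] X = X"
  by (auto simp: wrap_def)

lemma wrap_inj [simp]: "wrap u v X = wrap u v Y \<longleftrightarrow> X = Y"
  unfolding wrap_def by (rule inj_map_eq_map) (auto simp: inj_on_def)

lemma wrap_eq_Nil [simp]: "wrap u v X = [] \<longleftrightarrow> X = []"
  by (simp add: wrap_def)

text \<open>\<open>\<omega>\<close> reads a word off each acting 1-cell. The index \<open>i\<close>
  can be ignored, since for \<open>n = 1\<close> a well-formed action has index 0.\<close>

primrec whiskers :: "('c \<Rightarrow> 'w list) \<Rightarrow> ('c, 'g) tm \<Rightarrow> ('w list \<times> 'g \<times> 'w list) list" where
  "whiskers \<omega> (Gen g) = [([], g, [])]"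
| "whiskers \<omega> (Idt c) = []"
| "whiskers \<omega> (LAct i c t) = wrap (\<omega> c) [] (whiskers \<omega> t)"
| "whiskers \<omega> (RAct i t c) = wrap [] (\<omega> c) (whiskers \<omega> t)"
| "whiskers \<omega> (Comp s t) = whiskers \<omega> s @ whiskers \<omega> t"

text \<open>Every relation of the congruence keeps the generators of a term in order. The word
  serves for 1-cells, where acting terms are never well formed because a discrete set has no cells
  of positive dimension.\<close>

lemma tm_eq_gens_word: "tm_eq n C G b t t' \<Longrightarrow> gens_word t = gens_word t'"
  by (induction rule: tm_eq.induct) auto

context adjunction
begin

text \<open>For \<open>n = 1\<close> all actions have index 0, so the four laws relating actions of
  indices \<open>i < j\<close> are vacuous; the other laws of actions become laws of concatenation
  through the two assumptions on \<open>\<omega>\<close>.\<close>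

lemma tm_eq_whiskers:
  assumes n: "n = 1"
    and cmp: "\<And>c d. c \<in> cells C 1 \<Longrightarrow> d \<in> cells C 1 \<Longrightarrow> composable C 0 c d \<Longrightarrow>
      \<omega> (cmp C 0 c d) = \<omega> c @ \<omega> d"
    and idt: "\<And>x. x \<in> cells C 0 \<Longrightarrow> \<omega> (idt C x) = []"
  shows "eq t t' \<Longrightarrow> whiskers \<omega> t = whiskers \<omega> t'"
proof (induction rule: tm_eq.induct)
  case (LAct_LAct i c d t)
  hence "i < n" "c \<in> cells C (Suc i)" "d \<in> cells C (Suc i)" by (auto simp: wfL)
  hence "i = 0" "c \<in> cells C 1" "d \<in> cells C 1" using n by (auto simp: One_nat_def)
  thus ?case using LAct_LAct(1) by (simp add: cmp)
next
  case (RAct_RAct i c d t)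
  hence "i < n" "c \<in> cells C (Suc i)" "d \<in> cells C (Suc i)" by (auto simp: wfR)
  hence "i = 0" "c \<in> cells C 1" "d \<in> cells C 1" using n by (auto simp: One_nat_def)
  thus ?case using RAct_RAct(1) by (simp add: cmp)
next
  case (LAct_idt x i t)
  hence "i < n" by (simp add: wfL)
  hence "i = 0" using n by simp
  thus ?case using LAct_idt by (simp add: idt)
next
  case (RAct_idt x i t)
  hence "i < n" by (simp add: wfR)
  hence "i = 0" using n by simp
  thus ?case using RAct_idt by (simp add: idt)
next
  case (LAct_dist_LAct i j c d t)
  hence "j < n" by (simp add: wfL)
  thus ?case using LAct_dist_LAct(1) n by simp
next
  case (LAct_dist_RAct i j c t d)
  hence "j < n" by (simp add: wfL wfR)
  thus ?case using LAct_dist_RAct(1) n by simp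
next
  case (RAct_dist_LAct i j d t c)
  hence "j < n" by (simp add: wfL wfR)
  thus ?case using RAct_dist_LAct(1) n by simp
next
  case (RAct_dist_RAct i j t d c)
  hence "j < n" by (simp add: wfR)
  thus ?case using RAct_dist_RAct(1) n by simp
qed auto

end

text \<open>\<open>rep\<close> picks an arbitrary term of the class; \<open>ext_word_cls\<close>
  shows that the choice does not matter. On lower cells the empty word is a default value.\<close>

definition ext_word :: "('c, 'g) ext \<Rightarrow> 'g list" where
  "ext_word x = (case x of Low c \<Rightarrow> [] | Top T \<Rightarrow> gens_word (rep T))"

text \<open>There is one \<open>Low\<close> for each later adjunction: a 1-cell appears at the first
  stage and is embedded twice, a 2-cell is embedded once. All other shapes get a default
  value.\<close>

definition word1 :: "('g0, 'g1, 'g2, 'g3) cell3 \<Rightarrow> 'g1 list" where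
  "word1 f = (case f of Low (Low x) \<Rightarrow> ext_word x | _ \<Rightarrow> [])"

definition word2 :: "('g0, 'g1, 'g2, 'g3) cell3 \<Rightarrow> ('g1 list \<times> 'g2 \<times> 'g1 list) list" where
  "word2 \<phi> = (case \<phi> of Low (Top T) \<Rightarrow> whiskers ext_word (rep T) | _ \<Rightarrow> [])"

lemma (in adjunction) ext_word_cls: "wt t \<Longrightarrow> ext_word (cls t) = gens_word t"
  using tm_eq_gens_word[OF rep_cls] by (force simp: ext_word_def tm_class_def)

lemma discrete_simps:
  "cells (discrete G) k = (if k = 0 then G else {})" "bdry (discrete G) e k u = u"
  by (simp_all add: discrete_def)

section \<open>The stages of the free 3-precategory\<close>

locale prepolygraph =
  fixes Q :: "('g0, 'g1, 'g2, 'g3, 'g4) gray"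
  assumes pp: "prepolygraph4 Q"
begin

lemma adj0: "adjunction 0 (discrete (gens0 Q)) (gens1 Q) (bd1 Q)"
  using pp precategory_discrete by (simp add: adjunction_def adjunction_axioms_def prepolygraph4_def)

lemma adj1: "adjunction 1 (free1 Q) (gens2 Q) (bd2 Q)"
  using pp adjunction.adj[OF adj0]
  by (simp add: adjunction_def adjunction_axioms_def prepolygraph4_def free1_def One_nat_def)

lemma adj2: "adjunction 2 (free2 Q) (gens3 Q) (bd3 Q)"
  using pp adjunction.adj[OF adj1]
  by (simp add: adjunction_def adjunction_axioms_def prepolygraph4_def free2_def Suc_1)

text \<open>This makes the boundary laws derived in \<open>adjunction\<close>, such as
  \<open>bdry_cmp_i\<close> and \<open>bdry_cmp_up_L\<close>, available for \<open>free3 Q\<close>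
  itself.\<close>

lemma adj3: "adjunction 3 (free3 Q) (gens4 Q) (bd4 Q)"
  using pp precategory_free3[OF pp]
  by (simp add: adjunction_def adjunction_axioms_def prepolygraph4_def)

end

sublocale prepolygraph \<subseteq> D0: adjunction 0 "discrete (gens0 Q)" "gens1 Q" "bd1 Q"
  by (rule adj0)
sublocale prepolygraph \<subseteq> D1: adjunction 1 "free1 Q" "gens2 Q" "bd2 Q"
  by (rule adj1)
sublocale prepolygraph \<subseteq> D2: adjunction 2 "free2 Q" "gens3 Q" "bd3 Q"
  by (rule adj2)
sublocale prepolygraph \<subseteq> F: adjunction 3 "free3 Q" "gens4 Q" "bd4 Q"
  by (rule adj3)

context prepolygraph
begin

lemmas F1 = D0.cTT[folded free1_def] D0.kTT[folded free1_def] D0.bdT[folded free1_def]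
  D0.bdL[folded free1_def] D0.idL[folded free1_def] D0.LowA[folded free1_def] D0.clsA[folded free1_def]
lemmas F2 = D1.cc[folded free2_def] D1.kk[folded free2_def] D1.bdT[folded free2_def]
  D1.bdL[folded free2_def] D1.idL[folded free2_def] D1.LowA[folded free2_def] D1.clsA[folded free2_def]
lemmas F3 = D2.cc[folded free3_def] D2.kk[folded free3_def] D2.bdT[folded free3_def]
  D2.bdL[folded free3_def] D2.idL[folded free3_def] D2.LowA[folded free3_def] D2.clsA[folded free3_def]

abbreviation Cl :: "nat \<Rightarrow> ('g0, 'g1, 'g2, 'g3) cell3 set" where
  "Cl k \<equiv> cells (free3 Q) k"
abbreviation bd :: "sign \<Rightarrow> nat \<Rightarrow> ('g0, 'g1, 'g2, 'g3) cell3 \<Rightarrow> ('g0, 'g1, 'g2, 'g3) cell3" where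
  "bd e k u \<equiv> bdry (free3 Q) e k u"
abbreviation sr :: "nat \<Rightarrow> ('g0, 'g1, 'g2, 'g3) cell3 \<Rightarrow> ('g0, 'g1, 'g2, 'g3) cell3" where
  "sr k u \<equiv> bdry (free3 Q) Minus k u"
abbreviation tg :: "nat \<Rightarrow> ('g0, 'g1, 'g2, 'g3) cell3 \<Rightarrow> ('g0, 'g1, 'g2, 'g3) cell3" where
  "tg k u \<equiv> bdry (free3 Q) Plus k u"
abbreviation cmp0 :: "('g0, 'g1, 'g2, 'g3) cell3 \<Rightarrow> ('g0, 'g1, 'g2, 'g3) cell3 \<Rightarrow> ('g0, 'g1, 'g2, 'g3) cell3"
    (infixl "\<cdot>\<^sub>0" 75) where
  "u \<cdot>\<^sub>0 v \<equiv> cmp (free3 Q) 0 u v"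
abbreviation cmp1 :: "('g0, 'g1, 'g2, 'g3) cell3 \<Rightarrow> ('g0, 'g1, 'g2, 'g3) cell3 \<Rightarrow> ('g0, 'g1, 'g2, 'g3) cell3"
    (infixl "\<cdot>\<^sub>1" 70) where
  "u \<cdot>\<^sub>1 v \<equiv> cmp (free3 Q) 1 u v"
abbreviation one :: "('g0, 'g1, 'g2, 'g3) cell3 \<Rightarrow> ('g0, 'g1, 'g2, 'g3) cell3" where
  "one u \<equiv> idt (free3 Q) u"

section \<open>Terms of dimensions 1 and 2 as cells, and their words\<close>

definition tm1 :: "('g0, 'g1) tm \<Rightarrow> ('g0, 'g1, 'g2, 'g3) cell3" where
  "tm1 t = Low (Low (D0.cls t))"

definition tm2 :: "(('g0, 'g1) cell1, 'g2) tm \<Rightarrow> ('g0, 'g1, 'g2, 'g3) cell3" where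
  "tm2 t = Low (D1.cls t)"

lemma cell1E: assumes "f \<in> Cl 1" obtains t where "D0.wt t" "f = tm1 t"
proof -
  from assms obtain x where "f = Low x" "x \<in> cells (free2 Q) 1"
    unfolding free3_def by (auto elim: D2.cellsE)
  moreover then obtain y where "x = Low y" "y \<in> cells (free1 Q) 1"
    unfolding free2_def by (auto elim: D1.cellsE)
  moreover then obtain t where "y = D0.cls t" "D0.wt t"
    unfolding free1_def by (auto elim: D0.cellsE)
  ultimately show ?thesis using that by (simp add: tm1_def)
qed

lemma cell0E: assumes "x \<in> Cl 0" obtains y where "y \<in> gens0 Q" "x = Low (Low (Low y))"
proof -
  from assms obtain z where "x = Low z" "z \<in> cells (free2 Q) 0"
    unfolding free3_def by (auto elim: D2.cellsE)
  moreover then obtain y where "z = Low y" "y \<in> cells (free1 Q) 0"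
    unfolding free2_def by (auto elim: D1.cellsE)
  moreover then obtain t where "y = Low t" "t \<in> gens0 Q"
    unfolding free1_def by (auto elim: D0.cellsE simp: discrete_simps)
  ultimately show ?thesis using that by simp
qed

lemma cell2E: assumes "\<phi> \<in> Cl 2" obtains t where "D1.wt t" "\<phi> = tm2 t"
proof -
  from assms obtain x where "\<phi> = Low x" "x \<in> cells (free2 Q) 2"
    unfolding free3_def by (auto elim: D2.cellsE)
  moreover then obtain t where "x = D1.cls t" "D1.wt t"
    unfolding free2_def by (auto elim: D1.cellsE)
  ultimately show ?thesis using that by (simp add: tm2_def)
qed

lemma tm1_cell: "D0.wt t \<Longrightarrow> tm1 t \<in> Cl 1"
  by (simp add: tm1_def F1 F2 F3 One_nat_def)

lemma tm2_cell: "D1.wt t \<Longrightarrow> tm2 t \<in> Cl 2"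
  by (simp add: tm2_def F2 F3 Suc_1)

lemma tm1_bd: "D0.wt t \<Longrightarrow> bd e 0 (tm1 t) = Low (Low (Low (D0.bd e t)))"
  by (simp add: tm1_def F1 F2 F3 discrete_simps)

lemma D1_bd1: "D1.wt t \<Longrightarrow> bdry (free1 Q) e 1 (D1.bd e t) = D1.bd e t"
  using D1.bdry_same[OF D1.wf_bd] .

lemma tm2_bd: "D1.wt t \<Longrightarrow> bd e 1 (tm2 t) = Low (Low (D1.bd e t))"
  by (simp add: tm2_def F2 F3 D1_bd1)

lemma tm1_Comp: "D0.wt (Comp s t) \<Longrightarrow> tm1 s \<cdot>\<^sub>0 tm1 t = tm1 (Comp s t)"
  by (simp add: tm1_def F1 F2 F3)

lemma tm1_wf_Comp: "D0.wt s \<Longrightarrow> D0.wt t \<Longrightarrow> tg 0 (tm1 s) = sr 0 (tm1 t) \<Longrightarrow> D0.wt (Comp s t)"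
  by (simp add: tm1_bd D0.wfC)

lemma tm1_Idt: "y \<in> gens0 Q \<Longrightarrow> one (Low (Low (Low y))) = tm1 (Idt y)"
  by (subst F3, force simp: F1 F2 F3 discrete_simps)+
    (auto simp: tm1_def F1 F2 F3 discrete_simps)

lemma tm2_Idt: "D0.wt t \<Longrightarrow> one (tm1 t) = tm2 (Idt (D0.cls t))"
  unfolding tm1_def tm2_def
  by (subst F3, force simp: F1 F2 F3 One_nat_def)+
    (auto simp: F1 F2 F3 One_nat_def)

lemma word1_tm1: "D0.wt t \<Longrightarrow> word1 (tm1 t) = gens_word t"
  by (simp add: word1_def tm1_def D0.ext_word_cls)

lemma word1_cmp0: assumes "f \<in> Cl 1" "g \<in> Cl 1" "tg 0 f = sr 0 g"
  shows "word1 (f \<cdot>\<^sub>0 g) = word1 f @ word1 g"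
proof -
  obtain s t where st: "D0.wt s" "f = tm1 s" "D0.wt t" "g = tm1 t"
    using assms(1,2) by (metis cell1E)
  hence "D0.wt (Comp s t)" using tm1_wf_Comp assms(3) by blast
  thus ?thesis using st by (simp add: tm1_Comp word1_tm1)
qed

lemma word1_one [simp]: "x \<in> Cl 0 \<Longrightarrow> word1 (one x) = []"
  by (elim cell0E) (simp add: tm1_Idt word1_tm1 D0.wfI discrete_simps)

lemma D1_whiskers:
  assumes "D1.eq t t'" shows "whiskers ext_word t = whiskers ext_word t'"
proof (rule D1.tm_eq_whiskers[OF refl _ _ assms])
  fix x assume "x \<in> cells (free1 Q) 0"
  then obtain y where "x = Low y" "y \<in> gens0 Q"
    unfolding free1_def by (auto elim: D0.cellsE simp: discrete_simps)
  thus "ext_word (idt (free1 Q) x) = []"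
    using D0.ext_word_cls[of "Idt y"] F1(5)[of y 0] by (simp add: discrete_simps D0.wfI)
next
  fix c d assume cd: "c \<in> cells (free1 Q) 1" "d \<in> cells (free1 Q) 1" "composable (free1 Q) 0 c d"
  then obtain s t where st: "D0.wt s" "c = D0.cls s" "D0.wt t" "d = D0.cls t"
    unfolding free1_def by (auto elim!: D0.cellsE)
  hence "D0.wt (Comp s t)" using cd(3) F1(2) by blast
  thus "ext_word (cmp (free1 Q) 0 c d) = ext_word c @ ext_word d"
    using st by (simp add: F1 D0.ext_word_cls)
qed

lemma word2_tm2: "D1.wt t \<Longrightarrow> word2 (tm2 t) = whiskers ext_word t"
  using D1_whiskers[OF D1.rep_cls] by (force simp: word2_def tm2_def tm_class_def)

lemma word2_one [simp]: assumes "f \<in> Cl 1" shows "word2 (one f) = []"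
proof -
  from assms obtain t where t: "D0.wt t" "f = tm1 t" by (rule cell1E)
  hence "D1.wt (Idt (D0.cls t))" using F1(7)[of t 1] by (subst D1.wfI) (simp add: One_nat_def)
  thus ?thesis using t by (simp add: tm2_Idt word2_tm2)
qed

lemma tm2_LAct: "D1.wt (LAct 0 (D0.cls s) t) \<Longrightarrow> tm1 s \<cdot>\<^sub>0 tm2 t = tm2 (LAct 0 (D0.cls s) t)"
  by (simp add: tm1_def tm2_def F2 F3)

lemma tm2_RAct: "D1.wt (RAct 0 t (D0.cls s)) \<Longrightarrow> tm2 t \<cdot>\<^sub>0 tm1 s = tm2 (RAct 0 t (D0.cls s))"
  by (simp add: tm1_def tm2_def F2 F3)

lemma tm2_Comp: "D1.wt (Comp s t) \<Longrightarrow> tm2 s \<cdot>\<^sub>1 tm2 t = tm2 (Comp s t)"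
  by (simp add: tm2_def F2 F3)

lemma tm2_bd0: "D1.wt t \<Longrightarrow> bd e 0 (tm2 t) = Low (Low (bdry (free1 Q) e 0 (D1.bd e t)))"
  by (simp add: tm2_def F2 F3)

lemma tm1_bd0: "D0.wt t \<Longrightarrow> bd e 0 (tm1 t) = Low (Low (bdry (free1 Q) e 0 (D0.cls t)))"
  by (simp add: tm1_def F2 F3)

lemma wf_LAct0: assumes "D0.wt s" "D1.wt t" "tg 0 (tm1 s) = sr 0 (tm2 t)"
  shows "D1.wt (LAct 0 (D0.cls s) t)"
  using assms by (simp add: tm1_bd0 tm2_bd0 D1.wfL F1)

lemma wf_RAct0: assumes "D0.wt s" "D1.wt t" "tg 0 (tm2 t) = sr 0 (tm1 s)"
  shows "D1.wt (RAct 0 t (D0.cls s))"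
  using assms by (simp add: tm1_bd0 tm2_bd0 D1.wfR F1)

lemma wf_Comp1: assumes "D1.wt s" "D1.wt t" "tg 1 (tm2 s) = sr 1 (tm2 t)"
  shows "D1.wt (Comp s t)"
  using assms by (simp add: tm2_bd D1.wfC)

lemma word2_cmp0_left: assumes "l \<in> Cl 1" "\<phi> \<in> Cl 2" "tg 0 l = sr 0 \<phi>"
  shows "word2 (l \<cdot>\<^sub>0 \<phi>) = wrap (word1 l) [] (word2 \<phi>)"
proof -
  obtain s t where st: "D0.wt s" "l = tm1 s" "D1.wt t" "\<phi> = tm2 t"
    using assms(1,2) by (metis cell1E cell2E)
  hence "D1.wt (LAct 0 (D0.cls s) t)" using wf_LAct0 assms(3) by blast
  thus ?thesis using st by (simp add: tm2_LAct word1_tm1 word2_tm2 D0.ext_word_cls)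
qed

lemma word2_cmp0_right: assumes "r \<in> Cl 1" "\<phi> \<in> Cl 2" "tg 0 \<phi> = sr 0 r"
  shows "word2 (\<phi> \<cdot>\<^sub>0 r) = wrap [] (word1 r) (word2 \<phi>)"
proof -
  obtain s t where st: "D0.wt s" "r = tm1 s" "D1.wt t" "\<phi> = tm2 t"
    using assms(1,2) by (metis cell1E cell2E)
  hence "D1.wt (RAct 0 t (D0.cls s))" using wf_RAct0 assms(3) by blast
  thus ?thesis using st by (simp add: tm2_RAct word1_tm1 word2_tm2 D0.ext_word_cls)
qed

lemma word2_cmp1: assumes "\<phi> \<in> Cl 2" "\<psi> \<in> Cl 2" "tg 1 \<phi> = sr 1 \<psi>"
  shows "word2 (\<phi> \<cdot>\<^sub>1 \<psi>) = word2 \<phi> @ word2 \<psi>"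
proof -
  obtain s t where st: "D1.wt s" "\<phi> = tm2 s" "D1.wt t" "\<psi> = tm2 t"
    using assms(1,2) by (metis cell2E)
  hence "D1.wt (Comp s t)" using wf_Comp1 assms(3) by blast
  thus ?thesis using st by (simp add: tm2_Comp word2_tm2)
qed

lemma gen2_cell: "\<alpha> \<in> gens2 Q \<Longrightarrow> gen2 Q \<alpha> \<in> Cl 2"
  using tm2_cell[of "Gen \<alpha>"] by (simp add: gen2_def tm2_def wf_Gen)

lemma word2_gen2 [simp]: "\<alpha> \<in> gens2 Q \<Longrightarrow> word2 (gen2 Q \<alpha>) = [([], \<alpha>, [])]"
  using word2_tm2[of "Gen \<alpha>"] by (simp add: gen2_def tm2_def wf_Gen)

lemma gen3_cell: "A \<in> gens3 Q \<Longrightarrow> gen3 Q A \<in> Cl 3"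
  using D2.clsA[of "Gen A" 3, folded free3_def] by (simp add: gen3_def wf_Gen)

section \<open>Whiskering\<close>

lemma bd_bd: "u \<in> Cl k \<Longrightarrow> i < j \<Longrightarrow> j \<le> k \<Longrightarrow> bd e i (bd d j u) = bd e i u"
  by (rule F.globular)

text \<open>Composability with a 1-cell along a 0-cell amounts to one equation between 0-boundaries,
  so that later side conditions are equations.\<close>

lemma cmp0_left: assumes l: "l \<in> Cl 1" and u: "u \<in> Cl k" and k: "1 \<le> k" and m: "tg 0 l = sr 0 u"
  shows "composable (free3 Q) 0 l u" "l \<cdot>\<^sub>0 u \<in> Cl k" "sr 0 (l \<cdot>\<^sub>0 u) = sr 0 l" "tg 0 (l \<cdot>\<^sub>0 u) = tg 0 u"
    "1 \<le> j \<Longrightarrow> j \<le> k \<Longrightarrow> bd e j (l \<cdot>\<^sub>0 u) = l \<cdot>\<^sub>0 bd e j u"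
proof -
  show c: "composable (free3 Q) 0 l u" using F.compI[OF l u, of 0] k m by (simp add: One_nat_def)
  show "l \<cdot>\<^sub>0 u \<in> Cl k" using F.cmp_cells[OF l u c] k by (simp add: max_def split: if_splits)
  show "sr 0 (l \<cdot>\<^sub>0 u) = sr 0 l" "tg 0 (l \<cdot>\<^sub>0 u) = tg 0 u"
    using F.bdry_cmp_i[OF l u c] by simp_all
  show "1 \<le> j \<Longrightarrow> j \<le> k \<Longrightarrow> bd e j (l \<cdot>\<^sub>0 u) = l \<cdot>\<^sub>0 bd e j u"
    using F.bdry_cmp_up_L(1)[of l 0 u k j e] l u c by (simp add: One_nat_def)
qed

lemma cmp0_right: assumes r: "r \<in> Cl 1" and u: "u \<in> Cl k" and k: "1 \<le> k" and m: "tg 0 u = sr 0 r"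
  shows "composable (free3 Q) 0 u r" "u \<cdot>\<^sub>0 r \<in> Cl k" "sr 0 (u \<cdot>\<^sub>0 r) = sr 0 u" "tg 0 (u \<cdot>\<^sub>0 r) = tg 0 r"
    "1 \<le> j \<Longrightarrow> j \<le> k \<Longrightarrow> bd e j (u \<cdot>\<^sub>0 r) = bd e j u \<cdot>\<^sub>0 r"
proof -
  show c: "composable (free3 Q) 0 u r" using F.compI[OF u r, of 0] k m by (simp add: One_nat_def)
  show "u \<cdot>\<^sub>0 r \<in> Cl k" using F.cmp_cells[OF u r c] k by (simp add: max_def split: if_splits)
  show "sr 0 (u \<cdot>\<^sub>0 r) = sr 0 u" "tg 0 (u \<cdot>\<^sub>0 r) = tg 0 r"
    using F.bdry_cmp_i[OF u r c] by simp_all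
  show "1 \<le> j \<Longrightarrow> j \<le> k \<Longrightarrow> bd e j (u \<cdot>\<^sub>0 r) = bd e j u \<cdot>\<^sub>0 r"
    using F.bdry_cmp_up_R(1)[of r 0 u k j e] r u c by (simp add: One_nat_def)
qed

text \<open>Composition along 0-cells requires one factor of dimension 1, so a triple composite
  exists only if at least two of the three cells are 1-cells; \<open>d\<close> lists the three
  cases.\<close>

lemma cmp0_assoc:
  assumes "u \<in> Cl i" "v \<in> Cl j" "w \<in> Cl k" "tg 0 u = sr 0 v" "tg 0 v = sr 0 w"
    and d: "i = 1 \<and> j = 1 \<and> 1 \<le> k \<or> i = 1 \<and> k = 1 \<and> 1 \<le> j \<or> j = 1 \<and> k = 1 \<and> 1 \<le> i"
  shows "(u \<cdot>\<^sub>0 v) \<cdot>\<^sub>0 w = u \<cdot>\<^sub>0 (v \<cdot>\<^sub>0 w)"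
  using d
proof (elim disjE conjE)
  assume "i = 1" "j = 1" "1 \<le> k"
  thus ?thesis using assms by (intro F.cmp_assoc) (auto simp: cmp0_left cmp0_left(1)[where k=k])
next
  assume "i = 1" "k = 1" "1 \<le> j"
  thus ?thesis using assms by (intro F.cmp_assoc) (auto simp: cmp0_left cmp0_right cmp0_left(1)[where k=j] cmp0_right(1)[where k=j])
next
  assume "j = 1" "k = 1" "1 \<le> i"
  thus ?thesis using assms by (intro F.cmp_assoc) (auto simp: cmp0_right cmp0_right(1)[where k=i])
qed

section \<open>Units and composition along 1-cells\<close>

lemma one_cell: "u \<in> Cl k \<Longrightarrow> k < 3 \<Longrightarrow> one u \<in> Cl (Suc k)"
  using F.idt_cells by simp

lemma one_0: assumes "x \<in> Cl 0" shows "one x \<in> Cl 1" "bd e 0 (one x) = x"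
  using assms one_cell[of x 0] F.bdry_idt[of x 0] by (simp_all add: One_nat_def)

lemma one_1: assumes "f \<in> Cl 1" shows "one f \<in> Cl 2" "bd e 1 (one f) = f" "bd e 0 (one f) = bd e 0 f"
proof -
  show c: "one f \<in> Cl 2" and b: "\<And>e. bd e 1 (one f) = f"
    using assms one_cell[of f 1] F.bdry_idt[of f 1] by (simp_all add: Suc_1)
  show "bd e 0 (one f) = bd e 0 f" using bd_bd[OF c, of 0 1 e e] b by simp
qed

lemma one_cmp0_left: assumes "u \<in> Cl k" "1 \<le> k" "x = sr 0 u" shows "one x \<cdot>\<^sub>0 u = u"
proof -
  have "x \<in> Cl 0" using F.bdry_cells[OF assms(1), of 0] assms by simp
  thus ?thesis using F.idt_left cmp0_left(1)[OF one_0(1) assms(1)] assms one_0(2) by metis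
qed

lemma one_cmp0_right: assumes "u \<in> Cl k" "1 \<le> k" "x = tg 0 u" shows "u \<cdot>\<^sub>0 one x = u"
proof -
  have "x \<in> Cl 0" using F.bdry_cells[OF assms(1), of 0] assms by simp
  thus ?thesis using F.idt_right cmp0_right(1)[OF one_0(1) assms(1)] assms one_0(2) by metis
qed

text \<open>Composability along a 1-cell, with the dimensions as parameters so that a pair of
  2-cells and a pair of a 2-cell and a 3-cell fall under the same lemmas.\<close>

definition seq :: "nat \<Rightarrow> nat \<Rightarrow> ('g0, 'g1, 'g2, 'g3) cell3 \<Rightarrow> ('g0, 'g1, 'g2, 'g3) cell3 \<Rightarrow> bool" where
  "seq k m u v \<longleftrightarrow> u \<in> Cl k \<and> v \<in> Cl m \<and> min k m = 2 \<and> tg 1 u = sr 1 v"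

lemma seqD: assumes "seq k m u v"
  shows "u \<in> Cl k" "v \<in> Cl m" "min k m = 2" "tg 1 u = sr 1 v" "2 \<le> k" "2 \<le> m"
    "bd e 0 u = bd e 0 v"
proof -
  show a: "u \<in> Cl k" "v \<in> Cl m" "min k m = 2" "tg 1 u = sr 1 v" and b: "2 \<le> k" "2 \<le> m"
    using assms by (auto simp: seq_def)
  have "bd e 0 (tg 1 u) = bd e 0 u" "bd e 0 (sr 1 v) = bd e 0 v"
    using bd_bd[OF a(1)] bd_bd[OF a(2)] b by auto
  thus "bd e 0 u = bd e 0 v" using a by simp
qed

lemma cmp1: assumes "seq k m u v"
  shows "composable (free3 Q) 1 u v" "u \<cdot>\<^sub>1 v \<in> Cl (max k m)" "sr 1 (u \<cdot>\<^sub>1 v) = sr 1 u" "tg 1 (u \<cdot>\<^sub>1 v) = tg 1 v"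
    "bd e 0 (u \<cdot>\<^sub>1 v) = bd e 0 u"
    "bd e 2 (u \<cdot>\<^sub>1 v) = bd e 2 u \<cdot>\<^sub>1 bd e 2 v"
proof -
  note s = seqD[OF assms]
  show c: "composable (free3 Q) 1 u v" using F.compI[OF s(1,2), of 1] s by (simp add: Suc_1)
  show x: "u \<cdot>\<^sub>1 v \<in> Cl (max k m)" using F.cmp_cells[OF s(1,2) c] .
  show "sr 1 (u \<cdot>\<^sub>1 v) = sr 1 u" "tg 1 (u \<cdot>\<^sub>1 v) = tg 1 v"
    using F.bdry_cmp_i[OF s(1,2) c] by simp_all
  show "bd e 0 (u \<cdot>\<^sub>1 v) = bd e 0 u" using F.bdry_cmp_low(1)[OF s(1,2) c] by simp
  show "bd e 2 (u \<cdot>\<^sub>1 v) = bd e 2 u \<cdot>\<^sub>1 bd e 2 v"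
  proof (cases "k = 2")
    case True
    thus ?thesis using F.bdry_cmp_up_L(1)[of u 1 v m 2 e] s c F.bdry_same[OF s(1), of e] by (simp add: Suc_1)
  next
    case False
    hence "m = 2" using s by (simp add: min_def split: if_splits)
    thus ?thesis using F.bdry_cmp_up_R(1)[of v 1 u k 2 e] s c F.bdry_same[OF s(2), of e] by (simp add: Suc_1)
  qed
qed

lemma seqI: "u \<in> Cl k \<Longrightarrow> v \<in> Cl m \<Longrightarrow> min k m = 2 \<Longrightarrow> tg 1 u = sr 1 v \<Longrightarrow> seq k m u v"
  by (simp add: seq_def)

text \<open>The three conditions on minima, two of them inside \<open>seq\<close>, say that at least
  two of the cells are 2-cells, as both bracketings require.\<close>

lemma cmp1_assoc: assumes "seq i j u v" "seq j k v w" "min i k = 2"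
  shows "(u \<cdot>\<^sub>1 v) \<cdot>\<^sub>1 w = u \<cdot>\<^sub>1 (v \<cdot>\<^sub>1 w)" "seq (max i j) k (u \<cdot>\<^sub>1 v) w" "seq i (max j k) u (v \<cdot>\<^sub>1 w)"
proof -
  note a = cmp1[OF assms(1)] cmp1[OF assms(2)] seqD[OF assms(1)] seqD[OF assms(2)]
  show "seq (max i j) k (u \<cdot>\<^sub>1 v) w" "seq i (max j k) u (v \<cdot>\<^sub>1 w)"
    using a assms(3) by (auto intro!: seqI simp: max_def min_def split: if_splits)
  from cmp1(1)[OF this(1)] cmp1(1)[OF this(2)] show "(u \<cdot>\<^sub>1 v) \<cdot>\<^sub>1 w = u \<cdot>\<^sub>1 (v \<cdot>\<^sub>1 w)"
    using a F.cmp_assoc by blast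
qed

lemma one_cmp1_left: assumes "u \<in> Cl k" "2 \<le> k" "f = sr 1 u"
  shows "one f \<cdot>\<^sub>1 u = u" "seq 2 k (one f) u"
proof -
  have f: "f \<in> Cl 1" using F.bdry_cells[OF assms(1), of 1] assms by simp
  thus s: "seq 2 k (one f) u" using assms one_1 by (auto simp: seq_def)
  thus "one f \<cdot>\<^sub>1 u = u" using F.idt_left f cmp1(1) by blast
qed

lemma one_cmp1_right: assumes "u \<in> Cl k" "2 \<le> k" "f = tg 1 u"
  shows "u \<cdot>\<^sub>1 one f = u" "seq k 2 u (one f)"
proof -
  have f: "f \<in> Cl 1" using F.bdry_cells[OF assms(1), of 1] assms by simp
  thus s: "seq k 2 u (one f)" using assms one_1 by (auto simp: seq_def)
  thus "u \<cdot>\<^sub>1 one f = u" using F.idt_right f cmp1(1) by blast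
qed

definition fit :: "nat \<Rightarrow> ('g0, 'g1, 'g2, 'g3) cell3 \<Rightarrow> ('g0, 'g1, 'g2, 'g3) cell3 \<Rightarrow>
    ('g0, 'g1, 'g2, 'g3) cell3 \<Rightarrow> bool" where
  "fit k l u r \<longleftrightarrow> l \<in> Cl 1 \<and> u \<in> Cl k \<and> r \<in> Cl 1 \<and> 1 \<le> k \<and> tg 0 l = sr 0 u \<and> tg 0 u = sr 0 r"

abbreviation wh :: "('g0, 'g1, 'g2, 'g3) cell3 \<Rightarrow> ('g0, 'g1, 'g2, 'g3) cell3 \<Rightarrow>
    ('g0, 'g1, 'g2, 'g3) cell3 \<Rightarrow> ('g0, 'g1, 'g2, 'g3) cell3" where
  "wh l u r \<equiv> l \<cdot>\<^sub>0 u \<cdot>\<^sub>0 r"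

lemma fitD: assumes "fit k l u r"
  shows "l \<in> Cl 1" "u \<in> Cl k" "r \<in> Cl 1" "1 \<le> k" "tg 0 l = sr 0 u" "tg 0 u = sr 0 r"
  using assms by (auto simp: fit_def)

lemma wh: assumes "fit k l u r"
  shows "wh l u r \<in> Cl k" "sr 0 (wh l u r) = sr 0 l" "tg 0 (wh l u r) = tg 0 r"
    "1 \<le> j \<Longrightarrow> j \<le> k \<Longrightarrow> bd e j (wh l u r) = wh l (bd e j u) r"
    "1 \<le> j \<Longrightarrow> j \<le> k \<Longrightarrow> fit j l (bd e j u) r"
    "wh l u r = l \<cdot>\<^sub>0 (u \<cdot>\<^sub>0 r)"
proof -
  note f = fitD[OF assms]
  note a = cmp0_left[OF f(1,2,4,5)]
  note b = cmp0_right[OF f(3) a(2) f(4)]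
  show "wh l u r \<in> Cl k" "sr 0 (wh l u r) = sr 0 l" "tg 0 (wh l u r) = tg 0 r" 
    "1 \<le> j \<Longrightarrow> j \<le> k \<Longrightarrow> bd e j (wh l u r) = wh l (bd e j u) r"
    using a b f by simp_all
  show "1 \<le> j \<Longrightarrow> j \<le> k \<Longrightarrow> fit j l (bd e j u) r"
    using f bd_bd[OF f(2)] F.bdry_cells[OF f(2)] by (auto simp: fit_def)
  show "wh l u r = l \<cdot>\<^sub>0 (u \<cdot>\<^sub>0 r)"
    by (rule cmp0_assoc[OF f(1,2,3,5,6)]) (use f in auto)
qed

lemma whisk_ok_iff: "u \<in> Cl k \<Longrightarrow> 1 \<le> k \<Longrightarrow> whisk_ok Q l u r \<longleftrightarrow> fit k l u r"
proof
  assume u: "u \<in> Cl k" "1 \<le> k" and w: "whisk_ok Q l u r"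
  hence a: "l \<in> Cl 1" "r \<in> Cl 1" "composable (free3 Q) 0 l u" "composable (free3 Q) 0 (l \<cdot>\<^sub>0 u) r"
    by (simp_all add: whisk_ok_def)
  have b: "tg 0 l = sr 0 u" using F.compD[OF a(3,1) u(1)] by simp
  note c = cmp0_left[OF a(1) u b]
  have "tg 0 u = sr 0 r" using F.compD[OF a(4) c(2) a(2)] c by simp
  thus "fit k l u r" using a b u by (simp add: fit_def)
next
  assume u: "u \<in> Cl k" "1 \<le> k" and w: "fit k l u r"
  note f = fitD[OF w]
  note a = cmp0_left[OF f(1,2,4,5)]
  from a cmp0_right[OF f(3) a(2) f(4)] f show "whisk_ok Q l u r" by (simp add: whisk_ok_def)
qed

lemma wh_wh: assumes "fit k l' u r'" "l \<in> Cl 1" "r \<in> Cl 1" "tg 0 l = sr 0 l'" "tg 0 r' = sr 0 r"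
  shows "wh l (wh l' u r') r = wh (l \<cdot>\<^sub>0 l') u (r' \<cdot>\<^sub>0 r)" "fit k l (wh l' u r') r" "fit k (l \<cdot>\<^sub>0 l') u (r' \<cdot>\<^sub>0 r)"
proof -
  note f = fitD[OF assms(1)]
  note w = wh[OF assms(1)]
  have c: "u \<cdot>\<^sub>0 r' \<in> Cl k" "tg 0 (u \<cdot>\<^sub>0 r') = tg 0 r'" "sr 0 (u \<cdot>\<^sub>0 r') = sr 0 u"
    using cmp0_right[OF f(3,2,4,6)] by auto
  have d: "l \<cdot>\<^sub>0 l' \<in> Cl 1" "tg 0 (l \<cdot>\<^sub>0 l') = tg 0 l'" using cmp0_left[OF assms(2) f(1) _ assms(4)] by auto
  have d': "r' \<cdot>\<^sub>0 r \<in> Cl 1" "sr 0 (r' \<cdot>\<^sub>0 r) = sr 0 r'" using cmp0_left[OF f(3) assms(3) _ assms(5)] by auto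
  show "fit k l (wh l' u r') r" using w f assms by (simp add: fit_def)
  show F: "fit k (l \<cdot>\<^sub>0 l') u (r' \<cdot>\<^sub>0 r)" using d d' f by (simp add: fit_def)
  have "wh l (wh l' u r') r = (l \<cdot>\<^sub>0 (l' \<cdot>\<^sub>0 (u \<cdot>\<^sub>0 r'))) \<cdot>\<^sub>0 r" using w by simp
  also have "l \<cdot>\<^sub>0 (l' \<cdot>\<^sub>0 (u \<cdot>\<^sub>0 r')) = (l \<cdot>\<^sub>0 l') \<cdot>\<^sub>0 (u \<cdot>\<^sub>0 r')"
    by (rule cmp0_assoc[OF assms(2) f(1) c(1), symmetric]) (use c f assms in auto)
  also have "(l \<cdot>\<^sub>0 l') \<cdot>\<^sub>0 (u \<cdot>\<^sub>0 r') \<cdot>\<^sub>0 r = (l \<cdot>\<^sub>0 l') \<cdot>\<^sub>0 (u \<cdot>\<^sub>0 r' \<cdot>\<^sub>0 r)"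
    by (rule cmp0_assoc[OF d(1) c(1) assms(3)]) (use c d f assms in auto)
  also have "u \<cdot>\<^sub>0 r' \<cdot>\<^sub>0 r = u \<cdot>\<^sub>0 (r' \<cdot>\<^sub>0 r)"
    by (rule cmp0_assoc[OF f(2,3) assms(3)]) (use c d f assms in auto)
  finally show "wh l (wh l' u r') r = wh (l \<cdot>\<^sub>0 l') u (r' \<cdot>\<^sub>0 r)" using wh(6)[OF F] by simp
qed

text \<open>Cells composed along a 1-cell have the same 0-boundaries, so a context that fits one
  factor fits the other and the composite; hence the disjunction in the assumption. Distributivity
  is then applied on the left and on the right.\<close>

lemma wh_cmp1: assumes s: "seq k m u v" and f: "fit k l u r \<or> fit m l v r"
  shows "wh l (u \<cdot>\<^sub>1 v) r = wh l u r \<cdot>\<^sub>1 wh l v r" "seq k m (wh l u r) (wh l v r)"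
    "fit (max k m) l (u \<cdot>\<^sub>1 v) r" "fit k l u r" "fit m l v r"
proof -
  note a = seqD[OF s] cmp1[OF s]
  show fu: "fit k l u r" and fv: "fit m l v r" and F: "fit (max k m) l (u \<cdot>\<^sub>1 v) r"
    using f a a(7)[of Minus] a(7)[of Plus] a(12)[of Minus] a(12)[of Plus] by (auto simp: fit_def)
  show S: "seq k m (wh l u r) (wh l v r)" using a wh[OF fu] wh[OF fv] by (simp add: seq_def)
  note g = fitD[OF fu] fitD[OF fv] fitD[OF F]
  have lu: "l \<cdot>\<^sub>0 u \<in> Cl k" "l \<cdot>\<^sub>0 v \<in> Cl m" and L: "composable (free3 Q) 0 l (u \<cdot>\<^sub>1 v)"
    using cmp0_left(2)[OF g(1) g(2)] cmp0_left(2)[OF g(1) g(8)] cmp0_left(1)[OF g(1) g(14)] g by auto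
  have e: "l \<cdot>\<^sub>0 (u \<cdot>\<^sub>1 v) = l \<cdot>\<^sub>0 u \<cdot>\<^sub>1 (l \<cdot>\<^sub>0 v)"
    using F.distrib_left[of 0 1 l u v] g(1) L a by (simp add: One_nat_def)
  have s2: "seq k m (l \<cdot>\<^sub>0 u) (l \<cdot>\<^sub>0 v)"
    using lu a cmp0_left(5)[OF g(1) g(2), of 1 Plus] cmp0_left(5)[OF g(1) g(8), of 1 Minus] g by (simp add: seq_def)
  have t: "tg 0 (l \<cdot>\<^sub>0 u \<cdot>\<^sub>1 (l \<cdot>\<^sub>0 v)) = sr 0 r"
    using cmp0_left(4)[OF g(1) g(14)] g e by simp
  have "composable (free3 Q) 0 (l \<cdot>\<^sub>0 u \<cdot>\<^sub>1 (l \<cdot>\<^sub>0 v)) r"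
    using cmp0_right(1)[OF g(3) cmp1(2)[OF s2] _ t] g by simp
  hence "(l \<cdot>\<^sub>0 u \<cdot>\<^sub>1 (l \<cdot>\<^sub>0 v)) \<cdot>\<^sub>0 r = wh l u r \<cdot>\<^sub>1 wh l v r"
    using F.distrib_right[of 0 1 r "l \<cdot>\<^sub>0 u" "l \<cdot>\<^sub>0 v"] g(3) cmp1(1)[OF s2] by (simp add: One_nat_def)
  thus "wh l (u \<cdot>\<^sub>1 v) r = wh l u r \<cdot>\<^sub>1 wh l v r" using e by simp
qed

lemma wh_one: assumes "u \<in> Cl k" "1 \<le> k" "x = sr 0 u" "y = tg 0 u"
  shows "wh (one x) u (one y) = u" "fit k (one x) u (one y)"
proof -
  have "x \<in> Cl 0" "y \<in> Cl 0" using F.bdry_cells[OF assms(1), of 0] assms by simp_all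
  thus "fit k (one x) u (one y)" using assms one_0 by (simp add: fit_def)
  show "wh (one x) u (one y) = u" using one_cmp0_left[OF assms(1-3)] one_cmp0_right[OF assms(1,2,4)] by simp
qed

lemma wh_idt: assumes "fit 1 l f r"
  shows "wh l (one f) r = one (wh l f r)" "fit 2 l (one f) r"
proof -
  note f = fitD[OF assms]
  note o = one_1[OF f(2)]
  show F: "fit 2 l (one f) r" using f o by (simp add: fit_def)
  have c: "composable (free3 Q) 0 l (one f)" using cmp0_left(1)[OF f(1) o(1)] f o by simp
  have e: "l \<cdot>\<^sub>0 one f = one (l \<cdot>\<^sub>0 f)"
    using F.cmp_idt_right[OF f(2) _ _ _ c] f(1) by (simp add: One_nat_def)
  have lf: "l \<cdot>\<^sub>0 f \<in> Cl 1" "tg 0 (l \<cdot>\<^sub>0 f) = tg 0 f" using cmp0_left[OF f(1,2,4,5)] by auto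
  have "composable (free3 Q) 0 (one (l \<cdot>\<^sub>0 f)) r"
    using cmp0_right(1)[OF f(3) one_1(1)[OF lf(1)]] one_1(3)[OF lf(1)] lf f by simp
  thus "wh l (one f) r = one (wh l f r)"
    using e F.cmp_idt_left[OF lf(1), of 0 r] f(3) by (simp add: One_nat_def)
qed

lemma word1_wh: "fit 1 l f r \<Longrightarrow> word1 (wh l f r) = word1 l @ word1 f @ word1 r"
  using cmp0_left[of l f 1] word1_cmp0[of l f] word1_cmp0[of "l \<cdot>\<^sub>0 f" r] by (auto simp: fit_def)

lemma word2_wh: "fit 2 l \<phi> r \<Longrightarrow> word2 (wh l \<phi> r) = wrap (word1 l) (word1 r) (word2 \<phi>)"
  using cmp0_left[of l \<phi> 2] word2_cmp0_left[of l \<phi>] word2_cmp0_right[of r "l \<cdot>\<^sub>0 \<phi>"] by (auto simp: fit_def)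

section \<open>Cells are determined by their words\<close>

definition gen1 :: "'g1 \<Rightarrow> ('g0, 'g1, 'g2, 'g3) cell3" where
  "gen1 g = tm1 (Gen g)"

lemma gen1_cell: "g \<in> gens1 Q \<Longrightarrow> gen1 g \<in> Cl 1" and word1_gen1: "g \<in> gens1 Q \<Longrightarrow> word1 (gen1 g) = [g]"
  by (simp_all add: gen1_def tm1_cell word1_tm1 wf_Gen)

lemma sr0_cell: "u \<in> Cl k \<Longrightarrow> bd e 0 u \<in> Cl 0"
  using F.bdry_cells by blast

text \<open>Induction on a term: associativity moves the first generator of a left factor to the
  front of the composite, and an identity as left factor disappears.\<close>

lemma cell1_cases: assumes "f \<in> Cl 1"
  obtains (one) "f = one (sr 0 f)"
  | (gen) g f' where "g \<in> gens1 Q" "f' \<in> Cl 1" "tg 0 (gen1 g) = sr 0 f'" "f = gen1 g \<cdot>\<^sub>0 f'"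
proof -
  have "tm1 t = one (sr 0 (tm1 t)) \<or> (\<exists>g f'. g \<in> gens1 Q \<and> f' \<in> Cl 1 \<and> tg 0 (gen1 g) = sr 0 f' \<and>
      tm1 t = gen1 g \<cdot>\<^sub>0 f')" if "D0.wt t" for t
    using that
  proof (induction rule: wf_tm.induct)
    case (wf_Gen g)
    note c = gen1_cell[OF wf_Gen]
    have "tm1 (Gen g) = gen1 g \<cdot>\<^sub>0 one (tg 0 (gen1 g))"
      using one_cmp0_right[OF c] by (simp add: gen1_def)
    moreover have "one (tg 0 (gen1 g)) \<in> Cl 1" "sr 0 (one (tg 0 (gen1 g))) = tg 0 (gen1 g)"
      using one_0[OF sr0_cell[OF c]] by simp_all
    ultimately show ?case using wf_Gen by metis
  next
    case (wf_Idt c)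
    hence "c \<in> gens0 Q" "D0.wt (Idt c)" by (simp_all add: discrete_simps D0.wfI)
    thus ?case using tm1_Idt[of c] tm1_bd[of "Idt c" Minus] by simp
  next
    case (wf_LAct c i t) thus ?case by (simp add: discrete_simps)
  next
    case (wf_RAct c i t) thus ?case by (simp add: discrete_simps)
  next
    case (wf_Comp s t)
    hence w: "D0.wt (Comp s t)" by (simp add: D0.wfC)
    note e = tm1_Comp[OF w, symmetric]
    have c: "tm1 s \<in> Cl 1" "tm1 t \<in> Cl 1" "tg 0 (tm1 s) = sr 0 (tm1 t)"
      using wf_Comp(1-3) tm1_cell tm1_bd by simp_all
    from wf_Comp(4) show ?case
    proof (elim disjE exE conjE)
      assume s: "tm1 s = one (sr 0 (tm1 s))"
      have "tg 0 (tm1 s) = sr 0 (tm1 s)" using one_0[OF sr0_cell[OF c(1)]] s by metis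
      hence "tm1 (Comp s t) = tm1 t" unfolding e using one_cmp0_left[OF c(2)] c(3) s by simp
      thus ?case using wf_Comp(5) by simp
    next
      fix g f' assume g: "g \<in> gens1 Q" "f' \<in> Cl 1" "tg 0 (gen1 g) = sr 0 f'" "tm1 s = gen1 g \<cdot>\<^sub>0 f'"
      have t: "tg 0 f' = sr 0 (tm1 t)" using cmp0_left(4)[OF gen1_cell[OF g(1)] g(2) _ g(3)] g(4) c by simp
      have "tm1 (Comp s t) = gen1 g \<cdot>\<^sub>0 (f' \<cdot>\<^sub>0 tm1 t)"
        unfolding e g(4) using cmp0_assoc[OF gen1_cell[OF g(1)] g(2) c(2) g(3) t] by simp
      thus ?case using g cmp0_left(2,3)[OF g(2) c(2) _ t] by (metis order_refl)
    qed
  qed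
  thus ?thesis using assms that by (metis cell1E)
qed

lemma word1_gen_cmp0: "g \<in> gens1 Q \<Longrightarrow> f \<in> Cl 1 \<Longrightarrow> tg 0 (gen1 g) = sr 0 f \<Longrightarrow>
    word1 (gen1 g \<cdot>\<^sub>0 f) = g # word1 f"
  by (simp add: word1_cmp0 gen1_cell word1_gen1)

lemma word1_Nil: assumes "f \<in> Cl 1" "word1 f = []" shows "f = one (sr 0 f)" "sr 0 f = tg 0 f"
proof -
  show "f = one (sr 0 f)" using assms by (cases rule: cell1_cases) (auto simp: word1_gen_cmp0)
  thus "sr 0 f = tg 0 f" using one_0(2)[OF sr0_cell[OF assms(1)]] by metis
qed

lemma word1_Cons: assumes "f \<in> Cl 1" "word1 f = g # u"
  obtains f' where "g \<in> gens1 Q" "f' \<in> Cl 1" "tg 0 (gen1 g) = sr 0 f'" "f = gen1 g \<cdot>\<^sub>0 f'" "word1 f' = u"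
    "sr 0 f = sr 0 (gen1 g)"
  using assms(1)
proof (cases rule: cell1_cases)
  case one
  hence "word1 f = []" using sr0_cell[OF assms(1)] word1_one by metis
  thus ?thesis using assms by simp
next
  case (gen g' f')
  thus ?thesis using assms that word1_gen_cmp0[OF gen(1-3)] cmp0_left(3)[OF gen1_cell[OF gen(1)] gen(2) _ gen(3)] by simp
qed

lemma word1_inj: "f \<in> Cl 1 \<Longrightarrow> g \<in> Cl 1 \<Longrightarrow> sr 0 f = sr 0 g \<Longrightarrow> word1 f = word1 g \<Longrightarrow> f = g"
proof (induction "word1 g" arbitrary: f g)
  case Nil thus ?case using word1_Nil by metis
next
  case (Cons a u)
  obtain f' where f': "f' \<in> Cl 1" "tg 0 (gen1 a) = sr 0 f'" "f = gen1 a \<cdot>\<^sub>0 f'" "word1 f' = u"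
    using word1_Cons Cons by metis
  obtain g' where g': "g' \<in> Cl 1" "tg 0 (gen1 a) = sr 0 g'" "g = gen1 a \<cdot>\<^sub>0 g'" "word1 g' = u"
    using word1_Cons Cons by metis
  show ?case using Cons(1)[of g' f'] f' g' by simp
qed

text \<open>The source can be recovered: a nonempty word starts where its first generator does, and
  a cell with empty word has equal ends. This version serves right contexts, which are compared at
  their targets.\<close>

lemma word1_inj_tgt: assumes "f \<in> Cl 1" "g \<in> Cl 1" "tg 0 f = tg 0 g" "word1 f = word1 g" shows "f = g"
proof (rule word1_inj[OF assms(1,2) _ assms(4)])
  show "sr 0 f = sr 0 g" using assms by (cases "word1 g") (metis word1_Nil(2), metis word1_Cons)
qed

lemma word1_split: assumes "f \<in> Cl 1" "word1 f = u @ v"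
  obtains f1 f2 where "f1 \<in> Cl 1" "f2 \<in> Cl 1" "tg 0 f1 = sr 0 f2" "f = f1 \<cdot>\<^sub>0 f2" "word1 f1 = u" "word1 f2 = v"
    "sr 0 f1 = sr 0 f" "tg 0 f2 = tg 0 f"
  using assms
proof (induction u arbitrary: f thesis)
  case Nil
  show ?case
  proof (rule Nil(1)[of "one (sr 0 f)" f])
    show "one (sr 0 f) \<in> Cl 1" "tg 0 (one (sr 0 f)) = sr 0 f" "sr 0 (one (sr 0 f)) = sr 0 f"
      "word1 (one (sr 0 f)) = []"
      using one_0[OF sr0_cell[OF Nil(2)]] word1_one[OF sr0_cell[OF Nil(2)]] by simp_all
    show "f = one (sr 0 f) \<cdot>\<^sub>0 f" using one_cmp0_left[OF Nil(2)] by simp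
  qed (use Nil in auto)
next
  case (Cons a u)
  obtain f' where f': "a \<in> gens1 Q" "f' \<in> Cl 1" "tg 0 (gen1 a) = sr 0 f'" "f = gen1 a \<cdot>\<^sub>0 f'" "word1 f' = u @ v"
    "sr 0 f = sr 0 (gen1 a)"
    using Cons by (metis append_Cons word1_Cons)
  obtain f1 f2 where g: "f1 \<in> Cl 1" "f2 \<in> Cl 1" "tg 0 f1 = sr 0 f2" "f' = f1 \<cdot>\<^sub>0 f2" "word1 f1 = u" "word1 f2 = v"
    "sr 0 f1 = sr 0 f'" "tg 0 f2 = tg 0 f'" using Cons(1)[OF _ f'(2,5)] by blast
  have m: "tg 0 (gen1 a) = sr 0 f1" using g f' by simp
  note c = cmp0_left[OF gen1_cell[OF f'(1)] g(1) _ m]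
  show ?case
  proof (rule Cons(2))
    show "gen1 a \<cdot>\<^sub>0 f1 \<in> Cl 1" "tg 0 (gen1 a \<cdot>\<^sub>0 f1) = sr 0 f2" "sr 0 (gen1 a \<cdot>\<^sub>0 f1) = sr 0 f"
      using c g f' by simp_all
    show "f = gen1 a \<cdot>\<^sub>0 f1 \<cdot>\<^sub>0 f2" unfolding f'(4) g(4)
      using cmp0_assoc[OF gen1_cell[OF f'(1)] g(1,2) m g(3)] by simp
    show "word1 (gen1 a \<cdot>\<^sub>0 f1) = a # u" using word1_gen_cmp0[OF f'(1) g(1) m] g by simp
    show "tg 0 f2 = tg 0 f" using cmp0_left(4)[OF gen1_cell[OF f'(1)] f'(2) _ f'(3)] f'(4) g(8) by simp
  qed (use g in auto)
qed

text \<open>Concatenation of lists is cancellative, and the match with \<open>l\<close> gives both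
  cells the same 0-source.\<close>

lemma wh1_cancel: assumes "fit 1 l f r" "fit 1 l g r" "wh l f r = wh l g r" shows "f = g"
proof (rule word1_inj)
  show "f \<in> Cl 1" "g \<in> Cl 1" "sr 0 f = sr 0 g"
    using fitD[OF assms(1)] fitD[OF assms(2)] by simp_all
  show "word1 f = word1 g"
    using word1_wh[OF assms(1)] word1_wh[OF assms(2)] unfolding assms(3) by simp
qed

section \<open>Normal forms of 2-cells\<close>

lemma cell2_cases: assumes "\<phi> \<in> Cl 2"
  obtains (one) "\<phi> = one (sr 1 \<phi>)"
  | (cmp) l \<alpha> r \<psi> where "\<alpha> \<in> gens2 Q" "fit 2 l (gen2 Q \<alpha>) r" "seq 2 2 (wh l (gen2 Q \<alpha>) r) \<psi>"
    "\<phi> = wh l (gen2 Q \<alpha>) r \<cdot>\<^sub>1 \<psi>"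
proof -
  \<comment> \<open>\<open>P\<close> is the claimed alternative. Its closure under whiskering and
    under composition along 1-cells is what the induction over terms needs in the cases of actions
    and composites.\<close>
  define P where "P \<phi> \<longleftrightarrow> \<phi> = one (sr 1 \<phi>) \<or> (\<exists>l \<alpha> r \<psi>. \<alpha> \<in> gens2 Q \<and> fit 2 l (gen2 Q \<alpha>) r \<and>
    seq 2 2 (wh l (gen2 Q \<alpha>) r) \<psi> \<and> \<phi> = wh l (gen2 Q \<alpha>) r \<cdot>\<^sub>1 \<psi>)" for \<phi>
  have P_wh: "P (wh l \<phi> r)" if f: "fit 2 l \<phi> r" and p: "P \<phi>" for l \<phi> r
    using p unfolding P_def
  proof (elim disjE exE conjE)
    assume o: "\<phi> = one (sr 1 \<phi>)"
    have f1: "fit 1 l (sr 1 \<phi>) r" "sr 1 (wh l \<phi> r) = wh l (sr 1 \<phi>) r" using wh[OF f] by simp_all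
    have "wh l \<phi> r = one (sr 1 (wh l \<phi> r))" using wh_idt(1)[OF f1(1)] o f1(2) by metis
    thus "wh l \<phi> r = one (sr 1 (wh l \<phi> r)) \<or> (\<exists>l' \<alpha> r' \<psi>. \<alpha> \<in> gens2 Q \<and> fit 2 l' (gen2 Q \<alpha>) r' \<and>
      seq 2 2 (wh l' (gen2 Q \<alpha>) r') \<psi> \<and> wh l \<phi> r = wh l' (gen2 Q \<alpha>) r' \<cdot>\<^sub>1 \<psi>)" ..
  next
    fix l' \<alpha> r' \<psi> assume h: "\<alpha> \<in> gens2 Q" "fit 2 l' (gen2 Q \<alpha>) r'" "seq 2 2 (wh l' (gen2 Q \<alpha>) r') \<psi>"
      "\<phi> = wh l' (gen2 Q \<alpha>) r' \<cdot>\<^sub>1 \<psi>"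
    have f': "fit 2 l (wh l' (gen2 Q \<alpha>) r') r"
      using f h cmp1(5)[OF h(3), of Minus] cmp1(5)[OF h(3), of Plus] seqD[OF h(3)] by (auto simp: fit_def)
    note a = wh_cmp1[OF h(3) disjI1[OF f']]
    have m: "tg 0 l = sr 0 l'" "tg 0 r' = sr 0 r" using f' wh[OF h(2)] by (auto simp: fit_def)
    note b = wh_wh[OF h(2) fitD(1,3)[OF f'] m]
    show "wh l \<phi> r = one (sr 1 (wh l \<phi> r)) \<or> (\<exists>l' \<alpha> r' \<psi>. \<alpha> \<in> gens2 Q \<and> fit 2 l' (gen2 Q \<alpha>) r' \<and>
      seq 2 2 (wh l' (gen2 Q \<alpha>) r') \<psi> \<and> wh l \<phi> r = wh l' (gen2 Q \<alpha>) r' \<cdot>\<^sub>1 \<psi>)"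
      using a(1,2) b h(1,4) by metis
  qed
  have P_cmp: "P (\<phi> \<cdot>\<^sub>1 \<psi>)" if s: "seq 2 2 \<phi> \<psi>" and p: "P \<phi>" "P \<psi>" for \<phi> \<psi>
    using p(1) unfolding P_def[of \<phi>]
  proof (elim disjE exE conjE)
    assume "\<phi> = one (sr 1 \<phi>)"
    moreover have "sr 1 \<phi> \<in> Cl 1" using F.bdry_cells seqD(1)[OF s] by simp
    ultimately have "tg 1 \<phi> = sr 1 \<phi>" using one_1(2) by metis
    hence "\<phi> \<cdot>\<^sub>1 \<psi> = \<psi>" using one_cmp1_left(1)[OF seqD(2)[OF s]] \<open>\<phi> = one (sr 1 \<phi>)\<close> seqD(4)[OF s] by simp
    thus ?thesis using p by simp
  next
    fix l \<alpha> r \<chi> assume h: "\<alpha> \<in> gens2 Q" "fit 2 l (gen2 Q \<alpha>) r" "seq 2 2 (wh l (gen2 Q \<alpha>) r) \<chi>"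
      "\<phi> = wh l (gen2 Q \<alpha>) r \<cdot>\<^sub>1 \<chi>"
    have "seq 2 2 \<chi> \<psi>" using s h(4) cmp1(4)[OF h(3)] seqD[OF h(3)] by (simp add: seq_def)
    from cmp1_assoc(1,3)[OF h(3) this] show ?thesis unfolding P_def using h by auto
  qed
  have "P (tm2 t)" if "D1.wt t" for t
    using that
  proof (induction rule: wf_tm.induct)
    case (wf_Gen \<alpha>)
    have g: "tm2 (Gen \<alpha>) = gen2 Q \<alpha>" by (simp add: tm2_def gen2_def)
    note c = gen2_cell[OF wf_Gen]
    \<comment> \<open>A generator is its own whisker by identities, followed by an identity
      2-cell.\<close>
    note w = wh_one[OF c _ refl refl]
    note r = one_cmp1_right[OF c _ refl]
    show ?case unfolding g P_def using wf_Gen w r by (metis one_le_numeral order_refl)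
  next
    case (wf_Idt c)
    then obtain t where t: "D0.wt t" "c = D0.cls t" unfolding free1_def by (auto elim: D0.cellsE)
    have "D1.wt (Idt c)" using wf_Idt by (simp add: D1.wfI)
    thus ?case unfolding P_def using tm2_Idt[OF t(1)] tm2_bd[of "Idt c" Minus] t by (simp add: tm1_def)
  next
    case (wf_LAct c i t)
    hence W: "D1.wt (LAct i c t)" by (intro wf_tm.wf_LAct)
    hence "i < 1" by (simp only: D1.wfL)
    hence i: "i = 0" by simp
    obtain s where s: "D0.wt s" "c = D0.cls s"
      using wf_LAct(1) i unfolding free1_def by (auto elim: D0.cellsE)
    have c: "tm1 s \<in> Cl 1" "tm2 t \<in> Cl 2" using tm1_cell tm2_cell s wf_LAct by auto
    have m: "tg 0 (tm1 s) = sr 0 (tm2 t)" using W[unfolded i] by (simp only: D1.wfL tm1_bd0[OF s(1)] tm2_bd0[OF wf_LAct(2)] s(2))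
    have "tm2 (LAct i c t) = tm1 s \<cdot>\<^sub>0 tm2 t" using tm2_LAct W i s by simp
    also have "\<dots> = wh (tm1 s) (tm2 t) (one (tg 0 (tm2 t)))"
      using one_cmp0_right[OF cmp0_left(2)[OF c _ m]] cmp0_left(4)[OF c _ m] by simp
    finally show ?case using P_wh[of "tm1 s" "tm2 t"] wf_LAct(4) c m one_0[OF sr0_cell[OF c(2)]] by (simp add: fit_def)
  next
    case (wf_RAct c i t)
    hence W: "D1.wt (RAct i t c)" by (intro wf_tm.wf_RAct)
    hence "i < 1" by (simp only: D1.wfR)
    hence i: "i = 0" by simp
    obtain s where s: "D0.wt s" "c = D0.cls s"
      using wf_RAct(1) i unfolding free1_def by (auto elim: D0.cellsE)
    have c: "tm1 s \<in> Cl 1" "tm2 t \<in> Cl 2" using tm1_cell tm2_cell s wf_RAct by auto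
    have m: "tg 0 (tm2 t) = sr 0 (tm1 s)" using W[unfolded i] by (simp only: D1.wfR tm1_bd0[OF s(1)] tm2_bd0[OF wf_RAct(2)] s(2))
    have "tm2 (RAct i t c) = tm2 t \<cdot>\<^sub>0 tm1 s" using tm2_RAct W i s by simp
    also have "\<dots> = wh (one (sr 0 (tm2 t))) (tm2 t) (tm1 s)"
      using one_cmp0_left[OF c(2)] by simp
    finally show ?case using P_wh[of _ "tm2 t" "tm1 s"] wf_RAct(4) c m one_0[OF sr0_cell[OF c(2)]] by (simp add: fit_def)
  next
    case (wf_Comp s t)
    hence "D1.wt (Comp s t)" by (simp add: D1.wfC)
    moreover have "seq 2 2 (tm2 s) (tm2 t)" using wf_Comp tm2_cell tm2_bd by (simp add: seq_def)
    ultimately show ?case using P_cmp wf_Comp(4,5) tm2_Comp by metis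
  qed
  thus ?thesis using assms that unfolding P_def by (metis cell2E)
qed

lemma word2_seq: "seq 2 2 \<phi> \<psi> \<Longrightarrow> word2 (\<phi> \<cdot>\<^sub>1 \<psi>) = word2 \<phi> @ word2 \<psi>"
  by (simp add: seq_def word2_cmp1)

lemma word2_whisker: "\<alpha> \<in> gens2 Q \<Longrightarrow> fit 2 l (gen2 Q \<alpha>) r \<Longrightarrow>
    word2 (wh l (gen2 Q \<alpha>) r) = [(word1 l, \<alpha>, word1 r)]"
  by (simp add: word2_wh)

lemma sr1_cell: "\<phi> \<in> Cl k \<Longrightarrow> 1 \<le> k \<Longrightarrow> bd e 1 \<phi> \<in> Cl 1"
  using F.bdry_cells by blast

lemma word2_Nil: assumes "\<phi> \<in> Cl 2" "word2 \<phi> = []" shows "\<phi> = one (sr 1 \<phi>)"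
  using assms(1) by (cases rule: cell2_cases) (use assms in \<open>auto simp: word2_seq word2_whisker\<close>)

lemma word2_Cons: assumes "\<phi> \<in> Cl 2" "word2 \<phi> = (u, \<alpha>, v) # X"
  obtains l r \<psi> where "\<alpha> \<in> gens2 Q" "fit 2 l (gen2 Q \<alpha>) r" "seq 2 2 (wh l (gen2 Q \<alpha>) r) \<psi>"
    "\<phi> = wh l (gen2 Q \<alpha>) r \<cdot>\<^sub>1 \<psi>" "word1 l = u" "word1 r = v" "word2 \<psi> = X" "sr 0 l = sr 0 \<phi>"
  using assms(1)
proof (cases rule: cell2_cases)
  case one
  thus ?thesis using assms(2) word2_one[OF sr1_cell[OF assms(1)]] by (metis list.distinct(1) one_le_numeral)
next
  case (cmp l \<alpha>' r \<psi>)
  have "sr 0 l = sr 0 \<phi>" using cmp(4) cmp1(5)[OF cmp(3)] wh(2)[OF cmp(2)] by simp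
  thus ?thesis using cmp assms(2) word2_seq[OF cmp(3)] word2_whisker[OF cmp(1,2)] that by simp
qed

text \<open>The left contexts of the first whiskers start at the common 0-source, the right ones at
  the 0-target of the same generator. Equal words thus give equal first whiskers, and the remainders
  then share their 1-source.\<close>

lemma word2_inj: "\<phi> \<in> Cl 2 \<Longrightarrow> \<psi> \<in> Cl 2 \<Longrightarrow> sr 1 \<phi> = sr 1 \<psi> \<Longrightarrow> word2 \<phi> = word2 \<psi> \<Longrightarrow> \<phi> = \<psi>"
proof (induction "word2 \<psi>" arbitrary: \<phi> \<psi>)
  case Nil thus ?case using word2_Nil by metis
next
  case (Cons a X)
  obtain u \<alpha> v where a: "a = (u, \<alpha>, v)" by (cases a)
  obtain l r \<phi>' where p: "\<alpha> \<in> gens2 Q" "fit 2 l (gen2 Q \<alpha>) r" "seq 2 2 (wh l (gen2 Q \<alpha>) r) \<phi>'"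
    "\<phi> = wh l (gen2 Q \<alpha>) r \<cdot>\<^sub>1 \<phi>'" "word1 l = u" "word1 r = v" "word2 \<phi>' = X" "sr 0 l = sr 0 \<phi>"
    using word2_Cons[of \<phi> u \<alpha> v X] Cons a by metis
  obtain l2 r2 \<psi>' where q: "fit 2 l2 (gen2 Q \<alpha>) r2" "seq 2 2 (wh l2 (gen2 Q \<alpha>) r2) \<psi>'"
    "\<psi> = wh l2 (gen2 Q \<alpha>) r2 \<cdot>\<^sub>1 \<psi>'" "word1 l2 = u" "word1 r2 = v" "word2 \<psi>' = X" "sr 0 l2 = sr 0 \<psi>"
    using word2_Cons[of \<psi> u \<alpha> v X] Cons a by metis
  have "sr 0 \<phi> = sr 0 \<psi>" using bd_bd[OF Cons(3), of 0 1] bd_bd[OF Cons(4), of 0 1] Cons(5) by (metis one_le_numeral zero_less_one)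
  hence l: "l = l2" using word1_inj p q by (simp add: fit_def)
  have r: "r = r2" using word1_inj p q by (simp add: fit_def)
  have "\<phi>' = \<psi>'" using Cons(1)[of \<psi>' \<phi>'] p(3,7) q(2,6) l r by (auto simp: seq_def)
  thus ?case using p q l r by simp
qed

lemma word2_split: assumes "\<phi> \<in> Cl 2" "word2 \<phi> = X @ Y"
  obtains \<phi>1 \<phi>2 where "seq 2 2 \<phi>1 \<phi>2" "\<phi> = \<phi>1 \<cdot>\<^sub>1 \<phi>2" "word2 \<phi>1 = X" "word2 \<phi>2 = Y"
  using assms
proof (induction X arbitrary: \<phi> thesis)
  case Nil
  show ?case
    by (rule Nil(1)[of "one (sr 1 \<phi>)" \<phi>])
      (use one_cmp1_left[OF Nil(2) order_refl refl] word2_one[OF sr1_cell[OF Nil(2)]] Nil(3) in auto)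
next
  case (Cons a X)
  obtain u \<alpha> v where a: "a = (u, \<alpha>, v)" by (cases a)
  obtain l r \<phi>' where p: "\<alpha> \<in> gens2 Q" "fit 2 l (gen2 Q \<alpha>) r" "seq 2 2 (wh l (gen2 Q \<alpha>) r) \<phi>'"
    "\<phi> = wh l (gen2 Q \<alpha>) r \<cdot>\<^sub>1 \<phi>'" "word1 l = u" "word1 r = v" "word2 \<phi>' = X @ Y" "sr 0 l = sr 0 \<phi>"
    using word2_Cons[of \<phi> u \<alpha> v "X @ Y"] Cons(3,4) a by (metis append_Cons)
  obtain \<phi>1 \<phi>2 where q: "seq 2 2 \<phi>1 \<phi>2" "\<phi>' = \<phi>1 \<cdot>\<^sub>1 \<phi>2" "word2 \<phi>1 = X" "word2 \<phi>2 = Y"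
    using Cons(1)[OF _ seqD(2)[OF p(3)] p(7)] by blast
  have s: "seq 2 2 (wh l (gen2 Q \<alpha>) r) \<phi>1"
    using p(3) q(2) cmp1(3)[OF q(1)] seqD[OF q(1)] by (simp add: seq_def)
  note t = cmp1_assoc[OF s q(1)]
  show ?case
    by (rule Cons(2)[of "wh l (gen2 Q \<alpha>) r \<cdot>\<^sub>1 \<phi>1" \<phi>2])
      (use t p q a word2_seq[OF s] word2_whisker[OF p(1,2)] in auto)
qed

lemma wh2_cancel: assumes "fit 2 l \<phi> r" "fit 2 l \<psi> r" "wh l \<phi> r = wh l \<psi> r" shows "\<phi> = \<psi>"
proof (rule word2_inj)
  show "\<phi> \<in> Cl 2" "\<psi> \<in> Cl 2" using assms by (auto simp: fit_def)
  show "word2 \<phi> = word2 \<psi>" using word2_wh[OF assms(1)] word2_wh[OF assms(2)] unfolding assms(3) by simp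
  show "sr 1 \<phi> = sr 1 \<psi>"
  proof (rule wh1_cancel)
    show "fit 1 l (sr 1 \<phi>) r" "fit 1 l (sr 1 \<psi>) r"
      using wh(5)[OF assms(1)] wh(5)[OF assms(2)] by simp_all
    show "wh l (sr 1 \<phi>) r = wh l (sr 1 \<psi>) r"
      using wh(4)[OF assms(1), of 1 Minus] wh(4)[OF assms(2), of 1 Minus] unfolding assms(3) by simp
  qed
qed

text \<open>The definite description has a value because every derivation of \<open>vlen\<close>
  counts the letters of the word. This turns the hypothesis on the lengths of sources into nonempty
  words.\<close>

lemma length2_eq: assumes "\<phi> \<in> Cl 2" shows "length2 Q \<phi> = length (word2 \<phi>)"
proof -
  have "vlen Q \<phi> (length (word2 \<phi>))"
    using assms
  proof (induction "word2 \<phi>" arbitrary: \<phi>)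
    case Nil
    thus ?case using word2_Nil[of \<phi>] sr1_cell[OF Nil(2)] vlen.intros(1)[of "sr 1 \<phi>" Q]
      by (metis list.size(3) one_le_numeral)
  next
    case (Cons a X)
    obtain u \<alpha> v where a: "a = (u, \<alpha>, v)" by (cases a)
    obtain l r \<phi>' where p: "\<alpha> \<in> gens2 Q" "fit 2 l (gen2 Q \<alpha>) r" "seq 2 2 (wh l (gen2 Q \<alpha>) r) \<phi>'"
      "\<phi> = wh l (gen2 Q \<alpha>) r \<cdot>\<^sub>1 \<phi>'" "word2 \<phi>' = X"
      using word2_Cons[of \<phi> u \<alpha> v X] Cons(2,3) a by metis
    have w: "whisk_ok Q l (gen2 Q \<alpha>) r" using whisk_ok_iff[OF gen2_cell[OF p(1)], of l r] p(2) by simp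
    have v: "vlen Q \<phi>' (length X)" using Cons(1)[of \<phi>'] p(3,5) by (simp add: seq_def)
    from vlen.intros(2)[OF p(1) w v cmp1(1)[OF p(3)]] show ?case
      using p(4) Cons(2) by (metis length_Cons)
  qed
  moreover have "\<psi> \<in> Cl 2 \<and> m = length (word2 \<psi>)" if "vlen Q \<psi> m" for \<psi> m
    using that
  proof (induction rule: vlen.induct)
    case (1 f) thus ?case using one_1[of f] by simp
  next
    case (2 \<alpha> l r \<phi> m)
    have f: "fit 2 l (gen2 Q \<alpha>) r" using whisk_ok_iff[OF gen2_cell[OF 2(1)], of l r] 2(2) by simp
    have "seq 2 2 (wh l (gen2 Q \<alpha>) r) \<phi>"
      using F.compD[OF 2(4) wh(1)[OF f]] 2(5) wh(1)[OF f] by (auto simp: seq_def)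
    thus ?case using 2(5) cmp1(2)[of 2 2] word2_seq word2_whisker[OF 2(1) f] by auto
  qed
  ultimately show ?thesis unfolding length2_def by (intro the_equality) blast+
qed

text \<open>Converse of \<open>word2_wh\<close>: contexts visible on every letter come from actual
  1-cells. The assumption on the 1-source serves the base case, where the 2-cell is an identity and
  the contexts must be cut out of its 1-source.\<close>

lemma unwrap:
  assumes "\<phi> \<in> Cl 2" "word2 \<phi> = wrap c d X" "word1 (sr 1 \<phi>) = c @ y @ d"
  obtains l \<psi> r where "fit 2 l \<psi> r" "\<phi> = wh l \<psi> r" "word1 l = c" "word1 r = d" "word2 \<psi> = X"
  using assms
proof (induction X arbitrary: \<phi> y thesis)
  case Nil
  have s: "sr 1 \<phi> \<in> Cl 1" using sr1_cell[OF Nil(2)] by simp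
  obtain l g where l: "l \<in> Cl 1" "g \<in> Cl 1" "tg 0 l = sr 0 g" "sr 1 \<phi> = l \<cdot>\<^sub>0 g" "word1 l = c" "word1 g = y @ d"
    using word1_split[OF s Nil(4)] by metis
  obtain f r where r: "f \<in> Cl 1" "r \<in> Cl 1" "tg 0 f = sr 0 r" "g = f \<cdot>\<^sub>0 r" "word1 f = y" "word1 r = d" "sr 0 f = sr 0 g"
    using word1_split[OF l(2,6)] by metis
  have F: "fit 1 l f r" using l r by (simp add: fit_def)
  note i = wh_idt[OF F]
  have "\<phi> = one (sr 1 \<phi>)" using word2_Nil Nil by simp
  also have "\<dots> = wh l (one f) r" using i wh(6)[OF F] l(4) r(4) by simp
  finally show ?case using Nil(1)[OF i(2)] l r by simp
next
  case (Cons x X)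
  obtain u \<alpha> v where x: "x = (u, \<alpha>, v)" by (cases x)
  obtain a b \<phi>' where p: "\<alpha> \<in> gens2 Q" "fit 2 a (gen2 Q \<alpha>) b" "seq 2 2 (wh a (gen2 Q \<alpha>) b) \<phi>'"
    "\<phi> = wh a (gen2 Q \<alpha>) b \<cdot>\<^sub>1 \<phi>'" "word1 a = c @ u" "word1 b = v @ d" "word2 \<phi>' = wrap c d X" "sr 0 a = sr 0 \<phi>"
    using word2_Cons[of \<phi> "c @ u" \<alpha> "v @ d" "wrap c d X"] Cons(3,4) x by (metis wrap_simps(2))
  obtain l a' where l: "l \<in> Cl 1" "a' \<in> Cl 1" "tg 0 l = sr 0 a'" "a = l \<cdot>\<^sub>0 a'" "word1 l = c" "sr 0 l = sr 0 a" "tg 0 a' = tg 0 a"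
    using word1_split[OF fitD(1)[OF p(2)] p(5)] by metis
  obtain b' r where r: "b' \<in> Cl 1" "r \<in> Cl 1" "tg 0 b' = sr 0 r" "b = b' \<cdot>\<^sub>0 r" "word1 b' = v" "word1 r = d" "sr 0 b' = sr 0 b" "tg 0 r = tg 0 b"
    using word1_split[OF fitD(3)[OF p(2)] p(6)] by metis
  have F: "fit 2 a' (gen2 Q \<alpha>) b'" using p(2) l r by (simp add: fit_def)
  note w = wh_wh[OF F l(1) r(2) l(3) r(3)]
  have e: "wh a (gen2 Q \<alpha>) b = wh l (wh a' (gen2 Q \<alpha>) b') r" using w l r by simp
  have t: "sr 1 \<phi>' = wh l (tg 1 (wh a' (gen2 Q \<alpha>) b')) r" "fit 1 l (tg 1 (wh a' (gen2 Q \<alpha>) b')) r"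
    using seqD(4)[OF p(3)] e wh(4,5)[OF w(2), of 1 Plus] by simp_all
  have "word1 (sr 1 \<phi>') = c @ word1 (tg 1 (wh a' (gen2 Q \<alpha>) b')) @ d" using word1_wh[OF t(2)] t l r by simp
  then obtain l2 \<psi> r2 where q: "fit 2 l2 \<psi> r2" "\<phi>' = wh l2 \<psi> r2" "word1 l2 = c" "word1 r2 = d" "word2 \<psi> = X"
    using Cons(1)[OF _ seqD(2)[OF p(3)] p(7)] by metis
  note bs = seqD(7)[OF p(3)] wh[OF p(2)] wh[OF q(1)]
  \<comment> \<open>Both left contexts have the word \<open>c\<close> and start at the 0-source
    shared by the two factors. On the right the common 0-target is used.\<close>
  have "l2 = l" using word1_inj[of l2 l] q(1,3) l bs q(2) by (auto simp: fit_def)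
  moreover have "r2 = r" using word1_inj_tgt[of r2 r] q(1,4) r bs q(2) by (auto simp: fit_def)
  ultimately have q': "fit 2 l \<psi> r" "\<phi>' = wh l \<psi> r" using q by simp_all
  \<comment> \<open>The two 1-cells agree after whiskering by \<open>l\<close> and \<open>r\<close>;
    cancellation makes the inner pieces composable.\<close>
  have "tg 1 (wh a' (gen2 Q \<alpha>) b') = sr 1 \<psi>"
    by (rule wh1_cancel[OF t(2)]) (use wh(4,5)[OF q'(1), of 1 Minus] t q' in auto)
  hence s: "seq 2 2 (wh a' (gen2 Q \<alpha>) b') \<psi>" using wh(1)[OF F] q' by (simp add: seq_def fit_def)
  note z = wh_cmp1[OF s disjI2[OF q'(1)]]
  show ?case
  proof (rule Cons(2))
    show "fit 2 l (wh a' (gen2 Q \<alpha>) b' \<cdot>\<^sub>1 \<psi>) r" using z by simp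
    show "\<phi> = wh l (wh a' (gen2 Q \<alpha>) b' \<cdot>\<^sub>1 \<psi>) r" using z p(4) e q' by simp
    show "word2 (wh a' (gen2 Q \<alpha>) b' \<cdot>\<^sub>1 \<psi>) = x # X"
      using word2_seq[OF s] word2_whisker[OF p(1) F] q(5) x word1_cmp0[OF l(1,2,3)] word1_cmp0[OF r(1,2,3)] l(4,5) r(4,5,6) p(5,6) by simp
  qed (use l r in auto)
qed

section \<open>Factoring rewriting steps\<close>

text \<open>A 3-cell has the same 1-boundaries as its 2-source, so either can stand for the other in
  composites along 1-cells.\<close>

lemma wh_sr2: assumes "fit 3 l u r"
  shows "fit 2 l (sr 2 u) r" "sr 2 (wh l u r) = wh l (sr 2 u) r"
    "bd e 1 (wh l (sr 2 u) r) = bd e 1 (wh l u r)"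
proof -
  show a: "fit 2 l (sr 2 u) r" "sr 2 (wh l u r) = wh l (sr 2 u) r"
    using wh(4,5)[OF assms, of 2 Minus] by simp_all
  show "bd e 1 (wh l (sr 2 u) r) = bd e 1 (wh l u r)"
    unfolding a(2)[symmetric] by (rule bd_bd[OF wh(1)[OF assms]]) simp_all
qed

text \<open>The parameter \<open>k\<close> lets one context surround a step (\<open>k = 3\<close>)
  and its source (\<open>k = 2\<close>). Unlike in \<open>ctx_ok\<close>, composability is required
  of adjacent factors, which treats \<open>\<kappa>\<close> and \<open>\<rho>\<close> alike.\<close>

definition ctx :: "nat \<Rightarrow> ('g0, 'g1, 'g2, 'g3) cell3 \<Rightarrow> ('g0, 'g1, 'g2, 'g3) cell3 \<Rightarrow>
    ('g0, 'g1, 'g2, 'g3) cell3 \<Rightarrow> ('g0, 'g1, 'g2, 'g3) cell3 \<Rightarrow> ('g0, 'g1, 'g2, 'g3) cell3 \<Rightarrow> bool" where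
  "ctx k \<kappa> l u r \<rho> \<longleftrightarrow> fit k l u r \<and> seq 2 k \<kappa> (wh l u r) \<and> seq k 2 (wh l u r) \<rho>"

abbreviation plug :: "('g0, 'g1, 'g2, 'g3) cell3 \<Rightarrow> ('g0, 'g1, 'g2, 'g3) cell3 \<Rightarrow>
    ('g0, 'g1, 'g2, 'g3) cell3 \<Rightarrow> ('g0, 'g1, 'g2, 'g3) cell3 \<Rightarrow> ('g0, 'g1, 'g2, 'g3) cell3 \<Rightarrow>
    ('g0, 'g1, 'g2, 'g3) cell3" where
  "plug \<kappa> l u r \<rho> \<equiv> \<kappa> \<cdot>\<^sub>1 (l \<cdot>\<^sub>0 u \<cdot>\<^sub>0 r) \<cdot>\<^sub>1 \<rho>"

lemma ctxD: assumes "ctx k \<kappa> l u r \<rho>"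
  shows "fit k l u r" "seq 2 k \<kappa> (wh l u r)" "seq k 2 (wh l u r) \<rho>" "seq k 2 (\<kappa> \<cdot>\<^sub>1 wh l u r) \<rho>"
    "seq 2 k \<kappa> (wh l u r \<cdot>\<^sub>1 \<rho>)" "plug \<kappa> l u r \<rho> = \<kappa> \<cdot>\<^sub>1 (wh l u r \<cdot>\<^sub>1 \<rho>)" "plug \<kappa> l u r \<rho> \<in> Cl k"
    "sr 1 (plug \<kappa> l u r \<rho>) = sr 1 \<kappa>" "sr 0 (plug \<kappa> l u r \<rho>) = sr 0 l" "tg 0 (plug \<kappa> l u r \<rho>) = tg 0 r"
proof -
  show a: "fit k l u r" "seq 2 k \<kappa> (wh l u r)" "seq k 2 (wh l u r) \<rho>" using assms by (simp_all add: ctx_def)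
  have k: "2 \<le> k" using seqD(6)[OF a(2)] .
  note c = cmp1_assoc[OF a(2,3)]
  show b: "seq k 2 (\<kappa> \<cdot>\<^sub>1 wh l u r) \<rho>" "seq 2 k \<kappa> (wh l u r \<cdot>\<^sub>1 \<rho>)"
    "plug \<kappa> l u r \<rho> = \<kappa> \<cdot>\<^sub>1 (wh l u r \<cdot>\<^sub>1 \<rho>)"
    using c k by (simp_all add: max_def split: if_splits)
  show "plug \<kappa> l u r \<rho> \<in> Cl k" "sr 1 (plug \<kappa> l u r \<rho>) = sr 1 \<kappa>"
    using cmp1(2,3)[OF b(1)] cmp1(3)[OF a(2)] k by (simp_all add: max_def split: if_splits)
  show "sr 0 (plug \<kappa> l u r \<rho>) = sr 0 l" "tg 0 (plug \<kappa> l u r \<rho>) = tg 0 r"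
    using cmp1(5)[OF b(1)] cmp1(5)[OF a(2)] seqD(7)[OF a(2)] wh(2,3)[OF a(1)] by simp_all
qed

lemma ctx_ok_iff: assumes S: "S \<in> Cl 3" shows "ctx_ok Q \<kappa> l S r \<rho> \<longleftrightarrow> ctx 3 \<kappa> l S r \<rho>"
proof
  assume "ctx_ok Q \<kappa> l S r \<rho>"
  hence a: "\<kappa> \<in> Cl 2" "\<rho> \<in> Cl 2" "fit 3 l S r" "composable (free3 Q) 1 \<kappa> (wh l S r)"
    "composable (free3 Q) 1 (\<kappa> \<cdot>\<^sub>1 wh l S r) \<rho>" using S whisk_ok_iff[OF S] by (simp_all add: ctx_ok_def)
  have s: "seq 2 3 \<kappa> (wh l S r)"
    using F.compD[OF a(4,1) wh(1)[OF a(3)]] a wh(1)[OF a(3)] by (simp add: seq_def)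
  have c: "\<kappa> \<cdot>\<^sub>1 wh l S r \<in> Cl 3" using cmp1(2)[OF s] by simp
  have "tg 1 (wh l S r) = sr 1 \<rho>" using F.compD[OF a(5) c a(2)] cmp1(4)[OF s] by simp
  thus "ctx 3 \<kappa> l S r \<rho>" using s a wh(1)[OF a(3)] by (simp add: ctx_def seq_def)
next
  assume c: "ctx 3 \<kappa> l S r \<rho>"
  note d = ctxD[OF c]
  show "ctx_ok Q \<kappa> l S r \<rho>" unfolding ctx_ok_def
    using whisk_ok_iff[OF S] d(1) cmp1(1)[OF d(2)] cmp1(1)[OF d(4)] seqD[OF d(2)] seqD[OF d(3)] by simp
qed

lemma ctx_sr2: assumes "ctx 3 \<kappa> l u r \<rho>"
  shows "ctx 2 \<kappa> l (sr 2 u) r \<rho>" "sr 2 (plug \<kappa> l u r \<rho>) = plug \<kappa> l (sr 2 u) r \<rho>"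
proof -
  note c = ctxD[OF assms]
  note w = wh_sr2[OF c(1)]
  show "ctx 2 \<kappa> l (sr 2 u) r \<rho>" using c w wh(1)[OF w(1)] by (simp add: ctx_def seq_def)
  have "sr 2 \<kappa> = \<kappa>" "sr 2 \<rho> = \<rho>" using F.bdry_same seqD[OF c(2)] seqD[OF c(3)] by auto
  thus "sr 2 (plug \<kappa> l u r \<rho>) = plug \<kappa> l (sr 2 u) r \<rho>"
    using cmp1(6)[OF c(4), of Minus] cmp1(6)[OF c(2), of Minus] w(2) by simp
qed

lemma ctx_word2: assumes "ctx 2 \<kappa> l u r \<rho>"
  shows "word2 (plug \<kappa> l u r \<rho>) = word2 \<kappa> @ wrap (word1 l) (word1 r) (word2 u) @ word2 \<rho>"
  using word2_seq[OF ctxD(4)[OF assms]] word2_seq[OF ctxD(2)[OF assms]] word2_wh[OF ctxD(1)[OF assms]] by simp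

lemma rewriting_step_iff: "rewriting_step Q S \<longleftrightarrow>
    (\<exists>A\<in>gens3 Q. \<exists>\<kappa> l r \<rho>. ctx 3 \<kappa> l (gen3 Q A) r \<rho> \<and> S = plug \<kappa> l (gen3 Q A) r \<rho>)"
  unfolding rewriting_step_def using ctx_ok_iff[OF gen3_cell] by blast

lemma append_middle:
  assumes "K @ M @ R = K0 @ N @ R0" "length K0 \<le> length K" "length R0 \<le> length R"
  obtains K' R' where "K = K0 @ K'" "R = R' @ R0" "N = K' @ M @ R'"
proof -
  obtain K' where K': "K = K0 @ K'"
    using assms(1,2) by (auto simp: append_eq_append_conv2)
  hence e: "(K' @ M) @ R = N @ R0" using assms(1) by simp
  then obtain us where "N = (K' @ M) @ us \<and> R = us @ R0 \<or> K' @ M = N @ us \<and> R0 = us @ R"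
    unfolding append_eq_append_conv2[of "K' @ M"] by metis
  thus ?thesis using that K' assms(3) by auto
qed

lemma wrap_eq_append: assumes "wrap u v N = X @ Y"
  obtains N1 N2 where "N = N1 @ N2" "wrap u v N1 = X" "wrap u v N2 = Y"
  using assms unfolding wrap_def by (auto simp: map_eq_append_conv)

text \<open>
  The word of the source cuts it into the pieces prescribed by either decomposition, and since
  2-cells with the same 1-source and the same word are equal, the pieces match as cells. No normal form
  of 3-cells is needed.
\<close>

lemma factor_step:
  assumes c: "ctx 3 \<kappa> l u r \<rho>" and d: "ctx 2 \<kappa>0 l0 \<phi> r0 \<rho>0"
    and src: "sr 2 (plug \<kappa> l u r \<rho>) = plug \<kappa>0 l0 \<phi> r0 \<rho>0"
    and l: "l = l0 \<cdot>\<^sub>0 l'" "l' \<in> Cl 1" "tg 0 l0 = sr 0 l'"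
    and r: "r = r' \<cdot>\<^sub>0 r0" "r' \<in> Cl 1" "tg 0 r' = sr 0 r0"
    and len: "length (word2 \<kappa>0) \<le> length (word2 \<kappa>)" "length (word2 \<rho>0) \<le> length (word2 \<rho>)"
  obtains \<kappa>' \<rho>' where "ctx 3 \<kappa>' l' u r' \<rho>'" "sr 2 (plug \<kappa>' l' u r' \<rho>') = \<phi>"
    "ctx 3 \<kappa>0 l0 (plug \<kappa>' l' u r' \<rho>') r0 \<rho>0" "plug \<kappa> l u r \<rho> = plug \<kappa>0 l0 (plug \<kappa>' l' u r' \<rho>') r0 \<rho>0"
proof -
  note C = ctxD[OF c] and D = ctxD[OF d]
  define p where "p = sr 2 u"
  note c2 = ctx_sr2[OF c, folded p_def]
  note C2 = ctxD[OF c2(1)]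
  have L0: "l0 \<in> Cl 1" "r0 \<in> Cl 1" using fitD[OF D(1)] by simp_all
  have "tg 0 l = tg 0 l'" "sr 0 r = sr 0 r'"
    using cmp0_left(4)[OF L0(1) l(2) _ l(3)] cmp0_left(3)[OF r(2) L0(2) _ r(3)] l(1) r(1) by simp_all
  hence fu: "fit 3 l' u r'" using fitD[OF C(1)] l(2) r(2) by (simp add: fit_def)
  note fp = wh_sr2[OF fu, folded p_def]
  note ww = wh_wh[OF fu L0 l(3) r(3), folded l(1) r(1)]
  note wp = wh_wh[OF fp(1) L0 l(3) r(3), folded l(1) r(1)]
  have wr: "wrap (word1 l) (word1 r) X = wrap (word1 l0) (word1 r0) (wrap (word1 l') (word1 r') X)" for X
    using word1_cmp0[OF L0(1) l(2,3)] word1_cmp0[OF r(2) L0(2) r(3)] l(1) r(1) by simp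
  have "word2 \<kappa> @ wrap (word1 l) (word1 r) (word2 p) @ word2 \<rho> =
    word2 \<kappa>0 @ wrap (word1 l0) (word1 r0) (word2 \<phi>) @ word2 \<rho>0"
    using ctx_word2[OF c2(1)] ctx_word2[OF d] c2(2) src by simp
  \<comment> \<open>The context around \<open>\<phi>\<close> has the shorter ends, so the surplus of
    \<open>\<kappa>\<close> and of \<open>\<rho>\<close> lies inside the whiskered word of
    \<open>\<phi>\<close>.\<close>
  then obtain K R where KR: "word2 \<kappa> = word2 \<kappa>0 @ K" "word2 \<rho> = R @ word2 \<rho>0"
    "wrap (word1 l0) (word1 r0) (word2 \<phi>) = K @ wrap (word1 l) (word1 r) (word2 p) @ R"
    using append_middle len by metis
  obtain N1 N2 N3 where N: "word2 \<phi> = N1 @ N2 @ N3" "wrap (word1 l0) (word1 r0) N1 = K"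
    "wrap (word1 l0) (word1 r0) N2 = wrap (word1 l) (word1 r) (word2 p)" "wrap (word1 l0) (word1 r0) N3 = R"
    using wrap_eq_append[OF KR(3)] wrap_eq_append by metis
  obtain \<kappa>' \<mu> where s1: "seq 2 2 \<kappa>' \<mu>" "\<phi> = \<kappa>' \<cdot>\<^sub>1 \<mu>" "word2 \<kappa>' = N1" "word2 \<mu> = N2 @ N3"
    using word2_split[OF fitD(2)[OF D(1)] N(1)] by metis
  obtain m \<rho>' where s2: "seq 2 2 m \<rho>'" "\<mu> = m \<cdot>\<^sub>1 \<rho>'" "word2 m = N2" "word2 \<rho>' = N3"
    using word2_split[OF seqD(2)[OF s1(1)] s1(4)] by metis
  have f: "fit (max 2 2) l0 (\<kappa>' \<cdot>\<^sub>1 \<mu>) r0" using D(1) s1(2) by simp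
  have fk: "fit 2 l0 \<kappa>' r0" using f cmp1(5)[OF s1(1)] seqD[OF s1(1)] by (simp add: fit_def)
  note w1 = wh_cmp1[OF s1(1) disjI1[OF fk]]
  have fm: "fit 2 l0 m r0" using w1(5) cmp1(5)[OF s2(1)] seqD[OF s2(1)] s2(2) by (simp add: fit_def)
  note w2 = wh_cmp1[OF s2(1) disjI1[OF fm]]
  define a b c where abc: "a = wh l0 \<kappa>' r0" "b = wh l0 m r0" "c = wh l0 \<rho>' r0"
  have sab: "seq 2 2 a b" using w1(2) cmp1(3)[OF w2(2)] w2 s2(2) by (simp add: abc seq_def)
  have sbc: "seq 2 2 b c" using w2(2) by (simp add: abc)
  have phi: "wh l0 \<phi> r0 = a \<cdot>\<^sub>1 (b \<cdot>\<^sub>1 c)" using w1(1) w2(1) s1(2) s2(2) by (simp add: abc)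
  have wa: "word2 a = K" and wb: "word2 b = wrap (word1 l) (word1 r) (word2 p)" and wc: "word2 c = R"
    using word2_wh[OF fk] word2_wh[OF fm] word2_wh[OF w2(5)] N s1 s2 by (simp_all add: abc)
  have ska: "seq 2 2 \<kappa>0 a" using D(2) phi cmp1(3) cmp1_assoc(3)[OF sab sbc] seqD[OF sab]
    by (simp add: seq_def) (metis One_nat_def abc(1) cmp1(3) s1(1) w1(1,2) s1(2))
  have scr: "seq 2 2 c \<rho>0" using D(3) phi cmp1(4)[OF cmp1_assoc(3)[OF sab sbc]] cmp1(4)[OF sbc] seqD[OF sbc]
    by (simp add: seq_def)
  have s0: "sr 1 \<kappa> = sr 1 \<kappa>0" using C2(8) D(8) c2(2) src by simp
  have k: "\<kappa> = \<kappa>0 \<cdot>\<^sub>1 a"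
    by (rule word2_inj) (use seqD[OF C(2)] cmp1(2)[OF ska] s0 cmp1(3)[OF ska] word2_seq[OF ska] KR(1) wa in auto)
  have b: "b = wh l p r"
  proof (rule word2_inj)
    show "b \<in> Cl 2" "wh l p r \<in> Cl 2" using seqD[OF sab] wh(1)[OF C2(1)] by simp_all
    show "sr 1 b = sr 1 (wh l p r)" using seqD(4)[OF sab] cmp1(4)[OF ska] k seqD(4)[OF C2(2)] by simp
    show "word2 b = word2 (wh l p r)" using wb word2_wh[OF C2(1)] by simp
  qed
  \<comment> \<open>The equality for \<open>b\<close> holds after whiskering by \<open>l0\<close>
    and \<open>r0\<close>; cancellation moves it inside.\<close>
  have m: "m = wh l' p r'"
    by (rule wh2_cancel[OF fm wp(2)]) (use b wp(1) in \<open>simp add: abc\<close>)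
  have rho: "\<rho> = c \<cdot>\<^sub>1 \<rho>0"
  proof (rule word2_inj)
    show "\<rho> \<in> Cl 2" "c \<cdot>\<^sub>1 \<rho>0 \<in> Cl 2" using seqD[OF C(3)] cmp1(2)[OF scr] by simp_all
    show "sr 1 \<rho> = sr 1 (c \<cdot>\<^sub>1 \<rho>0)" using seqD(4)[OF C2(3)] b seqD(4)[OF sbc] cmp1(3)[OF scr] by simp
    show "word2 \<rho> = word2 (c \<cdot>\<^sub>1 \<rho>0)" using KR(2) wc word2_seq[OF scr] by simp
  qed
  \<comment> \<open>The pieces were matched for the source. Since 1-boundaries do not distinguish a
    3-cell from its source, the same composites exist with \<open>u\<close> in place of
    \<open>p\<close>.\<close>
  have e1: "bd e 1 (wh l u r) = bd e 1 b" for e using wh_sr2(3)[OF C(1)] b by (simp add: p_def)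
  have e2: "bd e 1 (wh l' u r') = bd e 1 m" for e using fp(3) m by simp
  have "tg 1 \<kappa>' = sr 1 m" using seqD(4)[OF s1(1)] cmp1(3)[OF s2(1)] s2(2) by simp
  hence c': "ctx 3 \<kappa>' l' u r' \<rho>'"
    using fu e2 wh(1)[OF fu] seqD[OF s1(1)] seqD[OF s2(1)] by (simp add: ctx_def seq_def)
  note C' = ctxD[OF c']
  have src': "sr 2 (plug \<kappa>' l' u r' \<rho>') = \<phi>"
    using ctx_sr2(2)[OF c'] ctxD(6)[OF ctx_sr2(1)[OF c']] m s1(2) s2(2) by (simp add: p_def)
  have sx: "seq 2 3 a (wh l u r)" "seq 3 2 (wh l u r) c"
    using seqD[OF sab] seqD[OF sbc] e1 wh(1)[OF C(1)] by (simp_all add: seq_def)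
  have q1: "seq (max 2 3) 2 (\<kappa>' \<cdot>\<^sub>1 wh l' u r') \<rho>'" using C'(4) by simp
  note z1 = wh_cmp1[OF C'(2) disjI1[OF fk]]
  have fr: "fit 2 l0 \<rho>' r0" using w2(5) .
  note z2 = wh_cmp1[OF q1 disjI2[OF fr]]
  have S': "wh l0 (plug \<kappa>' l' u r' \<rho>') r0 = a \<cdot>\<^sub>1 wh l u r \<cdot>\<^sub>1 c"
    using z1(1) z2(1) ww(1) by (simp add: abc)
  have F': "fit 3 l0 (plug \<kappa>' l' u r' \<rho>') r0" using z2(3) by simp
  note y1 = cmp1_assoc[OF sx, simplified]
  have sk: "seq 2 3 \<kappa>0 (a \<cdot>\<^sub>1 wh l u r)"
    using ska cmp1(2,3)[OF sx(1)] by (simp add: seq_def)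
  have sk2: "seq 2 3 \<kappa>0 (a \<cdot>\<^sub>1 wh l u r \<cdot>\<^sub>1 c)"
    using sk cmp1(2,3)[OF y1(2)] by (simp add: seq_def)
  have sr: "seq 3 2 (a \<cdot>\<^sub>1 wh l u r \<cdot>\<^sub>1 c) \<rho>0"
    using scr cmp1(2,4)[OF y1(2)] by (simp add: seq_def)
  have ctx': "ctx 3 \<kappa>0 l0 (plug \<kappa>' l' u r' \<rho>') r0 \<rho>0" unfolding ctx_def S' using F' sk2 sr by simp
  have skk: "seq 3 2 (\<kappa>0 \<cdot>\<^sub>1 (a \<cdot>\<^sub>1 wh l u r)) c"
    using y1(2) cmp1(2,4)[OF sk] by (simp add: seq_def)
  have "plug \<kappa> l u r \<rho> = \<kappa>0 \<cdot>\<^sub>1 a \<cdot>\<^sub>1 wh l u r \<cdot>\<^sub>1 (c \<cdot>\<^sub>1 \<rho>0)" unfolding k rho ..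
  also have "\<kappa>0 \<cdot>\<^sub>1 a \<cdot>\<^sub>1 wh l u r = \<kappa>0 \<cdot>\<^sub>1 (a \<cdot>\<^sub>1 wh l u r)" using cmp1_assoc(1)[OF ska sx(1)] by simp
  also have "\<kappa>0 \<cdot>\<^sub>1 (a \<cdot>\<^sub>1 wh l u r) \<cdot>\<^sub>1 (c \<cdot>\<^sub>1 \<rho>0) = \<kappa>0 \<cdot>\<^sub>1 (a \<cdot>\<^sub>1 wh l u r) \<cdot>\<^sub>1 c \<cdot>\<^sub>1 \<rho>0"
    using cmp1_assoc(1)[OF skk scr] by simp
  also have "\<kappa>0 \<cdot>\<^sub>1 (a \<cdot>\<^sub>1 wh l u r) \<cdot>\<^sub>1 c = \<kappa>0 \<cdot>\<^sub>1 (a \<cdot>\<^sub>1 wh l u r \<cdot>\<^sub>1 c)"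
    using cmp1_assoc(1)[OF sk y1(2)] by simp
  finally have "plug \<kappa> l u r \<rho> = plug \<kappa>0 l0 (plug \<kappa>' l' u r' \<rho>') r0 \<rho>0" unfolding S' .
  from that[OF c' src' ctx' this] show ?thesis .
qed

text \<open>The form in which minimality is applied: a context of the common source need only be
  contained, on words, in the contexts of both steps. \<open>factor_step\<close> then gives two
  steps with the same source \<open>\<phi>\<close>, hence a local branching inside that
  context.\<close>

lemma minimal_trivial_context:
  assumes A: "A1 \<in> gens3 Q" "A2 \<in> gens3 Q"
    and c1: "ctx 3 \<kappa>1 l1 (gen3 Q A1) r1 \<rho>1" and c2: "ctx 3 \<kappa>2 l2 (gen3 Q A2) r2 \<rho>2"
    and S: "S1 = plug \<kappa>1 l1 (gen3 Q A1) r1 \<rho>1" "S2 = plug \<kappa>2 l2 (gen3 Q A2) r2 \<rho>2"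
    and src: "sr 2 S1 = sr 2 S2" and min: "minimal Q S1 S2"
    and d: "ctx 2 \<kappa> l \<phi> r \<rho>" "sr 2 S1 = plug \<kappa> l \<phi> r \<rho>"
    and w1: "word1 l1 = word1 l @ u1" "word1 r1 = v1 @ word1 r"
    and w2: "word1 l2 = word1 l @ u2" "word1 r2 = v2 @ word1 r"
    and k: "length (word2 \<kappa>) \<le> length (word2 \<kappa>1)" "length (word2 \<rho>) \<le> length (word2 \<rho>1)"
      "length (word2 \<kappa>) \<le> length (word2 \<kappa>2)" "length (word2 \<rho>) \<le> length (word2 \<rho>2)"
  shows "word1 l = []" "word1 r = []" "word2 \<kappa> = []" "word2 \<rho> = []"
proof -
  \<comment> \<open>The argument for a single step, used for each of the two. The prefix and suffix
    found on words are \<open>l\<close> and \<open>r\<close> themselves because the outer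
    0-boundaries agree.\<close>
  have *: "\<exists>S'. rewriting_step Q S' \<and> S' \<in> Cl 3 \<and> sr 2 S' = \<phi> \<and> ctx 3 \<kappa> l S' r \<rho> \<and> S = plug \<kappa> l S' r \<rho>"
    if A: "A \<in> gens3 Q" and c: "ctx 3 \<kappa>' l' (gen3 Q A) r' \<rho>'" and S: "S = plug \<kappa>' l' (gen3 Q A) r' \<rho>'"
      and s: "sr 2 S = plug \<kappa> l \<phi> r \<rho>"
      and w: "word1 l' = word1 l @ u" "word1 r' = v @ word1 r"
      and k: "length (word2 \<kappa>) \<le> length (word2 \<kappa>')" "length (word2 \<rho>) \<le> length (word2 \<rho>')"
    for A S \<kappa>' l' r' \<rho>' u v
  proof -
    have S3: "S \<in> Cl 3" using ctxD(7)[OF c] S by simp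
    have "bd e 0 (sr 2 S) = bd e 0 S" for e by (rule bd_bd[OF S3]) simp_all
    hence e: "bd e 0 (plug \<kappa> l \<phi> r \<rho>) = bd e 0 (plug \<kappa>' l' (gen3 Q A) r' \<rho>')" for e
      unfolding s S[symmetric] .
    have b: "sr 0 l' = sr 0 l" "tg 0 r' = tg 0 r"
      using e[of Minus] e[of Plus] unfolding ctxD(9,10)[OF c] ctxD(9,10)[OF d(1)] by simp_all
    obtain l0 l'' where l: "l0 \<in> Cl 1" "l'' \<in> Cl 1" "tg 0 l0 = sr 0 l''" "l' = l0 \<cdot>\<^sub>0 l''" "word1 l0 = word1 l" "sr 0 l0 = sr 0 l'"
      using word1_split[OF fitD(1)[OF ctxD(1)[OF c]] w(1)] by metis
    have l0: "l0 = l" using word1_inj[OF l(1) fitD(1)[OF ctxD(1)[OF d(1)]]] l b by simp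
    obtain r'' r0 where r: "r'' \<in> Cl 1" "r0 \<in> Cl 1" "tg 0 r'' = sr 0 r0" "r' = r'' \<cdot>\<^sub>0 r0" "word1 r0 = word1 r" "tg 0 r0 = tg 0 r'"
      using word1_split[OF fitD(3)[OF ctxD(1)[OF c]] w(2)] by metis
    have r0: "r0 = r" using word1_inj_tgt[OF r(2) fitD(3)[OF ctxD(1)[OF d(1)]]] r b by simp
    obtain \<kappa>'' \<rho>'' where f: "ctx 3 \<kappa>'' l'' (gen3 Q A) r'' \<rho>''" "sr 2 (plug \<kappa>'' l'' (gen3 Q A) r'' \<rho>'') = \<phi>"
      "ctx 3 \<kappa> l (plug \<kappa>'' l'' (gen3 Q A) r'' \<rho>'') r \<rho>" "S = plug \<kappa> l (plug \<kappa>'' l'' (gen3 Q A) r'' \<rho>'') r \<rho>"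
      using factor_step[OF c d(1) s[unfolded S] l(4)[unfolded l0] l(2) l(3)[unfolded l0] r(4)[unfolded r0] r(1) r(3)[unfolded r0] k]
      unfolding S by metis
    have "rewriting_step Q (plug \<kappa>'' l'' (gen3 Q A) r'' \<rho>'')" unfolding rewriting_step_iff using A f(1) by blast
    thus ?thesis using f ctxD(7)[OF f(1)] by blast
  qed
  obtain S1' where s1: "rewriting_step Q S1'" "S1' \<in> Cl 3" "sr 2 S1' = \<phi>" "ctx 3 \<kappa> l S1' r \<rho>" "S1 = plug \<kappa> l S1' r \<rho>"
    using *[OF A(1) c1 S(1) d(2) w1 k(1,2)] by blast
  obtain S2' where s2: "rewriting_step Q S2'" "S2' \<in> Cl 3" "sr 2 S2' = \<phi>" "ctx 3 \<kappa> l S2' r \<rho>" "S2 = plug \<kappa> l S2' r \<rho>"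
    using *[OF A(2) c2 S(2) d(2)[unfolded src] w2 k(3,4)] by blast
  have "local_branching Q S1' S2'" using s1(1,3) s2(1,3) by (simp add: local_branching_def)
  hence "is_idt Q 0 l \<and> is_idt Q 0 r \<and> is_idt Q 1 \<kappa> \<and> is_idt Q 1 \<rho>"
    using min s1(4,5) s2(4,5) ctx_ok_iff[OF s1(2)] ctx_ok_iff[OF s2(2)] unfolding minimal_def by blast
  thus "word1 l = []" "word1 r = []" "word2 \<kappa> = []" "word2 \<rho> = []" by (auto simp: is_idt_def)
qed

section \<open>Finiteness\<close>

text \<open>Words forget boundaries, so a code also records the 0-cell where the step starts and the
  word of the 1-source of \<open>\<kappa>\<close>. It is a relation since not every tuple is the
  code of a step.\<close>

inductive coded :: "('g0, 'g1, 'g2, 'g3) cell3 \<Rightarrow> 'g1 list \<Rightarrow> ('g1 list \<times> 'g2 \<times> 'g1 list) list \<Rightarrow>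
    'g1 list \<Rightarrow> 'g3 \<Rightarrow> 'g1 list \<Rightarrow> ('g1 list \<times> 'g2 \<times> 'g1 list) list \<Rightarrow> ('g0, 'g1, 'g2, 'g3) cell3 \<Rightarrow> bool" where
  "A \<in> gens3 Q \<Longrightarrow> ctx 3 \<kappa> l (gen3 Q A) r \<rho> \<Longrightarrow>
   coded (sr 0 l) (word1 (sr 1 \<kappa>)) (word2 \<kappa>) (word1 l) A (word1 r) (word2 \<rho>) (plug \<kappa> l (gen3 Q A) r \<rho>)"

text \<open>Boundaries propagate: the starting 0-cell fixes \<open>l\<close>, the 0-target of the
  generator fixes where \<open>r\<close> starts, \<open>f\<close> fixes the 1-source of
  \<open>\<kappa>\<close>, and the 1-target of the whiskered generator is the 1-source of
  \<open>\<rho>\<close>.\<close>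

lemma coded_unique: assumes "coded x f K u A v R S" "coded x f K u A v R S'" shows "S = S'"
  using assms(1)
proof cases
  case s: (1 \<kappa> l r \<rho>)
  from assms(2) show ?thesis
  proof cases
    case s': (1 \<kappa>' l' r' \<rho>')
    note c = ctxD[OF s(9)] and c' = ctxD[OF s'(9)]
    have l: "l = l'" using word1_inj[of l l'] fitD(1)[OF c(1)] fitD(1)[OF c'(1)] s(1,4) s'(1,4) by simp
    have r: "r = r'" using word1_inj[of r r'] fitD[OF c(1)] fitD[OF c'(1)] s(5) s'(5) by simp
    note k = seqD[OF c(2)] and k' = seqD[OF c'(2)]
    have "sr 1 \<kappa> = sr 1 \<kappa>'"
    proof (rule word1_inj)
      show "sr 1 \<kappa> \<in> Cl 1" "sr 1 \<kappa>' \<in> Cl 1" using sr1_cell k(1) k'(1) by simp_all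
      show "word1 (sr 1 \<kappa>) = word1 (sr 1 \<kappa>')" using s(2) s'(2) by simp
      show "sr 0 (sr 1 \<kappa>) = sr 0 (sr 1 \<kappa>')"
        using bd_bd[OF k(1), of 0 1] bd_bd[OF k'(1), of 0 1] k(7) k'(7) wh(2)[OF c(1)] wh(2)[OF c'(1)] l by simp
    qed
    hence kk: "\<kappa> = \<kappa>'" using word2_inj[of \<kappa> \<kappa>'] k k' s(3) s'(3) by simp
    have "sr 1 \<rho> = sr 1 \<rho>'" using seqD(4)[OF c(3)] seqD(4)[OF c'(3)] l r by simp
    hence "\<rho> = \<rho>'" using word2_inj[of \<rho> \<rho>'] seqD(2)[OF c(3)] seqD(2)[OF c'(3)] s(6) s'(6) by simp
    thus ?thesis using s(7) s'(7) kk l r by simp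
  qed
qed

section \<open>Finite sets of candidates for the codes\<close>

abbreviation srword :: "'g3 \<Rightarrow> ('g1 list \<times> 'g2 \<times> 'g1 list) list" where
  "srword A \<equiv> word2 (sr 2 (gen3 Q A))"

definition letters :: "('g1 list \<times> 'g2 \<times> 'g1 list) set" where
  "letters = (\<Union>A\<in>gens3 Q. set (srword A))"

text \<open>Candidates for left contexts. Around a shared whisker such a context is either empty or
  a prefix of the left context of that whisker in the source of the other generator;
  \<open>rights\<close> is the mirror image.\<close>

definition lefts :: "'g1 list set" where
  "lefts = (\<Union>e\<in>letters. (\<lambda>i. take i (fst e)) ` {..length (fst e)})"

definition rights :: "'g1 list set" where
  "rights = (\<Union>e\<in>letters. (\<lambda>i. drop i (snd (snd e))) ` {..length (snd (snd e))})"

definition redexes :: "('g1 list \<times> 'g2 \<times> 'g1 list) list set" where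
  "redexes = (\<lambda>(A, u, v). wrap u v (srword A)) ` (gens3 Q \<times> lefts \<times> rights)"

text \<open>Whatever one step leaves untouched before or after its interval is covered by the other
  step, hence is a prefix or a suffix of a whiskered source.\<close>

definition prefixes :: "('g1 list \<times> 'g2 \<times> 'g1 list) list set" where
  "prefixes = (\<Union>m\<in>redexes. (\<lambda>i. take i m) ` {..length m})"

definition suffixes :: "('g1 list \<times> 'g2 \<times> 'g1 list) list set" where
  "suffixes = (\<Union>m\<in>redexes. (\<lambda>i. drop i m) ` {..length m})"

text \<open>Candidates for the 1-source shared by both steps: it is that of the whiskered source
  standing first in the word.\<close>

definition sources :: "'g1 list set" where
  "sources = (\<lambda>(A, u, v). u @ word1 (sr 1 (gen3 Q A)) @ v) ` (gens3 Q \<times> lefts \<times> rights)"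

text \<open>The generator \<open>B\<close> only supplies the starting 0-cell: one of the two left
  contexts is an identity, so the generator of that step starts there.\<close>

definition bounded_steps :: "('g0, 'g1, 'g2, 'g3) cell3 set" where
  "bounded_steps = (\<Union>A\<in>gens3 Q. \<Union>B\<in>gens3 Q. \<Union>f\<in>sources. \<Union>K\<in>prefixes.
     \<Union>u\<in>lefts. \<Union>v\<in>rights. \<Union>R\<in>suffixes. {S. coded (sr 0 (gen3 Q B)) f K u A v R S})"

lemma bounded_stepsI:
  assumes "coded (sr 0 (gen3 Q B)) f K u A v R S" "A \<in> gens3 Q" "B \<in> gens3 Q" "f \<in> sources" "K \<in> prefixes"
    "u \<in> lefts" "v \<in> rights" "R \<in> suffixes"
  shows "S \<in> bounded_steps"
  unfolding bounded_steps_def by (intro UN_I CollectI) (rule assms)+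

lemma finite_bounded_steps: assumes fin: "finite (gens3 Q)" shows "finite bounded_steps"
proof -
  have "finite letters" using fin by (simp add: letters_def)
  hence f: "finite lefts" "finite rights" by (simp_all add: lefts_def rights_def)
  hence g: "finite redexes" "finite sources" using fin by (simp_all add: redexes_def sources_def)
  hence h: "finite prefixes" "finite suffixes" by (simp_all add: prefixes_def suffixes_def)
  have "finite {S. coded x f K u A v R S}" for x f K u A v R
  proof (rule finite_subset)
    \<comment> \<open>By \<open>coded_unique\<close> the set has at most one element, which the
      choice operator then returns.\<close>
    show "{S. coded x f K u A v R S} \<subseteq> {SOME S. coded x f K u A v R S}"
      by (auto intro: coded_unique someI)
  qed simp
  thus ?thesis unfolding bounded_steps_def using fin f g h by simp
qed

section \<open>Disjoint and overlapping intervals\<close>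

lemma word2_Nil_cmp1: assumes "seq 2 k \<kappa> u" "word2 \<kappa> = []" shows "\<kappa> \<cdot>\<^sub>1 u = u" "sr 1 \<kappa> = sr 1 u"
proof -
  have o: "\<kappa> = one (sr 1 \<kappa>)" using word2_Nil seqD(1)[OF assms(1)] assms(2) by simp
  hence "tg 1 \<kappa> = sr 1 \<kappa>" using one_1(2)[OF sr1_cell[OF seqD(1)[OF assms(1)], of Minus]] by simp
  thus s: "sr 1 \<kappa> = sr 1 u" using seqD(4)[OF assms(1)] by simp
  show "\<kappa> \<cdot>\<^sub>1 u = u" using one_cmp1_left(1)[OF seqD(2,6)[OF assms(1)] s] o by simp
qed

lemma cmp1_word2_Nil: assumes "seq k 2 u \<rho>" "word2 \<rho> = []" shows "u \<cdot>\<^sub>1 \<rho> = u"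
proof -
  have o: "\<rho> = one (sr 1 \<rho>)" using word2_Nil seqD(2)[OF assms(1)] assms(2) by simp
  have s: "sr 1 \<rho> = tg 1 u" using seqD(4)[OF assms(1)] by simp
  show "u \<cdot>\<^sub>1 \<rho> = u" using one_cmp1_right(1)[OF seqD(1,5)[OF assms(1)] s] o by simp
qed

lemma append_le: "K @ L = M @ N \<Longrightarrow> length K \<le> length M \<Longrightarrow> \<exists>X. M = K @ X \<and> L = X @ N"
  by (auto simp: append_eq_append_conv2)

text \<open>Nothing precedes the first interval and nothing follows the second, and by
  \<open>le\<close> the second starts after the end of the first. The 2-cell \<open>\<chi>\<close>
  is the piece of the source between them.\<close>

lemma disjoint_independent:
  assumes A: "A1 \<in> gens3 Q" "A2 \<in> gens3 Q"
    and c1: "ctx 3 \<kappa>1 l1 (gen3 Q A1) r1 \<rho>1" and c2: "ctx 3 \<kappa>2 l2 (gen3 Q A2) r2 \<rho>2"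
    and S: "S1 = plug \<kappa>1 l1 (gen3 Q A1) r1 \<rho>1" "S2 = plug \<kappa>2 l2 (gen3 Q A2) r2 \<rho>2"
    and src: "sr 2 S1 = sr 2 S2"
    and nil: "word2 \<kappa>1 = []" "word2 \<rho>2 = []"
    and le: "length (srword A1) \<le> length (word2 \<kappa>2)"
  shows "independent Q S1 S2"
proof -
  define G1 G2 where G: "G1 = gen3 Q A1" "G2 = gen3 Q A2"
  note C1 = ctxD[OF c1, folded G] and C2 = ctxD[OF c2, folded G]
  note d1 = ctx_sr2[OF c1, folded G] and d2 = ctx_sr2[OF c2, folded G]
  note D1 = ctxD[OF d1(1)] and D2 = ctxD[OF d2(1)]
  note p1 = wh_sr2[OF C1(1)] and p2 = wh_sr2[OF C2(1)]
  note SS = S[folded G]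
  let ?M1 = "wrap (word1 l1) (word1 r1) (word2 (sr 2 G1))" and ?M2 = "wrap (word1 l2) (word1 r2) (word2 (sr 2 G2))"
  have e: "?M1 @ word2 \<rho>1 = word2 \<kappa>2 @ ?M2"
    using src unfolding SS d1(2) d2(2) using ctx_word2[OF d1(1)] ctx_word2[OF d2(1)] nil by simp
  have "length ?M1 \<le> length (word2 \<kappa>2)" using le by (simp add: G)
  from append_le[OF e this] obtain X where X: "word2 \<kappa>2 = ?M1 @ X" "word2 \<rho>1 = X @ ?M2" by blast
  obtain a \<chi> where s: "seq 2 2 a \<chi>" "\<kappa>2 = a \<cdot>\<^sub>1 \<chi>" "word2 a = ?M1" "word2 \<chi> = X"
    using word2_split[OF seqD(1)[OF C2(2)] X(1)] by metis
  have sr: "sr 1 S1 = sr 1 S2"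
  proof -
    have "S1 \<in> Cl 3" "S2 \<in> Cl 3" using C1(7) C2(7) SS by simp_all
    thus ?thesis using bd_bd[of S1 3 1 2 Minus Minus] bd_bd[of S2 3 1 2 Minus Minus] src by simp
  qed
  note n1 = word2_Nil_cmp1[OF C1(2) nil(1)]
  have a: "a = wh l1 (sr 2 G1) r1"
  proof (rule word2_inj)
    show "a \<in> Cl 2" "wh l1 (sr 2 G1) r1 \<in> Cl 2" using seqD(1)[OF s(1)] wh(1)[OF p1(1)] by simp_all
    show "sr 1 a = sr 1 (wh l1 (sr 2 G1) r1)"
      using sr C1(8) C2(8) SS cmp1(3)[OF s(1)] s(2) n1(2) p1(3) by simp
    show "word2 a = word2 (wh l1 (sr 2 G1) r1)" using s(3) word2_wh[OF p1(1)] by simp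
  qed
  have t1: "seq 3 2 (wh l1 G1 r1) \<chi>"
    using seqD[OF s(1)] p1(3) wh(1)[OF C1(1)] a by (simp add: seq_def)
  have t2: "seq 2 2 \<chi> (wh l2 (sr 2 G2) r2)"
    using seqD[OF s(1)] seqD(4)[OF D2(2)] cmp1(4)[OF s(1)] s(2) wh(1)[OF p2(1)] by (simp add: seq_def)
  have t3: "seq 2 3 \<chi> (wh l2 G2 r2)"
    using seqD[OF t2] p2(3) wh(1)[OF C2(1)] by (simp add: seq_def)
  have rho: "\<rho>1 = \<chi> \<cdot>\<^sub>1 wh l2 (sr 2 G2) r2"
  proof (rule word2_inj)
    show "\<rho>1 \<in> Cl 2" "\<chi> \<cdot>\<^sub>1 wh l2 (sr 2 G2) r2 \<in> Cl 2" using seqD(2)[OF C1(3)] cmp1(2)[OF t2] by simp_all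
    show "sr 1 \<rho>1 = sr 1 (\<chi> \<cdot>\<^sub>1 wh l2 (sr 2 G2) r2)"
      using seqD(4)[OF C1(3)] seqD(4)[OF t1] cmp1(3)[OF t2] by simp
    show "word2 \<rho>1 = word2 (\<chi> \<cdot>\<^sub>1 wh l2 (sr 2 G2) r2)"
      using X(2) s(4) word2_seq[OF t2] word2_wh[OF p2(1)] by simp
  qed
  have "S1 = wh l1 G1 r1 \<cdot>\<^sub>1 \<chi> \<cdot>\<^sub>1 wh l2 (sr 2 G2) r2"
    using cmp1_assoc(1)[OF t1 t2] unfolding SS n1(1) rho by simp
  moreover have "S2 = wh l1 (sr 2 G1) r1 \<cdot>\<^sub>1 \<chi> \<cdot>\<^sub>1 wh l2 G2 r2"
    using cmp1_word2_Nil[OF C2(4) nil(2)] unfolding SS s(2) a by simp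
  moreover have "whisk_ok Q l1 G1 r1" "whisk_ok Q l2 G2 r2"
    using whisk_ok_iff[OF fitD(2,4)[OF C1(1)]] whisk_ok_iff[OF fitD(2,4)[OF C2(1)]] C1(1) C2(1) by simp_all
  ultimately show ?thesis unfolding independent_def
    using A seqD(2)[OF s(1)] cmp1(1)[OF t1] cmp1(1)[OF t3] unfolding G by blast
qed

text \<open>Two prefixes of one word are comparable, and \<open>c\<close> is the shorter
  one.\<close>

lemma common_prefix: assumes "u1 @ a1 = u2 @ a2"
  obtains c w1 w2 where "u1 = c @ w1" "u2 = c @ w2" "w1 = [] \<or> w2 = []"
proof -
  have "(\<exists>w. u1 = u2 @ w) \<or> (\<exists>w. u2 = u1 @ w)" using assms by (auto simp: append_eq_append_conv2)
  thus ?thesis using that[of u2 _ "[]"] that[of u1 "[]"] by auto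
qed

lemma common_suffix: assumes "b1 @ v1 = b2 @ v2"
  obtains d w1 w2 where "v1 = w1 @ d" "v2 = w2 @ d" "w1 = [] \<or> w2 = []"
proof -
  have "(\<exists>w. v1 = w @ v2) \<or> (\<exists>w. v2 = w @ v1)" using assms by (auto simp: append_eq_append_conv2)
  thus ?thesis using that[of _ v2 "[]"] that[of "[]" v1] by auto
qed

lemma lefts_prefix: assumes "A \<in> gens3 Q" "(u @ a, \<alpha>, b) \<in> set (srword A)" shows "u \<in> lefts"
proof -
  have "(u @ a, \<alpha>, b) \<in> letters" using assms by (auto simp: letters_def)
  thus ?thesis unfolding lefts_def by (rule UN_I) (auto intro!: image_eqI[of _ _ "length u"])
qed

lemma rights_suffix: assumes "A \<in> gens3 Q" "(a, \<alpha>, b @ v) \<in> set (srword A)" shows "v \<in> rights"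
proof -
  have "(a, \<alpha>, b @ v) \<in> letters" using assms by (auto simp: letters_def)
  thus ?thesis unfolding rights_def by (rule UN_I) (auto intro!: image_eqI[of _ _ "length b"])
qed

lemma set_wrapD: assumes "e \<in> set (wrap u v X)"
  obtains a \<alpha> b where "(a, \<alpha>, b) \<in> set X" "e = (u @ a, \<alpha>, b @ v)"
  using assms unfolding wrap_def by auto

lemma wrap_take: "take i (wrap u v X) = wrap u v (take i X)"
  by (simp add: wrap_def take_map)

text \<open>The order fixed by \<open>le\<close> makes \<open>\<kappa>1\<close> the shorter left
  end, hence trivial, so that positions are counted from the start of the first interval. On the
  right either end may be the shorter one, which is why facts about \<open>\<rho>1\<close> and
  \<open>\<rho>2\<close> come as disjunctions.\<close>

lemma bounded_steps_if_not_independent: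
  assumes ne: "\<And>A. A \<in> gens3 Q \<Longrightarrow> srword A \<noteq> []"
    and A: "A1 \<in> gens3 Q" "A2 \<in> gens3 Q"
    and c1: "ctx 3 \<kappa>1 l1 (gen3 Q A1) r1 \<rho>1" and c2: "ctx 3 \<kappa>2 l2 (gen3 Q A2) r2 \<rho>2"
    and S: "S1 = plug \<kappa>1 l1 (gen3 Q A1) r1 \<rho>1" "S2 = plug \<kappa>2 l2 (gen3 Q A2) r2 \<rho>2"
    and src: "sr 2 S1 = sr 2 S2" and min: "minimal Q S1 S2" and ind: "\<not> independent Q S1 S2"
    and le: "length (word2 \<kappa>1) \<le> length (word2 \<kappa>2)"
  shows "S1 \<in> bounded_steps" "S2 \<in> bounded_steps"
proof -
  define G1 G2 where G: "G1 = gen3 Q A1" "G2 = gen3 Q A2"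
  note C1 = ctxD[OF c1, folded G] and C2 = ctxD[OF c2, folded G]
  note d1 = ctx_sr2[OF c1, folded G] and d2 = ctx_sr2[OF c2, folded G]
  note D1 = ctxD[OF d1(1)] and D2 = ctxD[OF d2(1)]
  note SS = S[folded G]
  define u1 v1 u2 v2 where uv: "u1 = word1 l1" "v1 = word1 r1" "u2 = word1 l2" "v2 = word1 r2"
  define M1 M2 where M: "M1 = wrap u1 v1 (srword A1)" "M2 = wrap u2 v2 (srword A2)"
  have S3: "S1 \<in> Cl 3" "S2 \<in> Cl 3" using C1(7) C2(7) SS by simp_all
  define \<Phi> where "\<Phi> = sr 2 S1"
  have \<Phi>: "\<Phi> \<in> Cl 2" "sr 1 \<Phi> = sr 1 S1" "sr 1 \<Phi> = sr 1 S2" "bd e 0 \<Phi> = bd e 0 S1" "bd e 0 \<Phi> = bd e 0 S2" for e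
    using F.bdry_cells[OF S3(1), of 2] bd_bd[OF S3(1), of _ 2 _ Minus] bd_bd[OF S3(2), of _ 2 _ Minus] src
    unfolding \<Phi>_def by (simp_all del: src, metis+)
  have w1: "word2 \<Phi> = word2 \<kappa>1 @ M1 @ word2 \<rho>1"
    unfolding \<Phi>_def SS d1(2) using ctx_word2[OF d1(1)] by (simp add: M uv G)
  have w2: "word2 \<Phi> = word2 \<kappa>2 @ M2 @ word2 \<rho>2"
    unfolding \<Phi>_def src unfolding SS d2(2) using ctx_word2[OF d2(1)] by (simp add: M uv G)
  have M_ne: "M1 \<noteq> []" "M2 \<noteq> []" using ne A by (simp_all add: M)
  have id1: "word1 (one (sr 0 u)) = []" "word1 (one (tg 0 u)) = []" if "u \<in> Cl k" for u k
    using sr0_cell[OF that] by simp_all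

  note MT = minimal_trivial_context[OF A c1 c2 S src min]

  have K1: "word2 \<kappa>1 = []"
  proof -
    \<comment> \<open>All that follows \<open>\<kappa>1\<close> becomes the inner cell; the other
      three parts of the context are identities.\<close>
    let ?\<phi> = "wh l1 (sr 2 G1) r1 \<cdot>\<^sub>1 \<rho>1"
    have f: "?\<phi> \<in> Cl 2" using seqD(2)[OF D1(5)] .
    note o = wh_one[OF f _ refl refl]
    have t: "seq 2 2 ?\<phi> (one (tg 1 ?\<phi>))" "?\<phi> \<cdot>\<^sub>1 one (tg 1 ?\<phi>) = ?\<phi>"
      using one_cmp1_right[OF f _ refl] by simp_all
    have ctx: "ctx 2 \<kappa>1 (one (sr 0 ?\<phi>)) ?\<phi> (one (tg 0 ?\<phi>)) (one (tg 1 ?\<phi>))"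
      using o t D1(5) by (simp add: ctx_def)
    have e: "sr 2 S1 = plug \<kappa>1 (one (sr 0 ?\<phi>)) ?\<phi> (one (tg 0 ?\<phi>)) (one (tg 1 ?\<phi>))"
      unfolding ctxD(6)[OF ctx] using o(1) t(2) SS d1(2) D1(6) by simp
    show ?thesis
      by (rule MT(3)[OF ctx e]) (use id1[OF f] word2_one[OF sr1_cell[OF f, of Plus]] le in simp_all)
  qed
  have R: "word2 \<rho>1 = [] \<or> word2 \<rho>2 = []"
  proof -
    \<comment> \<open>Used for \<open>\<rho>1\<close> and for \<open>\<rho>2\<close>: whichever has
      the shorter word satisfies both bounds.\<close>
    have *: "word2 \<rho> = []" if r: "length (word2 \<rho>) \<le> length (word2 \<rho>1)" "length (word2 \<rho>) \<le> length (word2 \<rho>2)"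
      and d: "\<Phi> = \<mu> \<cdot>\<^sub>1 \<rho>" "seq 2 2 \<mu> \<rho>" for \<mu> \<rho>
    proof -
      have f: "\<mu> \<in> Cl 2" using seqD(1)[OF d(2)] .
      note o = wh_one[OF f _ refl refl]
      have t: "seq 2 2 (one (sr 1 \<mu>)) \<mu>" "one (sr 1 \<mu>) \<cdot>\<^sub>1 \<mu> = \<mu>"
        using one_cmp1_left[OF f _ refl] by simp_all
      have ctx: "ctx 2 (one (sr 1 \<mu>)) (one (sr 0 \<mu>)) \<mu> (one (tg 0 \<mu>)) \<rho>"
        using o t d(2) by (simp add: ctx_def)
      have e: "sr 2 S1 = plug (one (sr 1 \<mu>)) (one (sr 0 \<mu>)) \<mu> (one (tg 0 \<mu>)) \<rho>"
        using o(1) t(2) d(1) by (simp add: \<Phi>_def)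
      show ?thesis
        by (rule MT(4)[OF ctx e]) (use id1[OF f] word2_one[OF sr1_cell[OF f, of Minus]] r in simp_all)
    qed
    have q1: "\<Phi> = \<kappa>1 \<cdot>\<^sub>1 wh l1 (sr 2 G1) r1 \<cdot>\<^sub>1 \<rho>1" unfolding \<Phi>_def SS d1(2) ..
    have q2: "\<Phi> = \<kappa>2 \<cdot>\<^sub>1 wh l2 (sr 2 G2) r2 \<cdot>\<^sub>1 \<rho>2" unfolding \<Phi>_def src unfolding SS d2(2) ..
    show ?thesis using *[OF _ _ q1 D1(4)] *[OF _ _ q2 D2(4)] by linarith
  qed
  \<comment> \<open>As \<open>\<kappa>1\<close> has the empty word, \<open>p\<close> is the offset
    of the second interval from the start of the first.\<close>
  define p where "p = length (word2 \<kappa>2)"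
  have e: "M1 @ word2 \<rho>1 = word2 \<kappa>2 @ M2 @ word2 \<rho>2" using w1 w2 K1 by simp
  \<comment> \<open>Otherwise the nonempty \<open>M2\<close> would lie in the word of
    \<open>\<rho>1\<close>, so the word of \<open>\<rho>2\<close> would be empty and the branching
    independent.\<close>
  have p: "p < length M1"
  proof (rule ccontr)
    assume "\<not> p < length M1"
    hence le: "length M1 \<le> length (word2 \<kappa>2)" by (simp add: p_def)
    have "length (word2 \<rho>1) \<ge> length M2 + length (word2 \<rho>2)"
      using arg_cong[OF e, of length] le by simp
    hence "word2 \<rho>1 \<noteq> []" using M_ne(2) by auto
    hence "word2 \<rho>2 = []" using R by simp
    thus False using ind disjoint_independent[OF A c1 c2 S src K1] le by (simp add: M)
  qed
  have K2: "word2 \<kappa>2 = take p M1" using arg_cong[OF e, of "take p"] p by (simp add: p_def)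
  \<comment> \<open>If the word of \<open>\<rho>2\<close> is empty, the source ends with
    \<open>M2\<close>, whose first \<open>length M1 - p\<close> whiskers already belong to
    \<open>M1\<close>. In \<open>R2\<close> the roles are exchanged, and \<open>M2\<close> then ends
    at position \<open>p + length M2\<close> of \<open>M1\<close>.\<close>
  have R1: "word2 \<rho>1 = [] \<or> word2 \<rho>1 = drop (length M1 - p) M2"
    using R arg_cong[OF e, of "drop (length M1)"] p by (auto simp: p_def)
  have R2: "word2 \<rho>2 = [] \<or> word2 \<rho>2 = drop (p + length M2) M1"
    using R arg_cong[OF e, of "drop (p + length M2)"] by (auto simp: p_def)
  \<comment> \<open>The first whisker of the second interval is the shared one; it exists because
    \<open>M2\<close> is nonempty.\<close>
  have "M1 ! p = M2 ! 0"
    using arg_cong[OF e, of "\<lambda>X. X ! p"] p M_ne by (simp add: nth_append p_def)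
  then obtain x where x: "x \<in> set M1" "x \<in> set M2" using p M_ne(2) by (metis length_greater_0_conv nth_mem)
  obtain a1 \<alpha> b1 where x1: "(a1, \<alpha>, b1) \<in> set (srword A1)" "x = (u1 @ a1, \<alpha>, b1 @ v1)"
    using x(1) set_wrapD unfolding M by metis
  obtain a2 b2 where x2: "(a2, \<alpha>, b2) \<in> set (srword A2)" "u1 @ a1 = u2 @ a2" "b1 @ v1 = b2 @ v2"
    using x(2) x1(2) set_wrapD unfolding M by (metis prod.inject)
  obtain c y1 y2 where c: "u1 = c @ y1" "u2 = c @ y2" "y1 = [] \<or> y2 = []" using common_prefix[OF x2(2)] by metis
  obtain d z1 z2 where d: "v1 = z1 @ d" "v2 = z2 @ d" "z1 = [] \<or> z2 = []" using common_suffix[OF x2(3)] by metis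
  have sr1: "sr 1 S1 = wh l1 (sr 1 G1) r1" "fit 1 l1 (sr 1 G1) r1"
    using C1(8) SS word2_Nil_cmp1(2)[OF C1(2) K1] wh(4,5)[OF C1(1), of 1 Minus] by simp_all
  have f: "word1 (sr 1 S1) = u1 @ word1 (sr 1 G1) @ v1" using word1_wh[OF sr1(2)] sr1(1) by (simp add: uv)
  have cd: "c = []" "d = []"
  proof -
    \<comment> \<open>The source is either all of \<open>M1\<close>, or a prefix of
      \<open>M1\<close> followed by \<open>M2\<close>, according to which right end is
      empty.\<close>
    have "\<exists>X. word2 \<Phi> = wrap c d X"
      using R
    proof
      assume "word2 \<rho>1 = []"
      hence "word2 \<Phi> = wrap c d (wrap y1 z1 (srword A1))" using w1 K1 by (simp add: M c d)
      thus ?thesis ..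
    next
      assume "word2 \<rho>2 = []"
      hence "word2 \<Phi> = wrap c d (take p (wrap y1 z1 (srword A1)) @ wrap y2 z2 (srword A2))"
        using w2 K2 by (simp add: M c d wrap_take)
      thus ?thesis ..
    qed
    then obtain X where X: "word2 \<Phi> = wrap c d X" ..
    have "word1 (sr 1 \<Phi>) = c @ (y1 @ word1 (sr 1 G1) @ z1) @ d" using f \<Phi>(2) c d by simp
    then obtain l \<psi> r where h: "fit 2 l \<psi> r" "\<Phi> = wh l \<psi> r" "word1 l = c" "word1 r = d"
      using unwrap[OF \<Phi>(1) X] by metis
    have t1: "seq 2 2 (one (sr 1 \<Phi>)) \<Phi>" "one (sr 1 \<Phi>) \<cdot>\<^sub>1 \<Phi> = \<Phi>"
      using one_cmp1_left[OF \<Phi>(1) _ refl] by simp_all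
    have t2: "seq 2 2 \<Phi> (one (tg 1 \<Phi>))" "\<Phi> \<cdot>\<^sub>1 one (tg 1 \<Phi>) = \<Phi>"
      using one_cmp1_right[OF \<Phi>(1) _ refl] by simp_all
    have ctx: "ctx 2 (one (sr 1 \<Phi>)) l \<psi> r (one (tg 1 \<Phi>))"
      using h(1) t1(1) t2(1) unfolding ctx_def h(2)[symmetric] by simp
    have e: "sr 2 S1 = plug (one (sr 1 \<Phi>)) l \<psi> r (one (tg 1 \<Phi>))"
      unfolding h(2)[symmetric] t1(2) t2(2) by (rule \<Phi>_def[symmetric])
    have o: "word2 (one (sr 1 \<Phi>)) = []" "word2 (one (tg 1 \<Phi>)) = []"
      using word2_one[OF sr1_cell[OF \<Phi>(1)]] by simp_all
    have ww: "word1 l1 = word1 l @ y1" "word1 r1 = z1 @ word1 r" "word1 l2 = word1 l @ y2" "word1 r2 = z2 @ word1 r"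
      using c d h(3,4) uv by simp_all
    have "word1 l = []" by (rule MT(1)[OF ctx e ww]) (simp_all add: o)
    moreover have "word1 r = []" by (rule MT(2)[OF ctx e ww]) (simp_all add: o)
    ultimately show "c = []" "d = []" using h by simp_all
  qed
  have Nil: "[] \<in> lefts" "[] \<in> rights"
    using lefts_prefix[of A1 "[]"] rights_suffix[of A1 _ _ _ "[]"] A(1) x1(1) by auto
  \<comment> \<open>If \<open>u1\<close> is empty, then \<open>u2\<close> is a prefix of
    \<open>a1\<close>, which occurs in the source of \<open>A1\<close>; if \<open>u2\<close> is
    empty, then \<open>u1\<close> is a prefix of \<open>a2\<close>. The sets of right contexts are
    treated in the same way.\<close>
  have U: "u1 \<in> lefts" "u2 \<in> lefts"
    using c(3) x1(1) x2(1,2) Nil(1) lefts_prefix[OF A(2), of u1] lefts_prefix[OF A(1), of u2] unfolding c(1,2) cd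
    by auto
  have V: "v1 \<in> rights" "v2 \<in> rights"
    using d(3) x1(1) x2(1,3) Nil(2) rights_suffix[OF A(2), of _ _ _ v1] rights_suffix[OF A(1), of _ _ _ v2] unfolding d(1,2) cd
    by auto
  have MM: "M1 \<in> redexes" "M2 \<in> redexes"
    unfolding redexes_def M using A U V by force+
  have pre: "take i M1 \<in> prefixes" for i
    unfolding prefixes_def by (rule UN_I[OF MM(1)]) (auto intro: image_eqI[of _ _ "Orderings.min i (length M1)"] simp: min_def)
  have suf: "drop i m \<in> suffixes" if "m \<in> redexes" for i m
    unfolding suffixes_def by (rule UN_I[OF that]) (auto intro: image_eqI[of _ _ "Orderings.min i (length m)"] simp: min_def)
  have pK: "word2 \<kappa>1 \<in> prefixes" "word2 \<kappa>2 \<in> prefixes" using pre[of 0] pre[of p] K1 K2 by simp_all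
  have Ns: "[] \<in> suffixes" using suf[OF MM(1), of "length M1"] by simp
  have pR: "word2 \<rho>1 \<in> suffixes" "word2 \<rho>2 \<in> suffixes" using R1 R2 suf[OF MM(1)] suf[OF MM(2)] Ns by auto
  have F: "word1 (sr 1 \<kappa>1) \<in> sources" "word1 (sr 1 \<kappa>2) \<in> sources"
  proof -
    have "u1 @ word1 (sr 1 G1) @ v1 \<in> sources" unfolding sources_def G using A U V by force
    thus "word1 (sr 1 \<kappa>1) \<in> sources" "word1 (sr 1 \<kappa>2) \<in> sources"
      using f \<Phi>(2,3) C1(8) C2(8) SS by simp_all
  qed
  have l12: "sr 0 l1 = sr 0 l2" using \<Phi>(4,5)[of Minus] C1(9) C2(9) SS by simp
  have "\<exists>B\<in>gens3 Q. sr 0 l1 = sr 0 (gen3 Q B)"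
    using c(3)
  proof
    assume "y1 = []"
    hence "sr 0 l1 = tg 0 l1" using word1_Nil(2)[OF fitD(1)[OF C1(1)]] c cd uv by simp
    thus ?thesis using fitD(5)[OF C1(1)] A G by auto
  next
    assume "y2 = []"
    hence "sr 0 l2 = tg 0 l2" using word1_Nil(2)[OF fitD(1)[OF C2(1)]] c cd uv by simp
    thus ?thesis using fitD(5)[OF C2(1)] A G l12 by auto
  qed
  then obtain B where B: "B \<in> gens3 Q" "sr 0 l1 = sr 0 (gen3 Q B)" ..
  have "coded (sr 0 (gen3 Q B)) (word1 (sr 1 \<kappa>1)) (word2 \<kappa>1) u1 A1 v1 (word2 \<rho>1) S1"
    unfolding B(2)[symmetric] S uv by (rule coded.intros[OF A(1) c1])
  from bounded_stepsI[OF this A(1) B(1) F(1) pK(1) U(1) V(1) pR(1)] show "S1 \<in> bounded_steps" .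
  have "coded (sr 0 (gen3 Q B)) (word1 (sr 1 \<kappa>2)) (word2 \<kappa>2) u2 A2 v2 (word2 \<rho>2) S2"
    unfolding B(2)[symmetric] l12 S uv by (rule coded.intros[OF A(2) c2])
  from bounded_stepsI[OF this A(2) B(1) F(2) pK(2) U(2) V(2) pR(2)] show "S2 \<in> bounded_steps" .
qed

lemma minimal_sym: "minimal Q S1 S2 \<Longrightarrow> minimal Q S2 S1"
  unfolding minimal_def local_branching_def by metis

text \<open>The lengths of \<open>\<kappa>1\<close> and \<open>\<kappa>2\<close> decide which step
  comes first. Exchanging the steps is harmless, as minimality is symmetric and independence is
  excluded in both orders.\<close>

lemma critical_in_bounded_steps:
  assumes ne: "\<And>A. A \<in> gens3 Q \<Longrightarrow> srword A \<noteq> []" and cr: "critical Q S1 S2"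
  shows "S1 \<in> bounded_steps \<and> S2 \<in> bounded_steps"
proof -
  have lb: "rewriting_step Q S1" "rewriting_step Q S2" "sr 2 S1 = sr 2 S2" and min: "minimal Q S1 S2"
    and ind: "\<not> independent Q S1 S2" "\<not> independent Q S2 S1"
    using cr by (simp_all add: critical_def local_branching_def)
  obtain A1 \<kappa>1 l1 r1 \<rho>1 where 1: "A1 \<in> gens3 Q" "ctx 3 \<kappa>1 l1 (gen3 Q A1) r1 \<rho>1" "S1 = plug \<kappa>1 l1 (gen3 Q A1) r1 \<rho>1"
    using lb(1) rewriting_step_iff by blast
  obtain A2 \<kappa>2 l2 r2 \<rho>2 where 2: "A2 \<in> gens3 Q" "ctx 3 \<kappa>2 l2 (gen3 Q A2) r2 \<rho>2" "S2 = plug \<kappa>2 l2 (gen3 Q A2) r2 \<rho>2"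
    using lb(2) rewriting_step_iff by blast
  show ?thesis
  proof (cases "length (word2 \<kappa>1) \<le> length (word2 \<kappa>2)")
    case True
    from bounded_steps_if_not_independent[OF ne 1(1) 2(1) 1(2) 2(2) 1(3) 2(3) lb(3) min ind(1) True] show ?thesis by blast
  next
    case False
    hence "length (word2 \<kappa>2) \<le> length (word2 \<kappa>1)" by simp
    from bounded_steps_if_not_independent[OF ne 2(1) 1(1) 2(2) 1(2) 2(3) 1(3) lb(3)[symmetric] minimal_sym[OF min] ind(2) this]
    show ?thesis by blast
  qed
qed

end

theorem mainTheorem6:
  fixes Q :: "('g0, 'g1, 'g2, 'g3, 'g4) gray"
  assumes "gray_presentation Q"
    and "finite (gens2 Q)"
    and "finite (gens3 Q)"
    and "\<And>A. A \<in> gens3 Q \<Longrightarrow> length2 Q (src Q 2 (gen3 Q A)) > 0"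
  shows "finite {(S1, S2). local_branching Q S1 S2 \<and> critical Q S1 S2}"
proof -
  interpret prepolygraph Q
    using assms(1) by unfold_locales (simp add: gray_presentation_def)
  have ne: "srword A \<noteq> []" if "A \<in> gens3 Q" for A
    using assms(4)[OF that] length2_eq[OF F.bdry_cells[OF gen3_cell[OF that], of 2 Minus]] by auto
  have "{(S1, S2). local_branching Q S1 S2 \<and> critical Q S1 S2} \<subseteq> bounded_steps \<times> bounded_steps"
    using critical_in_bounded_steps[OF ne] by auto
  thus ?thesis using finite_bounded_steps[OF assms(3)] finite_subset by blast
qed

end
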